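(* Let the parameter vector $\boldsymbol{a}=(a_s)_{s\in\mathcal{S}}$, $a_s>0$, be fixed. Consider the sequence of infinite-server systems under the GRAND($\boldsymbol{a}Z$) algorithm, indexed by the scaling parameter $r\to\infty$, and let $\boldsymbol{x}^r(\infty)$ denote the random state of the fluid-scaled process in the stationary regime. Then, as $r\to\infty$, $\boldsymbol{x}^r(\infty)$ converges in distribution to (the deterministic point) $\boldsymbol{x}^{*,\boldsymbol{a}}$, where $\boldsymbol{x}^{*,\boldsymbol{a}}$ is the unique minimizer of $L^{(\boldsymbol{a})}$ over $\mathcal{X}$.
   Context: **Configurations.** There are customer types $i\in\mathcal{I}=\{1,\dots,I\}$ and server types $s\in\mathcal{S}=\{1,\dots,S\}$. For each $s$ there is a finite set $\bar{\mathcal{K}}^s$ of allowed type-$s$ server configurations $\boldsymbol{k}=(k_1,\dots,k_I;s)$ with non-negative integers $k_i$ (a type-$s$ server may simultaneously serve $k_i$ customers of each type $i$). Monotonicity: if $\boldsymbol{k}\in\bar{\mathcal{K}}^s$ and $0\le k_i'\le k_i$ for all $i$, then $(k_1',\dots,k_I';s)\in\bar{\mathcal{K}}^s$. The zero configuration $\boldsymbol{0}^s=(0,\dots,0;s)$ belongs to $\bar{\mathcal{K}}^s$ for each $s$. For each $i$ there is at least one $s$ with $(\boldsymbol{e}_i;s)\in\bar{\mathcal{K}}^s$, where $\boldsymbol{e}_i$ is the $i$-th unit vector. Put $\mathcal{K}^s=\bar{\mathcal{K}}^s\setminus\{\boldsymbol{0}^s\}$, $\bar{\mathcal{K}}=\bigcup_s\bar{\mathcal{K}}^s$,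 $\mathcal{K}=\bigcup_s\mathcal{K}^s$. For $\boldsymbol{k}\in\bar{\mathcal{K}}$, $\boldsymbol{k}\pm\boldsymbol{e}_i$ denotes $\boldsymbol{k}$ with $k_i$ replaced by $k_i\pm1$ (same server type). **Infinite-server system.** There are infinitely many servers of each type. Customers of type $i$ arrive as a Poisson process of rate $\Lambda_i>0$, independent over $i$; service times are independent (of each other and of the arrivals), exponential with mean $1/\mu_i$ for type $i$, $\mu_i>0$, and are unaffected by simultaneous service of other customers. Each arriving customer is immediately placed into a server, subject to the packing constraints: a type-$i$ customer may be added to a server in configuration $\boldsymbol{k}\in\bar{\mathcal{K}}$ iff $\boldsymbol{k}+\boldsymbol{e}_i\in\mathcal{K}$, and the configuration then becomes $\boldsymbol{k}+\boldsymbol{e}_i$. When a type-$i$ service is completed at a server in configuration $\boldsymbol{k}$, the customer leaves and the configuration becomes $\boldsymbol{k}-\boldsymbol{e}_i$. $X_{\boldsymbol{k}}(t)$ is the number of servers in configuration $\boldsymbol{k}\in\mathcal{K}$ at time $t$; the state is $\boldsymbol{X}(t)=\{X_{\boldsymbol{k}}(t),\boldsymbol{k}\in\mathcal{K}\}$. **GRAND($\boldsymbol{a}Z$).** Let $Z(t)=\sum_i\sum_{\boldsymbol{k}\in\mathcal{K}}k_iX_{\boldsymbol{k}}(t)$ be the total number of customers. At any time $t$ there is a designated set of $X_{\boldsymbol{0}^s}(t)=\lceil a_sZ(t)\rceil$ empty type-$s$ servers ("$s$-zero-servers") for each $s$. A type-$i$ customer arriving at time $t$ is placed into a server chosen uniformly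 at random among all those zero-servers (of all types) and occupied servers where it can fit, i.e. among $X_{(i)}(t)=\sum_{\boldsymbol{k}\in\bar{\mathcal{K}}:\,\boldsymbol{k}+\boldsymbol{e}_i\in\mathcal{K}}X_{\boldsymbol{k}}(t)$ servers. If $X_{(i)}(t)=0$, the customer is placed into an empty server of an arbitrary fixed type $s$ with $(\boldsymbol{e}_i;s)\in\mathcal{K}^s$. The process $\boldsymbol{X}(\cdot)$ is a continuous-time Markov chain with countable state space, irreducible and positive recurrent; $\boldsymbol{X}(\infty)$ denotes its random state in the stationary regime. **Asymptotic regime.** $r\ge1$ increases to infinity along a discrete sequence. In the system with index $r$, $\Lambda_i=\lambda_ir$ with fixed $\lambda_i>0$, while $\mu_i$ and the configuration sets are fixed. Let $\rho_i=\lambda_i/\mu_i$, normalized so that $\sum_i\rho_i=1$. $\boldsymbol{X}^r(\cdot)$ is the corresponding process, and $\boldsymbol{x}^r(t)=\boldsymbol{X}^r(t)/r$, $\boldsymbol{x}^r(\infty)=\boldsymbol{X}^r(\infty)/r$. **Limit point.** $\mathcal{X}=\{\boldsymbol{x}\in\mathbb{R}_+^{|\mathcal{K}|}:\ \sum_{\boldsymbol{k}\in\mathcal{K}}k_ix_{\boldsymbol{k}}=\rho_i\ \forall i\in\mathcal{I}\}$. With $c_{\boldsymbol{k}}=\prod_ik_i!$ and $0\log0=0$, $$L^{(\boldsymbol{a})}(\boldsymbol{x})=\sum_{s\in\mathcal{S}}\sum_{\boldsymbol{k}\in\mathcal{K}^s}x_{\boldsymbol{k}}\log\frac{x_{\boldsymbol{k}}c_{\boldsymbol{k}}}{e\,a_s},$$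 which is strictly convex on $\mathbb{R}_+^{|\mathcal{K}|}$, and $\boldsymbol{x}^{*,\boldsymbol{a}}$ is its unique minimizer over $\mathcal{X}$. *)

theory Defs
  imports "HOL-Probability.Probability"
begin

subsection \<open>Continuous-time Markov chains on a countable set\<close>

text \<open>
  A chain on the countable set S is given by its transition rates q x y for x, y in S with y
  different from x; diagonal values of q are never used. The infinite sum below is only meaningful
  for summable rates; in the chain defined further down only finitely many rates out of a state
  are nonzero.
\<close>

definition exit_rate :: "'x set \<Rightarrow> ('x \<Rightarrow> 'x \<Rightarrow> real) \<Rightarrow> 'x \<Rightarrow> real" where
  "exit_rate S q x = (\<Sum>\<^sub>\<infinity>y\<in>S - {x}. q x y)"

text \<open>
  Probability that the chain started in x is in y at time t and has made exactly n jumps in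
  [0, t]; the recursion conditions on the time u of the last jump and on the state z left by it.
\<close>

primrec n_jump_prob ::
  "'x set \<Rightarrow> ('x \<Rightarrow> 'x \<Rightarrow> real) \<Rightarrow> nat \<Rightarrow> real \<Rightarrow> 'x \<Rightarrow> 'x \<Rightarrow> ennreal" where
  "n_jump_prob S q 0 t x y = (if x = y then ennreal (exp (- exit_rate S q x * t)) else 0)"
| "n_jump_prob S q (Suc n) t x y =
     (\<integral>\<^sup>+ u. (\<integral>\<^sup>+ z. n_jump_prob S q n u x z * ennreal (q z y * exp (- exit_rate S q y * (t - u)))
              \<partial>count_space (S - {y})) * indicator {0..t} u \<partial>lborel)"

definition transition_prob ::
  "'x set \<Rightarrow> ('x \<Rightarrow> 'x \<Rightarrow> real) \<Rightarrow> real \<Rightarrow> 'x \<Rightarrow> 'x \<Rightarrow> ennreal" where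
  "transition_prob S q t x y = (\<Sum>n. n_jump_prob S q n t x y)"

definition stationary_distribution ::
  "'x set \<Rightarrow> ('x \<Rightarrow> 'x \<Rightarrow> real) \<Rightarrow> 'x pmf \<Rightarrow> bool" where
  "stationary_distribution S q p \<longleftrightarrow> set_pmf p \<subseteq> S \<and>
     (\<forall>t\<ge>0. \<forall>y\<in>S. (\<integral>\<^sup>+ x. transition_prob S q t x y \<partial>measure_pmf p) = ennreal (pmf p y))"


subsection \<open>Convergence in distribution\<close>

definition converges_in_distribution ::
  "(nat \<Rightarrow> 'a::topological_space pmf) \<Rightarrow> 'a pmf \<Rightarrow> bool" where
  "converges_in_distribution p q \<longleftrightarrow>
     (\<forall>f :: 'a \<Rightarrow> real. continuous_on UNIV f \<and> bounded (range f) \<longrightarrow>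
        (\<lambda>n. measure_pmf.expectation (p n) f) \<longlonglongrightarrow> measure_pmf.expectation q f)"


subsection \<open>Server configurations\<close>

text \<open>
  The finite types 'i and 's are the sets of customer types and of server types. A configuration
  (k; s) is a pair, and the set C of allowed configurations contains the zero configurations.
\<close>

type_synonym ('i, 's) config = "('i \<Rightarrow> nat) \<times> 's"

definition unit_vec :: "'i \<Rightarrow> 'i \<Rightarrow> nat" where
  "unit_vec i = (\<lambda>j. if j = i then 1 else 0)"

definition packing_constraints :: "('i::finite, 's::finite) config set \<Rightarrow> bool" where
  "packing_constraints C \<longleftrightarrow>
     finite C \<and>
     (\<forall>k k' s. (k, s) \<in> C \<and> (\<forall>i. k' i \<le> k i) \<longrightarrow> (k', s) \<in> C) \<and>
     (\<forall>s. ((\<lambda>_. 0), s) \<in> C) \<and>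
     (\<forall>i. \<exists>s. (unit_vec i, s) \<in> C)"

definition nonzero_configs :: "('i, 's) config set \<Rightarrow> ('i, 's) config set" where
  "nonzero_configs C = {k \<in> C. fst k \<noteq> (\<lambda>_. 0)}"

definition add_customer :: "'i \<Rightarrow> ('i, 's) config \<Rightarrow> ('i, 's) config" where
  "add_customer i k = ((fst k)(i := fst k i + 1), snd k)"

definition remove_customer :: "'i \<Rightarrow> ('i, 's) config \<Rightarrow> ('i, 's) config" where
  "remove_customer i k = ((fst k)(i := fst k i - 1), snd k)"


subsection \<open>The infinite-server system under GRAND(aZ)\<close>

text \<open>Vectors indexed by the nonzero configurations are total functions vanishing elsewhere.\<close>

type_synonym ('i, 's) state = "('i, 's) config \<Rightarrow> nat"

definition states :: "('i, 's) config set \<Rightarrow> ('i, 's) state set" where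
  "states C = {X. \<forall>k. k \<notin> nonzero_configs C \<longrightarrow> X k = 0}"

definition total_customers :: "('i::finite, 's) config set \<Rightarrow> ('i, 's) state \<Rightarrow> nat" where
  "total_customers C X = (\<Sum>i\<in>UNIV. \<Sum>k\<in>nonzero_configs C. fst k i * X k)"

text \<open>
  Number of servers in configuration k available to the algorithm, the designated zero-servers
  included.
\<close>

definition servers ::
  "('i::finite, 's) config set \<Rightarrow> ('s \<Rightarrow> real) \<Rightarrow> ('i, 's) state \<Rightarrow> ('i, 's) config \<Rightarrow> nat" where
  "servers C a X k =
     (if fst k = (\<lambda>_. 0) then nat \<lceil>a (snd k) * real (total_customers C X)\<rceil> else X k)"

definition fitting_configs :: "('i, 's) config set \<Rightarrow> 'i \<Rightarrow> ('i, 's) config set" where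
  "fitting_configs C i = {k \<in> C. add_customer i k \<in> nonzero_configs C}"

definition available_servers ::
  "('i::finite, 's) config set \<Rightarrow> ('s \<Rightarrow> real) \<Rightarrow> ('i, 's) state \<Rightarrow> 'i \<Rightarrow> nat" where
  "available_servers C a X i = (\<Sum>k\<in>fitting_configs C i. servers C a X k)"

text \<open>
  Probability that a type-i customer arriving in state X is placed into a server in configuration
  k; the server type used when no server is available is given by s0.
\<close>

definition placement_prob ::
  "('i::finite, 's) config set \<Rightarrow> ('s \<Rightarrow> real) \<Rightarrow> ('i \<Rightarrow> 's) \<Rightarrow> ('i, 's) state \<Rightarrow> 'i
     \<Rightarrow> ('i, 's) config \<Rightarrow> real" where
  "placement_prob C a s0 X i k =
     (if available_servers C a X i = 0 then (if k = ((\<lambda>_. 0), s0 i) then 1 else 0)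
      else if k \<in> fitting_configs C i
        then real (servers C a X k) / real (available_servers C a X i)
      else 0)"

text \<open>
  State after one server has changed its configuration from k to k'. Zero configurations are not
  counted in the state. The subtraction truncates only if k is nonzero and X k = 0, in which case
  the corresponding rate below vanishes.
\<close>

definition reconfigure ::
  "('i, 's) config set \<Rightarrow> ('i, 's) config \<Rightarrow> ('i, 's) config \<Rightarrow> ('i, 's) state
     \<Rightarrow> ('i, 's) state" where
  "reconfigure C k k' X =
     (\<lambda>j. if j \<in> nonzero_configs C
          then X j - (if j = k then 1 else 0) + (if j = k' then 1 else 0) else 0)"

text \<open>Lam and mu are the vectors of arrival rates and of service rates.\<close>

definition grand_rate ::
  "('i::finite, 's) config set \<Rightarrow> ('s \<Rightarrow> real) \<Rightarrow> ('i \<Rightarrow> 's) \<Rightarrow> ('i \<Rightarrow> real) \<Rightarrow> ('i \<Rightarrow> real)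
     \<Rightarrow> ('i, 's) state \<Rightarrow> ('i, 's) state \<Rightarrow> real" where
  "grand_rate C a s0 Lam mu X Y =
     (\<Sum>i\<in>UNIV. \<Sum>k\<in>C. if reconfigure C k (add_customer i k) X = Y
        then Lam i * placement_prob C a s0 X i k else 0) +
     (\<Sum>i\<in>UNIV. \<Sum>k\<in>nonzero_configs C. if reconfigure C k (remove_customer i k) X = Y
        then mu i * real (fst k i) * real (X k) else 0)"

definition fluid_scaled :: "real \<Rightarrow> ('i, 's) state pmf \<Rightarrow> (('i, 's) config \<Rightarrow> real) pmf" where
  "fluid_scaled r p = map_pmf (\<lambda>X k. real (X k) / r) p"


subsection \<open>The limit point\<close>

definition feasible_set ::
  "('i, 's) config set \<Rightarrow> ('i \<Rightarrow> real) \<Rightarrow> (('i, 's) config \<Rightarrow> real) set" where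
  "feasible_set C rho =
     {x. (\<forall>k\<in>nonzero_configs C. 0 \<le> x k) \<and> (\<forall>k. k \<notin> nonzero_configs C \<longrightarrow> x k = 0) \<and>
         (\<forall>i. (\<Sum>k\<in>nonzero_configs C. real (fst k i) * x k) = rho i)}"

text \<open>The convention 0 log 0 = 0 holds since a summand with x k = 0 is multiplied by 0.\<close>

definition L_fun ::
  "('i::finite, 's::finite) config set \<Rightarrow> ('s \<Rightarrow> real) \<Rightarrow> (('i, 's) config \<Rightarrow> real) \<Rightarrow> real" where
  "L_fun C a x =
     (\<Sum>s\<in>UNIV. \<Sum>k | k \<in> nonzero_configs C \<and> snd k = s.
        x k * ln (x k * (\<Prod>i\<in>UNIV. fact (fst k i)) / (exp 1 * a s)))"

end

theory Submission
  imports Defs "HOL-Real_Asymp.Real_Asymp"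
begin

text \<open>
  A stationary distribution balances probability flow, so the expected drift \<open>E (drift r f)\<close> of
  every function \<open>f\<close> that does not grow too fast is zero. The convergence is obtained from this
  identity alone, with three kinds of test functions \<open>f\<close>; no trajectory of the process is followed.

  With the indicator of \<open>Z \<le> n\<close> the identity says that the flow from \<open>Z = n\<close> up to \<open>Z = n + 1\<close> equals
  the flow down (\<open>cut_balance\<close>). Departure rates grow linearly in \<open>Z\<close>, so the tail of \<open>Z\<close> decays at
  least as fast as that of a Poisson variable, and all functions of polynomial growth in \<open>Z\<close> become admissible. With
  the number \<open>Y i\<close> of type-\<open>i\<close> customers and its square the identity gives mean and variance
  \<open>rho i * r\<close> (\<open>Y_mean\<close>, \<open>Y_variance\<close>), so that the loads are \<open>rho i * r\<close> up to an error of order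
  \<open>sqrt r\<close>, called \<open>V r X\<close> below.

  The third test function is a discrete version of \<open>r\<close> times \<open>L_fun\<close>, in which \<open>x ln x - x\<close> is replaced
  by the logarithm of a factorial. Its increment along a transition between \<open>k\<close> and \<open>k + e_i\<close> is then
  exactly the logarithm of a ratio. Let \<open>q k\<close> be the probability that an arriving type-\<open>i\<close> customer
  finds its server in configuration \<open>k\<close>, and \<open>p k\<close> the probability that a departing type-\<open>i\<close> customer
  leaves its server in configuration \<open>k\<close>. Since \<open>lam i * r\<close> is close to \<open>mu i * Y i X\<close>, the drift is
  \<open>-r * (\<Sum>i. lam i * (\<Sum>k. (q k - p k) * ln (q k / p k)))\<close> up to an error of order \<open>sqrt r * ln r\<close>
  in the mean (\<open>drift_bound\<close>). The inner sum is a symmetrised relative entropy and is at least the sum of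
  \<open>(q k - p k)^2\<close>. As the mean drift is zero, the mean of these squares is of order \<open>ln r / sqrt r\<close>
  (\<open>imbalance_mean\<close>): in the limit arrivals and departures balance across every single edge.

  Edge balance and the load constraints together say that a continuous nonnegative function, \<open>defect\<close>,
  vanishes at the limiting point. A zero of \<open>defect\<close> has the product form
  \<open>x k = a (snd k) * (\<Prod>i. w i ^ k i / fact (k i))\<close>, so the gradient of \<open>L_fun\<close> there is a combination of
  the load constraints, and convexity makes it the strict minimizer over the feasible set
  (\<open>zero_defect_strict_min\<close>). A zero exists because \<open>defect\<close> attains its infimum over a compact box in
  which the scaled states come arbitrarily close to zero defect. Points of the box outside a
  neighbourhood of the minimizer have defect bounded away from zero, so by Markov's inequality the scaled
  stationary state lies in the neighbourhood with probability tending to one.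
\<close>

section \<open>Balance and zero mean drift in a stationary Markov chain\<close>

lemma borel_measurable_nn_integral_countable:
  fixes f :: "'a \<Rightarrow> 'b \<Rightarrow> ennreal"
  assumes A: "countable A" and f [measurable]: "\<And>z. z \<in> A \<Longrightarrow> (\<lambda>u. f u z) \<in> borel_measurable M"
  shows "(\<lambda>u. \<integral>\<^sup>+z. f u z \<partial>count_space A) \<in> borel_measurable M"
proof -
  interpret sigma_finite_measure "count_space A"
    by (rule sigma_finite_measure_count_space_countable[OF A])
  have "(\<lambda>v. f (fst v) (snd v)) \<in> borel_measurable (M \<Otimes>\<^sub>M count_space A)"
    by (rule measurable_compose_countable'[where f="\<lambda>z v. f (fst v) z" and g=snd and I=A, OF _ _ A])
      simp_all
  then show ?thesis by (intro borel_measurable_nn_integral) (simp add: case_prod_beta')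
qed

lemma n_jump_prob_measurable:
  assumes "countable S"
  shows "(\<lambda>t. n_jump_prob S q n t x y) \<in> borel_measurable borel"
proof (induction n arbitrary: y)
  case 0
  show ?case by simp
next
  case (Suc n)
  have [measurable]: "(\<lambda>t. n_jump_prob S q n t x z) \<in> borel_measurable borel" for z
    by (rule Suc)
  have 2: "(\<lambda>v. \<integral>\<^sup>+z. n_jump_prob S q n (snd v) x z
        * ennreal (q z y * exp (- exit_rate S q y * (fst v - snd v))) \<partial>count_space (S - {y}))
      \<in> borel_measurable (borel \<Otimes>\<^sub>M borel)"
    by (rule borel_measurable_nn_integral_countable) (use assms in auto)
  have 3: "indicator {0..t} u = (if 0 \<le> u \<and> u \<le> t then 1 else 0 :: ennreal)" for t u :: real
    by simp
  have 4: "(\<lambda>(t, u). (\<integral>\<^sup>+z. n_jump_prob S q n u x z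
        * ennreal (q z y * exp (- exit_rate S q y * (t - u))) \<partial>count_space (S - {y}))
        * indicator {0..t} u) \<in> borel_measurable (borel \<Otimes>\<^sub>M lborel)"
    unfolding 3 using 2 by (simp add: case_prod_beta') measurable
  show ?case
    using sigma_finite_measure.borel_measurable_nn_integral[OF sigma_finite_lborel 4] by simp
qed

text \<open>
  The recursion for the number of jumps conditions on the last jump, so summing it over all numbers of
  jumps yields the forward equation in integrated form.
\<close>

lemma transition_prob_forward_equation:
  assumes S: "countable S" 
  shows "transition_prob S q t x y =
    (if x = y then ennreal (exp (- exit_rate S q x * t)) else 0) +
    (\<integral>\<^sup>+u. (\<integral>\<^sup>+z. transition_prob S q u x z
        * ennreal (q z y * exp (- exit_rate S q y * (t - u))) \<partial>count_space (S - {y}))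
      * indicator {0..t} u \<partial>lborel)"
proof -
  let ?w = "\<lambda>z u. ennreal (q z y * exp (- exit_rate S q y * (t - u)))"
  have m [measurable]: "(\<lambda>u. n_jump_prob S q n u x z) \<in> borel_measurable borel" for n z
    by (rule n_jump_prob_measurable[OF S])
  have m2 [measurable]: "(\<lambda>u. \<integral>\<^sup>+z. n_jump_prob S q n u x z * ?w z u \<partial>count_space (S - {y}))
      \<in> borel_measurable borel" for n
    by (rule borel_measurable_nn_integral_countable) (use assms in auto)
  have "transition_prob S q t x y = n_jump_prob S q 0 t x y + (\<Sum>n. n_jump_prob S q (Suc n) t x y)"
    unfolding transition_prob_def
    by (subst suminf_offset[of _ 1]) (simp_all add: add.commute)
  also have "(\<Sum>n. n_jump_prob S q (Suc n) t x y) =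
      (\<integral>\<^sup>+u. (\<Sum>n. (\<integral>\<^sup>+z. n_jump_prob S q n u x z * ?w z u \<partial>count_space (S - {y}))
        * indicator {0..t} u) \<partial>lborel)"
    unfolding n_jump_prob.simps
    using m2 by (subst nn_integral_suminf) (auto intro!: borel_measurable_times_ennreal)
  also have "\<dots> = (\<integral>\<^sup>+u. (\<integral>\<^sup>+z. transition_prob S q u x z * ?w z u \<partial>count_space (S - {y}))
        * indicator {0..t} u \<partial>lborel)"
    unfolding transition_prob_def
    by (simp add: ennreal_suminf_multc nn_integral_suminf[symmetric])
  finally show ?thesis by simp
qed

lemma nn_integral_pmf_eq_count_space:
  assumes "set_pmf p \<subseteq> S"
  shows "(\<integral>\<^sup>+x. f x \<partial>measure_pmf p) = (\<integral>\<^sup>+x. ennreal (pmf p x) * f x \<partial>count_space S)"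
  unfolding nn_integral_measure_pmf
  by (rule nn_integral_count_space_eq) (use assms in \<open>auto simp: set_pmf_iff\<close>)

text \<open>
  Integrating the forward equation at time \<open>t = 1\<close> against the stationary \<open>p\<close> removes all transition
  probabilities: with \<open>e\<close> the exit rate of \<open>y\<close> and \<open>B\<close> the total flow into \<open>y\<close> it becomes
  \<open>p y = p y * exp (-e) + B * (1 - exp (-e)) / e\<close>, which is \<open>p y * e = B\<close>. It matters that the time
  integral conditions on the last jump: conditioning on the first one would leave the unknown
  transition probabilities in place.
\<close>

lemma stationary_balance:
  assumes S: "countable S" and st: "stationary_distribution S q p" and y: "y \<in> S"
    and e0: "exit_rate S q y \<ge> 0" and q: "\<And>x. q x y \<ge> 0"
  shows "ennreal (pmf p y * exit_rate S q y) = (\<integral>\<^sup>+z. ennreal (pmf p z * q z y) \<partial>count_space (S - {y}))"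
proof -
  define e where "e = exit_rate S q y"
  define B where "B = (\<integral>\<^sup>+z. ennreal (pmf p z * q z y) \<partial>count_space (S - {y}))"
  have sub: "set_pmf p \<subseteq> S"
    and inv: "\<And>t z. t \<ge> 0 \<Longrightarrow> z \<in> S \<Longrightarrow> (\<integral>\<^sup>+x. transition_prob S q t x z \<partial>measure_pmf p) = ennreal (pmf p z)"
    using st unfolding stationary_distribution_def by auto
  have m [measurable]: "(\<lambda>u. transition_prob S q u x z) \<in> borel_measurable borel" for x z
    unfolding transition_prob_def using n_jump_prob_measurable[OF S] by measurable
  let ?w = "\<lambda>z u. ennreal (q z y * exp (- e * (1 - u)))"
  have m2 [measurable]: "(\<lambda>u. \<integral>\<^sup>+z. transition_prob S q u x z * ?w z u \<partial>count_space (S - {y}))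
      \<in> borel_measurable borel" for x
    by (rule borel_measurable_nn_integral_countable) (use assms in auto)
  have m3: "(\<lambda>u. (\<integral>\<^sup>+z. transition_prob S q u x z * ?w z u \<partial>count_space (S - {y}))
      * indicator {0..1} u) \<in> borel_measurable lborel" for x
    by (intro borel_measurable_times_ennreal) (use m2 in auto)
  have flow: "(\<integral>\<^sup>+x. (\<integral>\<^sup>+z. transition_prob S q u x z * ?w z u \<partial>count_space (S - {y})) \<partial>measure_pmf p)
      = B * ennreal (exp (- e * (1 - u)))" if u: "0 \<le> u" for u
  proof -
    have "(\<integral>\<^sup>+x. (\<integral>\<^sup>+z. transition_prob S q u x z * ?w z u \<partial>count_space (S - {y})) \<partial>measure_pmf p)
        = (\<integral>\<^sup>+z. (\<integral>\<^sup>+x. transition_prob S q u x z * ?w z u \<partial>measure_pmf p) \<partial>count_space (S - {y}))"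
      by (rule nn_integral_count_space_nn_integral) (use S in auto)
    also have "\<dots> = (\<integral>\<^sup>+z. ennreal (pmf p z) * ?w z u \<partial>count_space (S - {y}))"
      by (rule nn_integral_cong) (simp add: nn_integral_multc inv[OF u])
    also have "\<dots> = (\<integral>\<^sup>+z. ennreal (pmf p z * q z y) * ennreal (exp (- e * (1 - u))) \<partial>count_space (S - {y}))"
      by (rule nn_integral_cong) (simp add: ennreal_mult[symmetric] q mult.assoc)
    finally show ?thesis by (simp add: nn_integral_multc B_def)
  qed
  have "ennreal (pmf p y) = (\<integral>\<^sup>+x. transition_prob S q 1 x y \<partial>measure_pmf p)"
    by (rule inv[symmetric]) (use y in auto)
  also have "\<dots> = (\<integral>\<^sup>+x. (if x = y then ennreal (exp (- e)) else 0) \<partial>measure_pmf p) +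
     (\<integral>\<^sup>+x. (\<integral>\<^sup>+u. (\<integral>\<^sup>+z. transition_prob S q u x z * ?w z u \<partial>count_space (S - {y}))
      * indicator {0..1} u \<partial>lborel) \<partial>measure_pmf p)"
    by (subst transition_prob_forward_equation[OF S], subst nn_integral_add)
       (auto simp: e_def intro!: arg_cong2[where f="(+)"] nn_integral_cong)
  also have "(\<integral>\<^sup>+x. (if x = y then ennreal (exp (- e)) else 0) \<partial>measure_pmf p)
      = (\<integral>\<^sup>+x. ennreal (exp (- e)) * indicator {y} x \<partial>measure_pmf p)"
    by (rule nn_integral_cong) auto
  also have "\<dots> = ennreal (pmf p y * exp (- e))"
    by (simp add: nn_integral_cmult_indicator emeasure_pmf_single ennreal_mult mult.commute)
  also have "(\<integral>\<^sup>+x. (\<integral>\<^sup>+u. (\<integral>\<^sup>+z. transition_prob S q u x z * ?w z u \<partial>count_space (S - {y}))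
      * indicator {0..1} u \<partial>lborel) \<partial>measure_pmf p)
    = (\<integral>\<^sup>+u. (\<integral>\<^sup>+x. (\<integral>\<^sup>+z. transition_prob S q u x z * ?w z u \<partial>count_space (S - {y}))
      * indicator {0..1} u \<partial>measure_pmf p) \<partial>lborel)"
    unfolding nn_integral_pmf_eq_count_space[OF sub]
    by (subst nn_integral_count_space_nn_integral[OF S])
       (use m2 m3 in \<open>auto intro!: borel_measurable_times_ennreal nn_integral_cong nn_integral_cmult[symmetric]\<close>)
  also have "\<dots> = (\<integral>\<^sup>+u. B * (ennreal (exp (- e * (1 - u))) * indicator {0..1} u) \<partial>lborel)"
  proof (rule nn_integral_cong)
    fix u :: real
    show "(\<integral>\<^sup>+x. (\<integral>\<^sup>+z. transition_prob S q u x z * ?w z u \<partial>count_space (S - {y}))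
        * indicator {0..1} u \<partial>measure_pmf p) = B * (ennreal (exp (- e * (1 - u))) * indicator {0..1} u)"
    proof (cases "0 \<le> u")
      case True
      have "(\<integral>\<^sup>+x. (\<integral>\<^sup>+z. transition_prob S q u x z * ?w z u \<partial>count_space (S - {y}))
          * indicator {0..1} u \<partial>measure_pmf p)
        = (\<integral>\<^sup>+x. (\<integral>\<^sup>+z. transition_prob S q u x z * ?w z u \<partial>count_space (S - {y})) \<partial>measure_pmf p)
          * indicator {0..1} u"
        by (rule nn_integral_multc) (simp only: measurable_pmf_measure1 space_borel Pi_UNIV UNIV_I)
      then show ?thesis unfolding flow[OF True] by (simp only: mult.assoc)
    qed simp
  qed
  also have "\<dots> = B * (\<integral>\<^sup>+u. ennreal (exp (- e * (1 - u))) * indicator {0..1} u \<partial>lborel)"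
    by (rule nn_integral_cmult) auto
  finally have main: "ennreal (pmf p y) = ennreal (pmf p y * exp (- e)) +
      B * (\<integral>\<^sup>+u. ennreal (exp (- e * (1 - u))) * indicator {0..1} u \<partial>lborel)" .
  show ?thesis
  proof (cases "e = 0")
    case True
    have "ennreal (pmf p y) + 0 = ennreal (pmf p y) + B" using main True by simp
    then have "B = 0" unfolding ennreal_add_left_cancel by simp
    then show ?thesis using True by (simp add: B_def e_def)
  next
    case False
    with e0 have e: "e > 0" by (simp add: e_def)
    have "(\<integral>\<^sup>+u. ennreal (exp (- e * (1 - u))) * indicator {0..1} u \<partial>lborel)
        = ennreal (exp (- e * (1 - 1)) / e - exp (- e * (1 - 0)) / e)"
      by (rule nn_integral_FTC_Icc) (use e in \<open>auto intro!: derivative_eq_intros\<close>)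
    also have "\<dots> = ennreal ((1 - exp (- e)) / e)" using e by (simp add: field_simps)
    finally have I: "(\<integral>\<^sup>+u. ennreal (exp (- e * (1 - u))) * indicator {0..1} u \<partial>lborel)
        = ennreal ((1 - exp (- e)) / e)" .
    have pos: "(1 - exp (- e)) / e > 0" using e by simp
    have "ennreal (pmf p y * exp (- e)) + ennreal (pmf p y * (1 - exp (- e))) = ennreal (pmf p y)"
      using e by (subst ennreal_plus[symmetric]) (auto simp: algebra_simps mult_left_le)
    with main have "ennreal (pmf p y * exp (- e)) + ennreal (pmf p y * (1 - exp (- e)))
        = ennreal (pmf p y * exp (- e)) + B * ennreal ((1 - exp (- e)) / e)"
      unfolding I by (simp only:)
    then have "ennreal (pmf p y * (1 - exp (- e))) = B * ennreal ((1 - exp (- e)) / e)"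
      unfolding ennreal_add_left_cancel by simp
    moreover have "ennreal (pmf p y * (1 - exp (- e))) = ennreal (pmf p y * e) * ennreal ((1 - exp (- e)) / e)"
      using e pos by (subst ennreal_mult[symmetric]) auto
    ultimately have "ennreal (pmf p y * e) * ennreal ((1 - exp (- e)) / e) = B * ennreal ((1 - exp (- e)) / e)"
      by simp
    then have "ennreal (pmf p y * e) = B"
      using pos unfolding mult.commute[of _ "ennreal ((1 - exp (- e)) / e)"] ennreal_mult_cancel_left
      by (simp add: ennreal_eq_0_iff not_less)
    then show ?thesis by (simp add: B_def e_def)
  qed
qed

text \<open>
  Sum the balance equations with weights \<open>g y\<close> and exchange the sums by Tonelli's theorem, which is why
  \<open>g\<close> takes values in the extended nonnegative reals. Transitions that do not change the state are cut out of \<open>\<nu>\<close> because the exit rate does not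
  contain them.
\<close>

lemma stationary_jump_balance:
  fixes \<nu> :: "'j \<Rightarrow> 'x \<Rightarrow> real" and T :: "'j \<Rightarrow> 'x \<Rightarrow> 'x" and g :: "'x \<Rightarrow> ennreal"
  assumes S: "countable S" and J: "finite J"
    and q: "\<And>x y. q x y = (\<Sum>j\<in>J. if T j x = y then \<nu> j x else 0)"
    and \<nu>: "\<And>j x. j \<in> J \<Longrightarrow> \<nu> j x \<ge> 0" and T: "\<And>j x. j \<in> J \<Longrightarrow> x \<in> S \<Longrightarrow> T j x \<in> S"
    and st: "stationary_distribution S q p"
  defines "\<nu>' \<equiv> \<lambda>j x. if T j x = x then 0 else \<nu> j x"
  shows "(\<integral>\<^sup>+x. ennreal (\<Sum>j\<in>J. \<nu>' j x) * g x \<partial>measure_pmf p)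
    = (\<integral>\<^sup>+x. (\<Sum>j\<in>J. ennreal (\<nu>' j x) * g (T j x)) \<partial>measure_pmf p)"
proof -
  have sub: "set_pmf p \<subseteq> S" using st unfolding stationary_distribution_def by auto
  have \<nu>': "\<nu>' j x \<ge> 0" if "j \<in> J" for j x using \<nu>[OF that] by (simp add: \<nu>'_def)
  have q0: "q x y \<ge> 0" for x y unfolding q by (intro sum_nonneg) (use \<nu> in auto)
  have exit: "exit_rate S q x = (\<Sum>j\<in>J. \<nu>' j x)" if x: "x \<in> S" for x
  proof -
    define F where "F = (\<lambda>j. T j x) ` J - {x}"
    have F: "finite F" "F \<subseteq> S - {x}" using J T x by (auto simp: F_def)
    have "exit_rate S q x = (\<Sum>\<^sub>\<infinity>y\<in>F. q x y)"
      unfolding exit_rate_def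
    proof (rule infsum_cong_neutral)
      fix y assume "y \<in> S - {x} - F"
      then have "T j x \<noteq> y" if "j \<in> J" for j using that by (auto simp: F_def)
      then show "q x y = 0" by (simp add: q)
    qed (use F in auto)
    also have "\<dots> = (\<Sum>y\<in>F. \<Sum>j\<in>J. if T j x = y then \<nu> j x else 0)"
      using F by (simp add: q)
    also have "\<dots> = (\<Sum>j\<in>J. \<Sum>y\<in>F. if T j x = y then \<nu> j x else 0)" by (rule sum.swap)
    also have "\<dots> = (\<Sum>j\<in>J. \<nu>' j x)"
      using F by (intro sum.cong) (auto simp: \<nu>'_def F_def)
    finally show ?thesis .
  qed
  have bal: "ennreal (pmf p y) * ennreal (\<Sum>j\<in>J. \<nu>' j y) * g y =
      (\<integral>\<^sup>+x. ennreal (pmf p x) * ((\<Sum>j\<in>J. ennreal (\<nu>' j x) * indicator {T j x} y) * g y) \<partial>count_space S)"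
    if y: "y \<in> S" for y
  proof -
    have "ennreal (pmf p y) * ennreal (\<Sum>j\<in>J. \<nu>' j y) = ennreal (pmf p y * exit_rate S q y)"
      using \<nu>' by (simp add: exit[OF y] ennreal_mult sum_nonneg)
    also have "\<dots> = (\<integral>\<^sup>+x. ennreal (pmf p x * q x y) \<partial>count_space (S - {y}))"
      by (rule stationary_balance[OF S st y]) (use \<nu>' q0 exit[OF y] in \<open>auto intro!: sum_nonneg\<close>)
    also have "\<dots> = (\<integral>\<^sup>+x. ennreal (pmf p x) * (\<Sum>j\<in>J. ennreal (\<nu>' j x) * indicator {T j x} y) \<partial>count_space (S - {y}))"
    proof (rule nn_integral_cong)
      fix x assume x: "x \<in> space (count_space (S - {y}))"
      have "(\<Sum>j\<in>J. ennreal (\<nu>' j x) * indicator {T j x} y) = (\<Sum>j\<in>J. ennreal (if T j x = y then \<nu> j x else 0))"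
        using x by (intro sum.cong) (auto simp: \<nu>'_def)
      also have "\<dots> = ennreal (q x y)" unfolding q using \<nu> by (intro sum_ennreal) auto
      finally show "ennreal (pmf p x * q x y) = ennreal (pmf p x) * (\<Sum>j\<in>J. ennreal (\<nu>' j x) * indicator {T j x} y)"
        using q0 by (simp add: ennreal_mult)
    qed
    also have "\<dots> = (\<integral>\<^sup>+x. ennreal (pmf p x) * (\<Sum>j\<in>J. ennreal (\<nu>' j x) * indicator {T j x} y) \<partial>count_space S)"
      by (rule nn_integral_count_space_eq) (auto simp: \<nu>'_def indicator_def of_bool_def intro!: sum.neutral)
    finally show ?thesis by (simp add: nn_integral_multc[symmetric] mult.assoc)
  qed
  have "(\<integral>\<^sup>+x. ennreal (\<Sum>j\<in>J. \<nu>' j x) * g x \<partial>measure_pmf p) =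
     (\<integral>\<^sup>+y. ennreal (pmf p y) * ennreal (\<Sum>j\<in>J. \<nu>' j y) * g y \<partial>count_space S)"
    by (simp add: nn_integral_pmf_eq_count_space[OF sub] mult.assoc)
  also have "\<dots> = (\<integral>\<^sup>+y. \<integral>\<^sup>+x. ennreal (pmf p x) * ((\<Sum>j\<in>J. ennreal (\<nu>' j x) * indicator {T j x} y) * g y)
      \<partial>count_space S \<partial>count_space S)"
    by (rule nn_integral_cong) (simp add: bal)
  also have "\<dots> = (\<integral>\<^sup>+x. \<integral>\<^sup>+y. ennreal (pmf p x) * ((\<Sum>j\<in>J. ennreal (\<nu>' j x) * indicator {T j x} y) * g y)
      \<partial>count_space S \<partial>count_space S)"
    by (rule nn_integral_count_space_nn_integral) (use S in auto)
  also have "\<dots> = (\<integral>\<^sup>+x. ennreal (pmf p x) * (\<Sum>j\<in>J. ennreal (\<nu>' j x) * g (T j x)) \<partial>count_space S)"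
  proof (rule nn_integral_cong)
    fix x assume "x \<in> space (count_space S)"
    then have x: "x \<in> S" by simp
    have "(\<integral>\<^sup>+y. ((\<Sum>j\<in>J. ennreal (\<nu>' j x) * indicator {T j x} y) * g y) \<partial>count_space S)
        = (\<integral>\<^sup>+y. (\<Sum>j\<in>J. (ennreal (\<nu>' j x) * g (T j x)) * indicator {T j x} y) \<partial>count_space S)"
      by (rule nn_integral_cong) (auto simp: sum_distrib_right indicator_def intro!: sum.cong)
    also have "\<dots> = (\<Sum>j\<in>J. \<integral>\<^sup>+y. (ennreal (\<nu>' j x) * g (T j x)) * indicator {T j x} y \<partial>count_space S)"
      by (rule nn_integral_sum) auto
    also have "\<dots> = (\<Sum>j\<in>J. ennreal (\<nu>' j x) * g (T j x))"
      by (rule sum.cong) (use T x in \<open>auto simp: nn_integral_cmult_indicator emeasure_count_space\<close>)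
    finally show "(\<integral>\<^sup>+y. ennreal (pmf p x) * ((\<Sum>j\<in>J. ennreal (\<nu>' j x) * indicator {T j x} y) * g y) \<partial>count_space S)
        = ennreal (pmf p x) * (\<Sum>j\<in>J. ennreal (\<nu>' j x) * g (T j x))"
      by (simp add: nn_integral_cmult)
  qed
  also have "\<dots> = (\<integral>\<^sup>+x. (\<Sum>j\<in>J. ennreal (\<nu>' j x) * g (T j x)) \<partial>measure_pmf p)"
    by (simp add: nn_integral_pmf_eq_count_space[OF sub])
  finally show ?thesis .
qed

text \<open>
  The integrability assumption makes both sides of the previous identity finite for the positive and
  for the negative part of \<open>f\<close>, so that they may be subtracted.
\<close>

lemma stationary_expected_drift_zero:
  fixes \<nu> :: "'j \<Rightarrow> 'x \<Rightarrow> real" and T :: "'j \<Rightarrow> 'x \<Rightarrow> 'x" and f :: "'x \<Rightarrow> real"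
  assumes S: "countable S" and J: "finite J"
    and q: "\<And>x y. q x y = (\<Sum>j\<in>J. if T j x = y then \<nu> j x else 0)"
    and \<nu>: "\<And>j x. j \<in> J \<Longrightarrow> \<nu> j x \<ge> 0" and T: "\<And>j x. j \<in> J \<Longrightarrow> x \<in> S \<Longrightarrow> T j x \<in> S"
    and st: "stationary_distribution S q p"
    and int: "integrable (measure_pmf p) (\<lambda>x. (\<Sum>j\<in>J. \<nu> j x) * \<bar>f x\<bar>)"
  shows "integrable (measure_pmf p) (\<lambda>x. \<Sum>j\<in>J. \<nu> j x * (f (T j x) - f x))"
    and "measure_pmf.expectation p (\<lambda>x. \<Sum>j\<in>J. \<nu> j x * (f (T j x) - f x)) = 0"
proof -
  define \<nu>' where "\<nu>' = (\<lambda>j x. if T j x = x then 0 else \<nu> j x)"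
  have \<nu>': "0 \<le> \<nu>' j x" "\<nu>' j x \<le> \<nu> j x" if "j \<in> J" for j x using \<nu>[OF that] by (auto simp: \<nu>'_def)
  have nonneg_case: "integrable (measure_pmf p) (\<lambda>x. \<Sum>j\<in>J. \<nu>' j x * (g (T j x) - g x))
      \<and> measure_pmf.expectation p (\<lambda>x. \<Sum>j\<in>J. \<nu>' j x * (g (T j x) - g x)) = 0"
    if g: "\<And>x. 0 \<le> g x" "\<And>x. g x \<le> \<bar>f x\<bar>" for g :: "'x \<Rightarrow> real"
  proof -
    have 1: "integrable (measure_pmf p) (\<lambda>x. (\<Sum>j\<in>J. \<nu>' j x) * g x)"
    proof (rule Bochner_Integration.integrable_bound[OF int])
      show "AE x in measure_pmf p. norm ((\<Sum>j\<in>J. \<nu>' j x) * g x) \<le> norm ((\<Sum>j\<in>J. \<nu> j x) * \<bar>f x\<bar>)"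
        using \<nu>' \<nu> g by (auto simp: abs_mult sum_nonneg abs_of_nonneg intro!: AE_I2 mult_mono sum_mono)
    qed simp
    have "(\<integral>\<^sup>+x. ennreal (\<Sum>j\<in>J. \<nu>' j x * g (T j x)) \<partial>measure_pmf p)
        = (\<integral>\<^sup>+x. (\<Sum>j\<in>J. ennreal (\<nu>' j x) * ennreal (g (T j x))) \<partial>measure_pmf p)"
    proof (rule nn_integral_cong)
      fix x
      have "(\<Sum>j\<in>J. ennreal (\<nu>' j x) * ennreal (g (T j x))) = (\<Sum>j\<in>J. ennreal (\<nu>' j x * g (T j x)))"
        using \<nu>' g by (intro sum.cong) (auto simp: ennreal_mult)
      also have "\<dots> = ennreal (\<Sum>j\<in>J. \<nu>' j x * g (T j x))"
        using \<nu>' g by (intro sum_ennreal) auto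
      finally show "ennreal (\<Sum>j\<in>J. \<nu>' j x * g (T j x))
        = (\<Sum>j\<in>J. ennreal (\<nu>' j x) * ennreal (g (T j x)))" by simp
    qed
    also have "\<dots> = (\<integral>\<^sup>+x. ennreal (\<Sum>j\<in>J. \<nu>' j x) * ennreal (g x) \<partial>measure_pmf p)"
      unfolding \<nu>'_def by (rule stationary_jump_balance[OF S J q \<nu> T st, symmetric])
    also have "\<dots> = (\<integral>\<^sup>+x. ennreal ((\<Sum>j\<in>J. \<nu>' j x) * g x) \<partial>measure_pmf p)"
      using \<nu>' g by (auto simp: ennreal_mult sum_nonneg intro!: nn_integral_cong)
    also have eq: "\<dots> = ennreal (measure_pmf.expectation p (\<lambda>x. (\<Sum>j\<in>J. \<nu>' j x) * g x))"
      by (rule nn_integral_eq_integral[OF 1]) (use \<nu>' g in \<open>auto intro!: AE_I2 mult_nonneg_nonneg sum_nonneg\<close>)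
    finally have 2: "(\<integral>\<^sup>+x. ennreal (\<Sum>j\<in>J. \<nu>' j x * g (T j x)) \<partial>measure_pmf p)
        = ennreal (measure_pmf.expectation p (\<lambda>x. (\<Sum>j\<in>J. \<nu>' j x) * g x))" .
    have nn: "0 \<le> (\<Sum>j\<in>J. \<nu>' j x * g (T j x))" "0 \<le> (\<Sum>j\<in>J. \<nu>' j x) * g x" for x
      using \<nu>' g by (auto intro!: sum_nonneg mult_nonneg_nonneg)
    have 3: "integrable (measure_pmf p) (\<lambda>x. \<Sum>j\<in>J. \<nu>' j x * g (T j x))"
      by (rule integrableI_nonneg) (use nn in \<open>auto simp: 2\<close>)
    have 4: "measure_pmf.expectation p (\<lambda>x. \<Sum>j\<in>J. \<nu>' j x * g (T j x))
        = measure_pmf.expectation p (\<lambda>x. (\<Sum>j\<in>J. \<nu>' j x) * g x)"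
      using 2 nn by (subst (asm) nn_integral_eq_integral[OF 3])
        (auto intro!: Bochner_Integration.integral_nonneg simp del: integral_nonneg_eq_0_iff_AE)
    have "(\<lambda>x. \<Sum>j\<in>J. \<nu>' j x * (g (T j x) - g x))
        = (\<lambda>x. (\<Sum>j\<in>J. \<nu>' j x * g (T j x)) - (\<Sum>j\<in>J. \<nu>' j x) * g x)"
      by (simp add: fun_eq_iff right_diff_distrib sum_subtractf sum_distrib_right)
    then show ?thesis using 1 3 4 by simp
  qed
  have split: "(\<lambda>x. \<Sum>j\<in>J. \<nu> j x * (f (T j x) - f x)) =
      (\<lambda>x. (\<Sum>j\<in>J. \<nu>' j x * (max 0 (f (T j x)) - max 0 (f x)))
        - (\<Sum>j\<in>J. \<nu>' j x * (max 0 (- f (T j x)) - max 0 (- f x))))"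
    unfolding sum_subtractf[symmetric]
    by (intro ext sum.cong) (auto simp: \<nu>'_def max_def algebra_simps)
  note pos = nonneg_case[of "\<lambda>x. max 0 (f x)"] and neg = nonneg_case[of "\<lambda>x. max 0 (- f x)"]
  show "integrable (measure_pmf p) (\<lambda>x. \<Sum>j\<in>J. \<nu> j x * (f (T j x) - f x))"
    unfolding split using pos neg by auto
  show "measure_pmf.expectation p (\<lambda>x. \<Sum>j\<in>J. \<nu> j x * (f (T j x) - f x)) = 0"
    unfolding split using pos neg by auto
qed

section \<open>Transitions of the infinite-server system\<close>

text \<open>
  The data shared by all systems of the sequence; the scaling parameter \<open>r\<close> stays outside, so that
  constants found here are the same for all \<open>r\<close>.
\<close>

locale grand_system =
  fixes C :: "('i::finite, 's::finite) config set"
    and a :: "'s \<Rightarrow> real" and s0 :: "'i \<Rightarrow> 's"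
    and lam mu rho :: "'i \<Rightarrow> real"
  assumes packing: "packing_constraints C"
    and a_pos: "\<And>s. a s > 0"
    and lam_pos: "\<And>i. lam i > 0" and mu_pos: "\<And>i. mu i > 0"
    and rho_eq: "\<And>i. rho i = lam i / mu i" and rho_sum: "(\<Sum>i\<in>UNIV. rho i) = 1"
    and s0_fits: "\<And>i. (unit_vec i, s0 i) \<in> nonzero_configs C"
begin

abbreviation "N \<equiv> nonzero_configs C"
abbreviation "F \<equiv> fitting_configs C"
abbreviation "Z \<equiv> total_customers C"

text \<open>
  The number of type-\<open>i\<close> customers in the system.
\<close>

definition Y :: "'i \<Rightarrow> ('i, 's) state \<Rightarrow> nat" where
  "Y i X = (\<Sum>k\<in>N. fst k i * X k)"

text \<open>
  Contribution of the type-\<open>i\<close> events to the generator of the chain applied to \<open>f\<close>. Arrivals and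
  departures are both indexed by the configuration \<open>k\<close> without the customer concerned: \<open>F i\<close> is the
  set of edges between \<open>k\<close> and \<open>k + e_i\<close>, and the terms of one edge have to be compared later.
\<close>

definition type_drift :: "real \<Rightarrow> (('i, 's) state \<Rightarrow> real) \<Rightarrow> 'i \<Rightarrow> ('i, 's) state \<Rightarrow> real" where
  "type_drift r f i X = (\<Sum>k\<in>F i.
     lam i * r * placement_prob C a s0 X i k * (f (reconfigure C k (add_customer i k) X) - f X) +
     mu i * real (fst k i + 1) * real (X (add_customer i k))
       * (f (reconfigure C (add_customer i k) k X) - f X))"

definition drift :: "real \<Rightarrow> (('i, 's) state \<Rightarrow> real) \<Rightarrow> ('i, 's) state \<Rightarrow> real" where
  "drift r f X = (\<Sum>i\<in>UNIV. type_drift r f i X)"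

definition total_rate :: "real \<Rightarrow> ('i, 's) state \<Rightarrow> real" where
  "total_rate r X = (\<Sum>i\<in>UNIV. lam i * r + mu i * real (Y i X))"

lemma finite_C [simp]: "finite C" using packing by (simp add: packing_constraints_def)
lemma finite_N [simp]: "finite N" by (simp add: nonzero_configs_def)
lemma finite_F [simp]: "finite (F i)" by (simp add: fitting_configs_def)
lemma N_subset_C: "N \<subseteq> C" by (auto simp: nonzero_configs_def)
lemma F_subset_C: "F i \<subseteq> C" by (auto simp: fitting_configs_def)
lemma zero_notin_N [simp]: "fst k = (\<lambda>_. 0) \<Longrightarrow> k \<notin> N" by (simp add: nonzero_configs_def)
lemma in_N_iff: "k \<in> N \<longleftrightarrow> k \<in> C \<and> fst k \<noteq> (\<lambda>_. 0)" by (simp add: nonzero_configs_def)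
lemma add_in_N: "k \<in> F i \<Longrightarrow> add_customer i k \<in> N" by (simp add: fitting_configs_def)
lemma add_in_C: "k \<in> F i \<Longrightarrow> add_customer i k \<in> C"
  using add_in_N N_subset_C by (meson subsetD)
lemma in_F_in_C: "k \<in> F i \<Longrightarrow> k \<in> C" using F_subset_C by (meson subsetD)
lemma F_in_N_iff: "k \<in> F i \<Longrightarrow> k \<in> N \<longleftrightarrow> fst k \<noteq> (\<lambda>_. 0)"
  by (simp add: fitting_configs_def nonzero_configs_def)
lemma fst_add [simp]: "fst (add_customer i k) j = fst k j + (if j = i then 1 else 0)"
  by (simp add: add_customer_def)
lemma snd_add [simp]: "snd (add_customer i k) = snd k"
  by (simp add: add_customer_def)
lemma add_neq [simp]: "add_customer i k \<noteq> k" "k \<noteq> add_customer i k"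
  using fst_add[of i k i] by (auto simp del: fst_add)
lemma add_inj: "inj (add_customer i)"
proof (rule injI)
  fix k l assume "add_customer i k = add_customer i l"
  then have "fst (add_customer i k) j = fst (add_customer i l) j" "snd k = snd l" for j
    by (metis, metis snd_add)
  then show "k = l" by (auto simp: prod_eq_iff fun_eq_iff)
qed
lemma add_remove: "fst k i \<noteq> 0 \<Longrightarrow> add_customer i (remove_customer i k) = k"
  by (auto simp: add_customer_def remove_customer_def prod_eq_iff fun_eq_iff)
lemma remove_add: "remove_customer i (add_customer i k) = k"
  by (auto simp: add_customer_def remove_customer_def prod_eq_iff fun_eq_iff)
lemma smaller_in_C: "(k, s) \<in> C \<Longrightarrow> (\<And>i. k' i \<le> k i) \<Longrightarrow> (k', s) \<in> C"
  using packing unfolding packing_constraints_def by blast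

lemma remove_in_C: "k \<in> C \<Longrightarrow> remove_customer i k \<in> C"
  unfolding remove_customer_def by (rule smaller_in_C[of "fst k" "snd k"]) simp_all

text \<open>
  Monotonicity of the packing constraints enters here: every configuration containing a type-\<open>i\<close>
  customer is reached by an arrival from an allowed one.
\<close>

lemma bij_betw_add: "bij_betw (add_customer i) (F i) {k\<in>N. fst k i \<noteq> 0}"
  unfolding bij_betw_def
proof (intro conjI set_eqI iffI)
  show "inj_on (add_customer i) (F i)" by (rule inj_on_subset[OF add_inj subset_UNIV])
  fix k assume "k \<in> {k\<in>N. fst k i \<noteq> 0}"
  then show "k \<in> add_customer i ` F i"
    by (intro image_eqI[of _ _ "remove_customer i k"])
       (use N_subset_C in \<open>auto simp: add_remove fitting_configs_def remove_in_C\<close>)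
qed (auto simp: add_in_N)

lemma sum_over_departures:
  fixes h :: "('i, 's) config \<Rightarrow> real"
  assumes "\<And>k. k \<in> N \<Longrightarrow> fst k i = 0 \<Longrightarrow> h k = 0"
  shows "(\<Sum>k\<in>N. h k) = (\<Sum>k\<in>F i. h (add_customer i k))"
proof -
  have "(\<Sum>k\<in>N. h k) = (\<Sum>k | k \<in> N \<and> fst k i \<noteq> 0. h k)"
    by (rule sum.mono_neutral_right) (use assms in auto)
  also have "\<dots> = (\<Sum>k\<in>F i. h (add_customer i k))"
    by (rule sum.reindex_bij_betw[OF bij_betw_add, symmetric])
  finally show ?thesis .
qed

lemma zero_in_F: "((\<lambda>_. 0), s0 i) \<in> F i"
proof -
  have "add_customer i ((\<lambda>_. 0), s0 i) = (unit_vec i, s0 i)"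
    by (auto simp: add_customer_def unit_vec_def)
  moreover have "((\<lambda>_. 0), s0 i) \<in> C" using packing by (simp add: packing_constraints_def)
  ultimately show ?thesis using s0_fits by (simp add: fitting_configs_def)
qed

lemma placement_outside: "k \<notin> F i \<Longrightarrow> placement_prob C a s0 X i k = 0"
  using zero_in_F[of i] by (auto simp: placement_prob_def)

lemma placement_nonneg: "placement_prob C a s0 X i k \<ge> 0"
  by (simp add: placement_prob_def)

lemma placement_sum: "(\<Sum>k\<in>F i. placement_prob C a s0 X i k) = 1"
proof (cases "available_servers C a X i = 0")
  case True
  then show ?thesis using zero_in_F[of i] by (simp add: placement_prob_def)
next
  case False
  then have "(\<Sum>k\<in>F i. placement_prob C a s0 X i k)
      = (\<Sum>k\<in>F i. real (servers C a X k)) / real (available_servers C a X i)"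
    by (simp add: placement_prob_def sum_divide_distrib)
  also have "(\<Sum>k\<in>F i. real (servers C a X k)) = real (available_servers C a X i)"
    by (simp add: available_servers_def)
  finally show ?thesis using False by simp
qed

lemma placement_pos_occupied:
  assumes "placement_prob C a s0 X i k \<noteq> 0" "k \<in> N"
  shows "X k > 0"
proof -
  have "fst k \<noteq> (\<lambda>_. 0)" using assms(2) by (simp add: in_N_iff)
  then show ?thesis using assms(1)
    by (auto simp: placement_prob_def servers_def split: if_splits)
qed

lemma Y_eq_sum_departures: "real (Y i X) = (\<Sum>k\<in>F i. real (fst k i + 1) * real (X (add_customer i k)))"
proof -
  have "real (Y i X) = (\<Sum>k\<in>N. real (fst k i * X k))" by (simp add: Y_def)
  also have "\<dots> = (\<Sum>k\<in>F i. real (fst (add_customer i k) i * X (add_customer i k)))"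
    by (rule sum_over_departures) auto
  finally show ?thesis by (simp add: algebra_simps)
qed

lemma Z_eq_sum_Y: "Z X = (\<Sum>i\<in>UNIV. Y i X)"
  by (simp add: total_customers_def Y_def)

lemma Y_le_Z: "Y i X \<le> Z X"
  unfolding Z_eq_sum_Y by (rule member_le_sum) auto

lemma reconfigure_in_states: "reconfigure C k k' X \<in> states C"
  by (simp add: reconfigure_def states_def)

lemma countable_states: "countable (states C)"
proof -
  have "states C \<subseteq> (\<lambda>f k. if k \<in> N then f k else 0) ` PiE N (\<lambda>_. UNIV)"
  proof
    fix X assume X: "X \<in> states C"
    show "X \<in> (\<lambda>f k. if k \<in> N then f k else 0) ` PiE N (\<lambda>_. UNIV)"
      by (rule image_eqI[of _ _ "restrict X N"]) (use X in \<open>auto simp: states_def fun_eq_iff\<close>)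
  qed
  moreover have "countable (PiE N (\<lambda>_. UNIV :: nat set))"
    by (rule countable_PiE) auto
  ultimately show ?thesis by (meson countable_image countable_subset)
qed

lemma total_rate_nonneg: "r \<ge> 0 \<Longrightarrow> total_rate r X \<ge> 0"
  unfolding total_rate_def using lam_pos mu_pos
  by (intro sum_nonneg add_nonneg_nonneg mult_nonneg_nonneg) (auto simp: less_imp_le)

lemma grand_rate_eq:
  "grand_rate C a s0 (\<lambda>i. lam i * r) mu X X' = (\<Sum>i\<in>UNIV. \<Sum>k\<in>F i.
     (if reconfigure C k (add_customer i k) X = X' then lam i * r * placement_prob C a s0 X i k else 0) +
     (if reconfigure C (add_customer i k) k X = X' then mu i * real (fst k i + 1) * real (X (add_customer i k)) else 0))"
proof -
  have 1: "(\<Sum>k\<in>C. if reconfigure C k (add_customer i k) X = X' then lam i * r * placement_prob C a s0 X i k else 0)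
     = (\<Sum>k\<in>F i. if reconfigure C k (add_customer i k) X = X' then lam i * r * placement_prob C a s0 X i k else 0)" for i
    by (rule sum.mono_neutral_right) (auto simp: placement_outside F_subset_C[THEN subsetD])
  have 2: "(\<Sum>k\<in>N. if reconfigure C k (remove_customer i k) X = X' then mu i * real (fst k i) * real (X k) else 0)
    = (\<Sum>k\<in>F i. if reconfigure C (add_customer i k) k X = X' then mu i * real (fst k i + 1) * real (X (add_customer i k)) else 0)" for i
    by (subst sum_over_departures[of i]) (auto simp: remove_add intro!: sum.cong)
  show ?thesis
    unfolding grand_rate_def 1 2 by (simp add: sum.distrib)
qed

text \<open>
  The rates are a sum over finitely many events, an arrival or a departure along one of the edges, each
  leading to a single new state.
\<close>

theorem stationary_drift_zero:
  assumes st: "stationary_distribution (states C) (grand_rate C a s0 (\<lambda>i. lam i * r) mu) p"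
    and r: "r \<ge> 0"
    and int: "integrable (measure_pmf p) (\<lambda>X. total_rate r X * \<bar>f X\<bar>)"
  shows "integrable (measure_pmf p) (drift r f)" "measure_pmf.expectation p (drift r f) = 0"
proof -
  define J where "J = (SIGMA i:UNIV. F i) \<times> (UNIV :: bool set)"
  define T :: "('i \<times> ('i, 's) config) \<times> bool \<Rightarrow> ('i, 's) state \<Rightarrow> ('i, 's) state" where
    "T = (\<lambda>((i, k), b) X. if b then reconfigure C k (add_customer i k) X else reconfigure C (add_customer i k) k X)"
  define \<nu> :: "('i \<times> ('i, 's) config) \<times> bool \<Rightarrow> ('i, 's) state \<Rightarrow> real" where
    "\<nu> = (\<lambda>((i, k), b) X. if b then lam i * r * placement_prob C a s0 X i k
        else mu i * real (fst k i + 1) * real (X (add_customer i k)))"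
  have J: "finite J" unfolding J_def by (intro finite_cartesian_product finite_SigmaI) auto
  have sumJ: "(\<Sum>j\<in>J. h j) = (\<Sum>i\<in>UNIV. \<Sum>k\<in>F i. h ((i, k), True) + h ((i, k), False))"
    for h :: "('i \<times> ('i, 's) config) \<times> bool \<Rightarrow> real"
    unfolding J_def sum.cartesian_product'
    by (subst sum.Sigma) (auto simp: UNIV_bool add.commute intro!: sum.cong)
  have q: "grand_rate C a s0 (\<lambda>i. lam i * r) mu X X' = (\<Sum>j\<in>J. if T j X = X' then \<nu> j X else 0)" for X X'
    unfolding sumJ grand_rate_eq T_def \<nu>_def by (simp cong: if_cong)
  have \<nu>: "\<nu> j X \<ge> 0" for j X
    using less_imp_le[OF lam_pos] less_imp_le[OF mu_pos] r placement_nonneg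
    by (auto simp: \<nu>_def split: prod.split)
  have T: "T j X \<in> states C" for j X
    by (auto simp: T_def reconfigure_in_states split: prod.split)
  have tot: "(\<Sum>j\<in>J. \<nu> j X) = total_rate r X" for X
    unfolding sumJ total_rate_def \<nu>_def
    by (simp add: sum.distrib sum_distrib_left[symmetric] placement_sum Y_eq_sum_departures mult.assoc)
  have dr: "(\<lambda>X. \<Sum>j\<in>J. \<nu> j X * (f (T j X) - f X)) = drift r f"
    unfolding sumJ drift_def type_drift_def \<nu>_def T_def by simp
  note * = stationary_expected_drift_zero[OF countable_states J q \<nu> T st, of f, unfolded dr tot, OF int]
  show "integrable (measure_pmf p) (drift r f)" "measure_pmf.expectation p (drift r f) = 0"
    using * by auto
qed

lemma sum_reconfigure_diff:
  fixes \<phi> :: "('i, 's) config \<Rightarrow> nat \<Rightarrow> real"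
  assumes "k \<noteq> k'"
  shows "(\<Sum>j\<in>N. \<phi> j (reconfigure C k k' X j)) - (\<Sum>j\<in>N. \<phi> j (X j)) =
    (if k \<in> N then \<phi> k (X k - 1) - \<phi> k (X k) else 0) +
    (if k' \<in> N then \<phi> k' (X k' + 1) - \<phi> k' (X k') else 0)"
proof -
  have "(\<Sum>j\<in>N. \<phi> j (reconfigure C k k' X j)) - (\<Sum>j\<in>N. \<phi> j (X j)) =
     (\<Sum>j\<in>N. (if j = k then \<phi> k (X k - 1) - \<phi> k (X k) else 0) +
        (if j = k' then \<phi> k' (X k' + 1) - \<phi> k' (X k') else 0))"
    unfolding sum_subtractf[symmetric]
    by (rule sum.cong) (use assms in \<open>auto simp: reconfigure_def\<close>)
  then show ?thesis by (simp add: sum.distrib)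
qed

lemma Y_reconfigure_diff:
  assumes "k \<noteq> k'" "k \<in> N \<Longrightarrow> X k > 0" "k \<in> C" "k' \<in> C"
  shows "real (Y j (reconfigure C k k' X)) = real (Y j X) + real (fst k' j) - real (fst k j)"
proof -
  have "real (Y j (reconfigure C k k' X)) - real (Y j X) =
    (if k \<in> N then - real (fst k j) else 0) + (if k' \<in> N then real (fst k' j) else 0)"
    using sum_reconfigure_diff[OF assms(1), of "\<lambda>k n. real (fst k j) * real n" X] assms(2)
    by (auto simp: Y_def of_nat_diff algebra_simps)
  then show ?thesis using assms(3,4) by (auto simp: in_N_iff split: if_splits)
qed

text \<open>
  Placement decisions are invisible to functions of the customer numbers: such a function sees
  independent M/M/infinity queues.
\<close>

lemma drift_of_load:
  fixes w :: "'i \<Rightarrow> real" and h :: "real \<Rightarrow> real"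
  defines "W \<equiv> \<lambda>X. \<Sum>j\<in>UNIV. w j * real (Y j X)"
  shows "drift r (\<lambda>X. h (W X)) X = (\<Sum>i\<in>UNIV. lam i * r * (h (W X + w i) - h (W X))
     + mu i * real (Y i X) * (h (W X - w i) - h (W X)))"
proof -
  have up: "placement_prob C a s0 X i k * h (W (reconfigure C k (add_customer i k) X))
     = placement_prob C a s0 X i k * h (W X + w i)" if k: "k \<in> F i" for i k
  proof (cases "placement_prob C a s0 X i k = 0")
    case False
    have "W (reconfigure C k (add_customer i k) X) = (\<Sum>j\<in>UNIV. w j * real (Y j X) + (if j = i then w i else 0))"
      unfolding W_def using k False in_F_in_C[OF k] add_in_C[OF k]
      by (subst Y_reconfigure_diff)
         (auto simp: placement_pos_occupied algebra_simps intro!: sum.cong)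
    then have "W (reconfigure C k (add_customer i k) X) = W X + w i"
      by (simp add: sum.distrib W_def)
    then show ?thesis by simp
  qed simp
  have down: "real (X (add_customer i k)) * h (W (reconfigure C (add_customer i k) k X))
     = real (X (add_customer i k)) * h (W X - w i)" if k: "k \<in> F i" for i k
  proof (cases "X (add_customer i k) = 0")
    case False
    have "W (reconfigure C (add_customer i k) k X) = (\<Sum>j\<in>UNIV. w j * real (Y j X) - (if j = i then w i else 0))"
      unfolding W_def using k False in_F_in_C[OF k] add_in_C[OF k]
      by (subst Y_reconfigure_diff) (auto simp: algebra_simps intro!: sum.cong)
    then have "W (reconfigure C (add_customer i k) k X) = W X - w i"
      by (simp add: sum_subtractf W_def)
    then show ?thesis by simp
  qed simp
  have "drift r (\<lambda>X. h (W X)) X = (\<Sum>i\<in>UNIV. \<Sum>k\<in>F i.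
     lam i * r * (h (W X + w i) - h (W X)) * placement_prob C a s0 X i k +
     mu i * (h (W X - w i) - h (W X)) * (real (fst k i + 1) * real (X (add_customer i k))))"
    unfolding drift_def type_drift_def
  proof (intro sum.cong refl)
    fix i k assume k: "k \<in> F i"
    have 1: "lam i * r * placement_prob C a s0 X i k * (h (W (reconfigure C k (add_customer i k) X)) - h (W X))
      = lam i * r * (h (W X + w i) - h (W X)) * placement_prob C a s0 X i k"
      using up[OF k] by (simp add: algebra_simps)
    have 2: "mu i * real (fst k i + 1) * real (X (add_customer i k)) * (h (W (reconfigure C (add_customer i k) k X)) - h (W X))
      = mu i * (h (W X - w i) - h (W X)) * (real (fst k i + 1) * real (X (add_customer i k)))"
    proof -
      have "mu i * real (fst k i + 1) * real (X (add_customer i k)) * (h (W (reconfigure C (add_customer i k) k X)) - h (W X))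
       = mu i * real (fst k i + 1) * (real (X (add_customer i k)) * h (W (reconfigure C (add_customer i k) k X)) - real (X (add_customer i k)) * h (W X))"
        by (simp add: algebra_simps)
      then show ?thesis unfolding down[OF k] by (simp add: algebra_simps)
    qed
    show "lam i * r * placement_prob C a s0 X i k * (h (W (reconfigure C k (add_customer i k) X)) - h (W X))
       + mu i * real (fst k i + 1) * real (X (add_customer i k)) * (h (W (reconfigure C (add_customer i k) k X)) - h (W X))
      = lam i * r * (h (W X + w i) - h (W X)) * placement_prob C a s0 X i k +
     mu i * (h (W X - w i) - h (W X)) * (real (fst k i + 1) * real (X (add_customer i k)))"
      by (simp only: 1 2)
  qed
  also have "\<dots> = (\<Sum>i\<in>UNIV. lam i * r * (h (W X + w i) - h (W X)) * 1
     + mu i * (h (W X - w i) - h (W X)) * real (Y i X))"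
    by (simp only: sum.distrib sum_distrib_left[symmetric] placement_sum Y_eq_sum_departures)
  finally show ?thesis by (simp add: algebra_simps)
qed

lemma total_rate_le:
  assumes r: "r \<ge> 0"
  shows "total_rate r X \<le> (\<Sum>i\<in>UNIV. lam i * r + mu i) * (1 + real (Z X))"
  unfolding total_rate_def sum_distrib_right
proof (rule sum_mono)
  fix i
  have "mu i * real (Y i X) \<le> mu i * real (Z X)"
    using Y_le_Z mu_pos[of i] by (intro mult_left_mono) auto
  moreover have "0 \<le> lam i * r * real (Z X)" using lam_pos[of i] r by simp
  ultimately show "lam i * r + mu i * real (Y i X) \<le> (lam i * r + mu i) * (1 + real (Z X))"
    using mu_pos[of i] unfolding distrib_left distrib_right by linarith
qed

lemma W_delta: "(\<Sum>j\<in>UNIV. (if j = i then 1 else 0) * real (Y j X)) = real (Y i X)"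
  by (simp add: if_distrib[of "\<lambda>x. x * _"] cong: if_cong)

lemma drift_of_Y:
  "drift r (\<lambda>X. h (real (Y i X))) X = lam i * r * (h (real (Y i X) + 1) - h (real (Y i X)))
     + mu i * real (Y i X) * (h (real (Y i X) - 1) - h (real (Y i X)))"
proof -
  let ?y = "real (Y i X)"
  have "drift r (\<lambda>X. h (real (Y i X))) X = (\<Sum>j\<in>UNIV. lam j * r * (h (?y + (if j = i then 1 else 0)) - h ?y)
     + mu j * real (Y j X) * (h (?y - (if j = i then 1 else 0)) - h ?y))"
    using drift_of_load[of r h "\<lambda>j. if j = i then 1 else 0" X] unfolding W_delta .
  also have "\<dots> = (\<Sum>j\<in>UNIV. if j = i then lam i * r * (h (?y + 1) - h ?y)
     + mu i * real (Y i X) * (h (?y - 1) - h ?y) else 0)"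
    by (rule sum.cong) auto
  finally show ?thesis by simp
qed

lemma lam_eq: "lam i = mu i * rho i" using rho_eq mu_pos[of i] by simp

lemma Y_bound: "real (Y i X) \<le> 1 + real (Z X)"
  using Y_le_Z[of i X] by linarith

definition mu_min :: real where "mu_min = Min (range mu)"

lemma mu_min: "mu_min > 0" "mu_min \<le> mu i"
  unfolding mu_min_def using mu_pos by (auto simp: Min_gr_iff)

text \<open>
  The total deviation of the customer numbers from their means; all error terms are expressed by it.
\<close>

definition V :: "real \<Rightarrow> ('i, 's) state \<Rightarrow> real" where
  "V r X = (\<Sum>i\<in>UNIV. \<bar>real (Y i X) - rho i * r\<bar>)"

lemma V_nonneg: "V r X \<ge> 0" by (simp add: V_def sum_nonneg)

lemma Z_deviation_le_V: "\<bar>real (Z X) - r\<bar> \<le> V r X"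
proof -
  have "real (Z X) - r = (\<Sum>i\<in>UNIV. real (Y i X) - rho i * r)"
    by (simp add: Z_eq_sum_Y sum_subtractf sum_distrib_right[symmetric] rho_sum)
  then show ?thesis unfolding V_def by (metis sum_abs)
qed

lemma Y_deviation_le_V: "\<bar>real (Y i X) - rho i * r\<bar> \<le> V r X"
  unfolding V_def by (rule member_le_sum[of i UNIV "\<lambda>i. \<bar>real (Y i X) - rho i * r\<bar>"]) auto

end

section \<open>Moments of the number of customers in the stationary regime\<close>

lemma integrable_pmf_nat_if_summable:
  fixes P :: "nat pmf" and f :: "nat \<Rightarrow> real"
  assumes f: "\<And>n. f n \<ge> 0" and sm: "summable (\<lambda>n. pmf P n * f n)"
  shows "integrable (measure_pmf P) f"
proof (rule integrableI_nonneg)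
  have "(\<integral>\<^sup>+n. ennreal (f n) \<partial>measure_pmf P) = (\<Sum>n. ennreal (pmf P n * f n))"
    using f by (simp add: nn_integral_measure_pmf nn_integral_count_space_nat ennreal_mult)
  also have "\<dots> < \<infinity>"
    using sm f by (subst suminf_ennreal2) auto
  finally show "(\<integral>\<^sup>+n. ennreal (f n) \<partial>measure_pmf P) < \<infinity>" .
qed (use f in auto)

locale stationary_grand = grand_system C a s0 lam mu rho
  for C :: "('i::finite, 's::finite) config set" and a s0 lam mu rho +
  fixes r :: real and p :: "('i, 's) state pmf"
  assumes r_ge_1: "r \<ge> 1"
    and stat: "stationary_distribution (states C) (grand_rate C a s0 (\<lambda>i. lam i * r) mu) p"
begin

abbreviation "E \<equiv> measure_pmf.expectation p"

lemma r_pos: "r > 0" using r_ge_1 by simp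

text \<open>
  The drift of the indicator of \<open>Z \<le> n\<close> is the departure rate on \<open>Z = n + 1\<close> minus the arrival rate
  on \<open>Z = n\<close>. The test function vanishes beyond \<open>n\<close>, where the rates are unbounded, so it may be
  used before any moment of \<open>Z\<close> is known.
\<close>

lemma cut_balance:
  "mu_min * real (Suc n) * pmf (map_pmf Z p) (Suc n) \<le> (\<Sum>i\<in>UNIV. lam i * r) * pmf (map_pmf Z p) n"
proof -
  define h :: "real \<Rightarrow> real" where "h = (\<lambda>x. if x \<le> real n then 1 else 0)"
  define f where "f = (\<lambda>X. h (\<Sum>j\<in>UNIV. 1 * real (Y j X)))"
  define M where "M = (\<lambda>X. \<Sum>i\<in>UNIV. mu i * real (Y i X))"
  have W: "(\<Sum>j\<in>UNIV. 1 * real (Y j X)) = real (Z X)" for X by (simp add: Z_eq_sum_Y)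
  have fW: "f = (\<lambda>X. h (real (Z X)))" unfolding f_def W by simp
  have dr: "drift r f X = M X * indicator {X. Z X = Suc n} X
      - (\<Sum>i\<in>UNIV. lam i * r) * indicator {X. Z X = n} X" for X
    using drift_of_load[of r h "\<lambda>_. 1" X]
    unfolding W fW[symmetric] sum.distrib sum_distrib_right[symmetric] M_def
    by (auto simp: h_def indicator_def)
  have bnd: "\<bar>total_rate r X * \<bar>f X\<bar>\<bar> \<le> (\<Sum>i\<in>UNIV. lam i * r + mu i) * (1 + real n)" for X
  proof (cases "Z X \<le> n")
    case True
    then have "total_rate r X \<le> (\<Sum>i\<in>UNIV. lam i * r + mu i) * (1 + real n)"
      using lam_pos mu_pos r_pos
      by (intro order.trans[OF total_rate_le[OF less_imp_le[OF r_pos]]] mult_left_mono sum_nonneg)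
        (auto intro!: add_nonneg_nonneg mult_nonneg_nonneg simp: less_imp_le)
    then show ?thesis using True total_rate_nonneg[of r X] r_pos by (simp add: fW h_def)
  next
    case False
    have "(\<Sum>i\<in>UNIV. lam i * r + mu i) \<ge> 0"
      using lam_pos mu_pos r_pos by (intro sum_nonneg) (auto intro!: add_nonneg_nonneg simp: less_imp_le)
    then show ?thesis using False by (simp add: fW h_def)
  qed
  have int: "integrable (measure_pmf p) (\<lambda>X. total_rate r X * \<bar>f X\<bar>)"
    by (rule measure_pmf.integrable_const_bound[where B="(\<Sum>i\<in>UNIV. lam i * r + mu i) * (1 + real n)"])
       (use bnd in auto)
  have d0: "integrable (measure_pmf p) (drift r f)" "E (drift r f) = 0"
    using stationary_drift_zero[OF stat _ int] r_pos by auto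
  have pm: "E (indicator {X. Z X = m}) = pmf (map_pmf Z p) m" for m
    by (simp add: pmf_map vimage_def)
  have "E (\<lambda>X. mu_min * real (Suc n) * indicator {X. Z X = Suc n} X
      - (\<Sum>i\<in>UNIV. lam i * r) * indicator {X. Z X = n} X) \<le> E (drift r f)"
  proof (rule integral_mono)
    fix X
    have "mu_min * real (Z X) \<le> M X"
      unfolding M_def Z_eq_sum_Y of_nat_sum sum_distrib_left
      by (intro sum_mono mult_right_mono) (auto simp: mu_min)
    then show "mu_min * real (Suc n) * indicator {X. Z X = Suc n} X
      - (\<Sum>i\<in>UNIV. lam i * r) * indicator {X. Z X = n} X \<le> drift r f X"
      unfolding dr by (auto simp: indicator_def)
  qed (use d0 in \<open>auto simp: measure_pmf.emeasure_eq_measure\<close>)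
  then show ?thesis unfolding d0
    by (subst (asm) Bochner_Integration.integral_diff) (auto simp: pm[symmetric] measure_pmf.emeasure_eq_measure)
qed

text \<open>
  The ratio of consecutive probabilities is of order \<open>1 / n\<close>, so the moment series converges by the
  ratio test.
\<close>

lemma Z_moment_integrable: "integrable (measure_pmf p) (\<lambda>X. real (Z X) ^ m)"
proof -
  define P where "P = map_pmf Z p"
  define b where "b = (\<Sum>i\<in>UNIV. lam i * r) / mu_min * 2 ^ m"
  obtain n0 :: nat where n0: "2 * b \<le> real n0" using real_arch_simple by blast
  have "summable (\<lambda>n. pmf P n * real n ^ m)"
  proof (rule summable_ratio_test[of "1 / 2" "max 1 n0"])
    fix n assume n: "max 1 n0 \<le> n"
    have "mu_min * real (Suc n) * pmf P (Suc n) \<le> (\<Sum>i\<in>UNIV. lam i * r) * pmf P n"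
      unfolding P_def by (rule cut_balance)
    then have 1: "pmf P (Suc n) \<le> (\<Sum>i\<in>UNIV. lam i * r) / mu_min / real (Suc n) * pmf P n"
      using mu_min(1) by (simp add: pos_le_divide_eq mult_ac del: of_nat_Suc)
    have 2: "real (Suc n) ^ m \<le> 2 ^ m * real n ^ m"
      unfolding power_mult_distrib[symmetric] using n by (intro power_mono) auto
    have "pmf P (Suc n) * real (Suc n) ^ m
       \<le> (\<Sum>i\<in>UNIV. lam i * r) / mu_min / real (Suc n) * pmf P n * (2 ^ m * real n ^ m)"
      using 1 2 order.trans[OF pmf_nonneg 1] by (intro mult_mono) auto
    also have "\<dots> = b / real (Suc n) * (pmf P n * real n ^ m)" by (simp add: b_def)
    also have "\<dots> \<le> 1 / 2 * (pmf P n * real n ^ m)"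
      using n n0 by (intro mult_right_mono) (auto simp: field_simps)
    finally show "norm (pmf P (Suc n) * real (Suc n) ^ m) \<le> 1 / 2 * norm (pmf P n * real n ^ m)"
      by simp
  qed simp
  then have "integrable (measure_pmf P) (\<lambda>n. real n ^ m)"
    by (intro integrable_pmf_nat_if_summable) auto
  then show ?thesis unfolding P_def by (simp add: integrable_map_pmf_eq)
qed

lemma integrable_dominated_by_Z:
  assumes "\<And>X. \<bar>f X\<bar> \<le> c * (1 + real (Z X)) ^ m"
  shows "integrable (measure_pmf p) f"
proof (rule Bochner_Integration.integrable_bound)
  have "(\<lambda>X. c * (1 + real (Z X)) ^ m) = (\<lambda>X. c * (\<Sum>k\<le>m. of_nat (m choose k) * real (Z X) ^ k))"
    by (subst add.commute, subst binomial_ring) simp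
  then show "integrable (measure_pmf p) (\<lambda>X. c * (1 + real (Z X)) ^ m)"
    by (simp add: Z_moment_integrable)
  show "AE X in measure_pmf p. norm (f X) \<le> norm (c * (1 + real (Z X)) ^ m)"
    using assms by (auto intro!: AE_I2 order.trans[OF _ abs_ge_self])
qed simp

lemma drift_zero_polynomial:
  assumes c: "\<And>X. \<bar>f X\<bar> \<le> c * (1 + real (Z X)) ^ m"
  shows "integrable (measure_pmf p) (drift r f)" "E (drift r f) = 0"
proof -
  define b where "b = (\<Sum>i\<in>UNIV. lam i * r + mu i)"
  have b: "b \<ge> 0" unfolding b_def
    using lam_pos mu_pos r_pos by (intro sum_nonneg) (auto intro!: add_nonneg_nonneg simp: less_imp_le)
  have "integrable (measure_pmf p) (\<lambda>X. total_rate r X * \<bar>f X\<bar>)"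
  proof (rule integrable_dominated_by_Z)
    fix X
    have "\<bar>total_rate r X * \<bar>f X\<bar>\<bar> = total_rate r X * \<bar>f X\<bar>"
      using total_rate_nonneg[of r X] r_pos by simp
    also have "\<dots> \<le> b * (1 + real (Z X)) * (c * (1 + real (Z X)) ^ m)"
      using total_rate_le[of r X] r_pos c[of X] b by (intro mult_mono) (auto simp: b_def)
    finally show "\<bar>total_rate r X * \<bar>f X\<bar>\<bar> \<le> b * c * (1 + real (Z X)) ^ Suc m"
      by (simp add: mult_ac)
  qed
  then show "integrable (measure_pmf p) (drift r f)" "E (drift r f) = 0"
    using stationary_drift_zero[OF stat] r_pos by auto
qed

lemma Y_integrable: "integrable (measure_pmf p) (\<lambda>X. real (Y i X) ^ m)"
  by (rule integrable_dominated_by_Z[of _ 1 m])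
     (use Y_bound in \<open>auto intro!: power_mono\<close>)

lemma Y_mean: "E (\<lambda>X. real (Y i X)) = rho i * r"
proof -
  have "E (drift r (\<lambda>X. real (Y i X))) = 0"
    by (rule drift_zero_polynomial(2)[of _ 1 1]) (use Y_bound in auto)
  moreover have "drift r (\<lambda>X. real (Y i X)) = (\<lambda>X. mu i * (rho i * r - real (Y i X)))"
    using drift_of_Y[of r "\<lambda>x. x" i] by (auto simp: fun_eq_iff lam_eq algebra_simps)
  ultimately show ?thesis
    using mu_pos[of i] Y_integrable[of i 1] by simp
qed

text \<open>
  The square of \<open>Y i\<close> has a quadratic drift, so the zero mean drift determines the second moment from
  the first. The value is that of the Poisson distribution.
\<close>

lemma Y_variance: "E (\<lambda>X. (real (Y i X) - rho i * r)\<^sup>2) = rho i * r"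
proof -
  have "E (drift r (\<lambda>X. (real (Y i X))\<^sup>2)) = 0"
    by (rule drift_zero_polynomial(2)[of _ 1 2]) (use Y_bound in \<open>auto intro!: power_mono\<close>)
  moreover have "drift r (\<lambda>X. (real (Y i X))\<^sup>2) = (\<lambda>X. mu i * (rho i * r * (2 * real (Y i X) + 1)
      + real (Y i X) - 2 * (real (Y i X))\<^sup>2))"
    using drift_of_Y[of r "\<lambda>x. x\<^sup>2" i] by (auto simp: fun_eq_iff lam_eq algebra_simps power2_eq_square)
  ultimately have "rho i * r * (2 * (rho i * r) + 1) + rho i * r - 2 * E (\<lambda>X. (real (Y i X))\<^sup>2) = 0"
    using mu_pos[of i] Y_integrable[of i 1] Y_integrable[of i 2] by (simp add: Y_mean)
  then have 2: "E (\<lambda>X. (real (Y i X))\<^sup>2) = (rho i * r)\<^sup>2 + rho i * r"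
    by (simp add: power2_eq_square algebra_simps)
  have "E (\<lambda>X. (real (Y i X) - rho i * r)\<^sup>2)
      = E (\<lambda>X. (real (Y i X))\<^sup>2 - 2 * (rho i * r) * real (Y i X) + (rho i * r)\<^sup>2)"
    by (simp add: power2_diff algebra_simps)
  also have "\<dots> = E (\<lambda>X. (real (Y i X))\<^sup>2) - 2 * (rho i * r) * (rho i * r) + (rho i * r)\<^sup>2"
    using Y_integrable[of i 1] Y_integrable[of i 2] by (simp add: Y_mean)
  finally show ?thesis unfolding 2 by (simp add: power2_eq_square)
qed

lemma V_square: "integrable (measure_pmf p) (\<lambda>X. (V r X)\<^sup>2)" "E (\<lambda>X. (V r X)\<^sup>2) \<le> real CARD('i) * r"
proof -
  have le: "(V r X)\<^sup>2 \<le> real CARD('i) * (\<Sum>i\<in>UNIV. (real (Y i X) - rho i * r)\<^sup>2)" for X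
    using Cauchy_Schwarz_ineq_sum[of "\<lambda>_::'i. 1" "\<lambda>i. \<bar>real (Y i X) - rho i * r\<bar>" UNIV]
    by (simp add: V_def)
  have i1: "integrable (measure_pmf p) (\<lambda>X. (real (Y i X) - rho i * r)\<^sup>2)" for i
    unfolding power2_diff using Y_integrable[of i 1] Y_integrable[of i 2] by simp
  show int: "integrable (measure_pmf p) (\<lambda>X. (V r X)\<^sup>2)"
    by (rule Bochner_Integration.integrable_bound[of _ "\<lambda>X. real CARD('i) * (\<Sum>i\<in>UNIV. (real (Y i X) - rho i * r)\<^sup>2)"])
       (use le i1 in \<open>auto intro!: AE_I2 order.trans[OF _ abs_ge_self]\<close>)
  have "E (\<lambda>X. (V r X)\<^sup>2) \<le> E (\<lambda>X. real CARD('i) * (\<Sum>i\<in>UNIV. (real (Y i X) - rho i * r)\<^sup>2))"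
    by (rule integral_mono) (use le i1 int in auto)
  also have "\<dots> = real CARD('i) * (\<Sum>i\<in>UNIV. rho i * r)"
    using i1 by (simp add: Y_variance)
  finally show "E (\<lambda>X. (V r X)\<^sup>2) \<le> real CARD('i) * r"
    by (simp add: sum_distrib_right[symmetric] rho_sum)
qed

lemma V_integrable: "integrable (measure_pmf p) (V r)"
  unfolding V_def using Y_integrable[of _ 1] by (intro Bochner_Integration.integrable_sum integrable_abs) auto

text \<open>
  Expand \<open>0 \<le> E (V - sqrt r)^2\<close> and use the bound on the second moment.
\<close>

lemma V_mean: "E (V r) \<le> real CARD('i) * sqrt r"
proof -
  have "0 \<le> E (\<lambda>X. (V r X - sqrt r)\<^sup>2)" by (rule Bochner_Integration.integral_nonneg) auto
  also have "E (\<lambda>X. (V r X - sqrt r)\<^sup>2) = E (\<lambda>X. (V r X)\<^sup>2 - 2 * sqrt r * V r X + r)"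
    using r_pos by (simp add: power2_diff algebra_simps)
  also have "\<dots> = E (\<lambda>X. (V r X)\<^sup>2) - 2 * sqrt r * E (V r) + r"
    using V_square(1) V_integrable by simp
  finally have "2 * sqrt r * E (V r) \<le> real CARD('i) * r + r" using V_square(2) by linarith
  also have "\<dots> \<le> 2 * sqrt r * (real CARD('i) * sqrt r)"
  proof -
    have "2 * sqrt r * (real CARD('i) * sqrt r) = 2 * real CARD('i) * (sqrt r * sqrt r)" by simp
    also have "\<dots> = 2 * (real CARD('i) * r)" using r_pos by simp
    finally have "2 * sqrt r * (real CARD('i) * sqrt r) = 2 * (real CARD('i) * r)" .
    moreover have "1 * r \<le> real CARD('i) * r" using r_pos by (intro mult_right_mono) (auto simp: Suc_leI)
    ultimately show ?thesis by linarith
  qed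
  finally show ?thesis using r_pos by simp
qed

end

section \<open>A Lyapunov function with logarithmic increments\<close>

text \<open>
  On the unit interval the slope of \<open>ln\<close> is at least 1, so \<open>ln q - ln p\<close> is at least \<open>q - p\<close> for
  \<open>p \<le> q\<close>.
\<close>

lemma diff_mult_ln_ratio_le:
  fixes p q :: real
  assumes "0 < p" "p \<le> 1" "0 < q" "q \<le> 1"
  shows "(q - p) * ln (p / q) \<le> - (q - p)\<^sup>2"
proof (cases "p \<le> q")
  case True
  have "ln (p / q) \<le> p / q - 1" using assms by (intro ln_le_minus_one) auto
  also have "\<dots> = - ((q - p) / q)" using assms by (simp add: field_simps)
  also have "\<dots> \<le> - (q - p)"
    unfolding neg_le_iff_le pos_le_divide_eq[OF \<open>0 < q\<close>]
    using assms True by (intro mult_left_le) auto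
  finally have "(q - p) * ln (p / q) \<le> (q - p) * - (q - p)"
    using True by (intro mult_left_mono) auto
  then show ?thesis by (simp add: power2_eq_square algebra_simps)
next
  case False
  have "- ln (p / q) = ln (q / p)" using assms by (simp add: ln_div)
  also have "\<dots> \<le> q / p - 1" using assms by (intro ln_le_minus_one) auto
  also have "\<dots> = - ((p - q) / p)" using assms by (simp add: field_simps)
  also have "\<dots> \<le> - (p - q)"
    unfolding neg_le_iff_le pos_le_divide_eq[OF \<open>0 < p\<close>]
    using assms False by (intro mult_left_le) auto
  finally have "(p - q) * (p - q) \<le> (p - q) * ln (p / q)"
    using False by (intro mult_left_mono) auto
  then show ?thesis by (simp add: power2_eq_square algebra_simps)
qed

text \<open>
  The normalising factors may be omitted inside the logarithm because they contribute a constant, and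
  the differences of two probability vectors sum to zero.
\<close>

lemma sum_fraction_diff_mult_ln_le:
  fixes A B :: "'k \<Rightarrow> real"
  assumes K: "finite K" and A: "\<And>k. k \<in> K \<Longrightarrow> 0 < A k" and B: "\<And>k. k \<in> K \<Longrightarrow> 0 < B k"
  shows "(\<Sum>k\<in>K. (A k / sum A K - B k / sum B K) * ln (B k / A k))
    \<le> - (\<Sum>k\<in>K. (A k / sum A K - B k / sum B K)\<^sup>2)"
proof (cases "K = {}")
  case False
  have sA: "sum A K > 0" and sB: "sum B K > 0" using K A B False by (auto intro!: sum_pos)
  have leA: "A k \<le> sum A K" and leB: "B k \<le> sum B K" if "k \<in> K" for k
    using that K less_imp_le[OF A] less_imp_le[OF B] by (auto intro!: member_le_sum)
  have "(\<Sum>k\<in>K. (A k / sum A K - B k / sum B K) * ln (B k / A k)) =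
     (\<Sum>k\<in>K. (A k / sum A K - B k / sum B K) * ln ((B k / sum B K) / (A k / sum A K)) +
        (A k / sum A K - B k / sum B K) * ln (sum B K / sum A K))"
  proof (rule sum.cong[OF refl])
    fix k assume k: "k \<in> K"
    have "ln (B k / A k) = ln ((B k / sum B K) / (A k / sum A K)) + ln (sum B K / sum A K)"
      using A[OF k] B[OF k] sA sB by (simp add: ln_div ln_mult)
    then show "(A k / sum A K - B k / sum B K) * ln (B k / A k) =
       (A k / sum A K - B k / sum B K) * ln ((B k / sum B K) / (A k / sum A K)) +
        (A k / sum A K - B k / sum B K) * ln (sum B K / sum A K)" by (simp add: distrib_left)
  qed
  also have "\<dots> = (\<Sum>k\<in>K. (A k / sum A K - B k / sum B K) * ln ((B k / sum B K) / (A k / sum A K)))"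
    using sA sB by (simp add: sum.distrib sum_distrib_right[symmetric] sum_subtractf sum_divide_distrib[symmetric])
  also have "\<dots> \<le> (\<Sum>k\<in>K. - (A k / sum A K - B k / sum B K)\<^sup>2)"
    by (intro sum_mono diff_mult_ln_ratio_le) (use sA sB leA leB A B in \<open>auto intro!: divide_pos_pos\<close>)
  finally show ?thesis by (simp add: sum_negf)
qed simp

lemma ln_fact_Suc: "ln (fact (Suc n) :: real) = ln (fact n) + ln (real n + 1)"
proof -
  have "(fact (Suc n) :: real) = fact n * (real n + 1)" by (simp add: algebra_simps)
  also have "ln \<dots> = ln (fact n) + ln (real n + 1)" by (rule ln_mult_pos) auto
  finally show ?thesis .
qed

context grand_system
begin

definition config_fact :: "('i, 's) config \<Rightarrow> real" where
  "config_fact k = (\<Prod>i\<in>UNIV. fact (fst k i))"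

lemma config_fact_pos: "config_fact k > 0" by (simp add: config_fact_def prod_pos)

lemma config_fact_zero: "fst k = (\<lambda>_. 0) \<Longrightarrow> config_fact k = 1" by (simp add: config_fact_def)

lemma config_fact_add: "config_fact (add_customer i k) = real (fst k i + 1) * config_fact k"
proof -
  have "config_fact (add_customer i k) = (\<Prod>j\<in>UNIV. (if j = i then real (fst k i + 1) else 1) * fact (fst k j))"
    unfolding config_fact_def by (intro prod.cong) (auto simp: algebra_simps)
  then show ?thesis by (simp add: prod.distrib config_fact_def)
qed

text \<open>
  By Stirling's formula this is approximately \<open>r * L_fun C a (X / r)\<close>. With factorials in place of
  \<open>x ln x - x\<close> the increments are exact logarithms and remain finite at \<open>X k = 0\<close>.
\<close>

definition lyapunov :: "real \<Rightarrow> ('i, 's) state \<Rightarrow> real" where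
  "lyapunov r X = (\<Sum>k\<in>N. ln (fact (X k)) + real (X k) * ln (config_fact k / (a (snd k) * r)))"

text \<open>
  Zero-servers are counted as \<open>a s * r\<close> here, while the algorithm uses the ceiling of \<open>a s * Z\<close>; the
  difference is controlled by \<open>V\<close>.
\<close>

definition source :: "real \<Rightarrow> ('i, 's) state \<Rightarrow> ('i, 's) config \<Rightarrow> real" where
  "source r X k = (if k \<in> N then real (X k) else a (snd k) * r)"

lemma lyapunov_arrival:
  assumes k: "k \<in> F i" and occ: "k \<in> N \<Longrightarrow> X k > 0" and r: "r > 0"
  shows "lyapunov r (reconfigure C k (add_customer i k) X) - lyapunov r X =
    ln (real (fst k i + 1) * (real (X (add_customer i k)) + 1) / source r X k)"
proof -
  let ?k = "add_customer i k"
  define b where "b = a (snd k) * r"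
  have b: "b > 0" using a_pos r by (simp add: b_def)
  have "lyapunov r (reconfigure C k ?k X) - lyapunov r X =
    (if k \<in> N then ln (fact (X k - 1)) + real (X k - 1) * ln (config_fact k / b)
       - (ln (fact (X k)) + real (X k) * ln (config_fact k / b)) else 0) +
    (ln (fact (X ?k + 1)) + real (X ?k + 1) * ln (config_fact ?k / b)
       - (ln (fact (X ?k)) + real (X ?k) * ln (config_fact ?k / b)))"
    using sum_reconfigure_diff[of k ?k "\<lambda>k n. ln (fact n) + real n * ln (config_fact k / (a (snd k) * r))" X]
      add_in_N[OF k] by (simp add: lyapunov_def b_def)
  also have "ln (fact (X ?k + 1)) + real (X ?k + 1) * ln (config_fact ?k / b)
       - (ln (fact (X ?k)) + real (X ?k) * ln (config_fact ?k / b))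
     = ln (real (X ?k) + 1) + ln (config_fact ?k / b)"
    by (simp add: ln_fact_Suc algebra_simps del: fact_Suc)
  also have "ln (config_fact ?k / b) = ln (real (fst k i + 1)) + ln (config_fact k / b)"
    using config_fact_pos[of k] b by (simp add: config_fact_add ln_mult ln_div del: of_nat_add)
  also have "(if k \<in> N then ln (fact (X k - 1)) + real (X k - 1) * ln (config_fact k / b)
       - (ln (fact (X k)) + real (X k) * ln (config_fact k / b)) else 0)
     = (if k \<in> N then - ln (real (X k)) - ln (config_fact k / b) else 0)"
  proof (cases "k \<in> N")
    case True
    then obtain m where m: "X k = Suc m" using occ not0_implies_Suc by blast
    show ?thesis using True by (simp add: m ln_fact_Suc algebra_simps del: fact_Suc)
  qed simp
  finally have *: "lyapunov r (reconfigure C k ?k X) - lyapunov r X =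
    (if k \<in> N then - ln (real (X k)) - ln (config_fact k / b) else 0) +
    (ln (real (X ?k) + 1) + (ln (real (fst k i + 1)) + ln (config_fact k / b)))" .
  show ?thesis
  proof (cases "k \<in> N")
    case True
    then show ?thesis using occ by (simp add: * source_def ln_div ln_mult)
  next
    case False
    then have "config_fact k = 1" using F_in_N_iff[OF k] by (simp add: config_fact_zero)
    then show ?thesis using False a_pos[of "snd k"] r by (simp add: * source_def ln_div ln_mult b_def)
  qed
qed

lemma lyapunov_departure:
  assumes k: "k \<in> F i" and occ: "X (add_customer i k) > 0" and r: "r > 0"
  shows "lyapunov r (reconfigure C (add_customer i k) k X) - lyapunov r X =
    ln ((if k \<in> N then real (X k) + 1 else a (snd k) * r)
      / (real (fst k i + 1) * real (X (add_customer i k))))"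
proof -
  let ?k = "add_customer i k"
  define b where "b = a (snd k) * r"
  have b: "b > 0" using a_pos r by (simp add: b_def)
  obtain m where m: "X ?k = Suc m" using occ not0_implies_Suc by blast
  have "lyapunov r (reconfigure C ?k k X) - lyapunov r X =
    (ln (fact (X ?k - 1)) + real (X ?k - 1) * ln (config_fact ?k / b)
       - (ln (fact (X ?k)) + real (X ?k) * ln (config_fact ?k / b))) +
    (if k \<in> N then ln (fact (X k + 1)) + real (X k + 1) * ln (config_fact k / b)
       - (ln (fact (X k)) + real (X k) * ln (config_fact k / b)) else 0)"
    using sum_reconfigure_diff[of ?k k "\<lambda>k n. ln (fact n) + real n * ln (config_fact k / (a (snd k) * r))" X]
      add_in_N[OF k] by (simp add: lyapunov_def b_def)
  also have "(if k \<in> N then ln (fact (X k + 1)) + real (X k + 1) * ln (config_fact k / b)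
       - (ln (fact (X k)) + real (X k) * ln (config_fact k / b)) else 0)
    = (if k \<in> N then ln (real (X k) + 1) + ln (config_fact k / b) else 0)"
    by (simp add: ln_fact_Suc algebra_simps del: fact_Suc)
  also have "ln (fact (X ?k - 1)) + real (X ?k - 1) * ln (config_fact ?k / b)
       - (ln (fact (X ?k)) + real (X ?k) * ln (config_fact ?k / b))
     = - ln (real (X ?k)) - ln (config_fact ?k / b)"
    by (simp add: m ln_fact_Suc algebra_simps del: fact_Suc)
  also have "ln (config_fact ?k / b) = ln (real (fst k i + 1)) + ln (config_fact k / b)"
    using config_fact_pos[of k] b by (simp add: config_fact_add ln_mult ln_div del: of_nat_add)
  finally have *: "lyapunov r (reconfigure C ?k k X) - lyapunov r X =
    - ln (real (X ?k)) - (ln (real (fst k i + 1)) + ln (config_fact k / b)) +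
    (if k \<in> N then ln (real (X k) + 1) + ln (config_fact k / b) else 0)" .
  show ?thesis
  proof (cases "k \<in> N")
    case True
    then show ?thesis using occ by (simp add: * ln_div ln_mult)
  next
    case False
    then have "config_fact k = 1" using F_in_N_iff[OF k] by (simp add: config_fact_zero)
    then show ?thesis using False occ a_pos[of "snd k"] r by (simp add: * ln_div ln_mult b_def)
  qed
qed

lemma X_le_Z: "k \<in> N \<Longrightarrow> X k \<le> Z X"
proof -
  assume k: "k \<in> N"
  then obtain i where i: "fst k i \<noteq> 0" by (auto simp: in_N_iff fun_eq_iff)
  have "X k \<le> fst k i * X k" using i by simp
  also have "\<dots> \<le> Y i X" unfolding Y_def by (rule member_le_sum[of k N "\<lambda>k. fst k i * X k"]) (use k in auto)
  also have "\<dots> \<le> Z X" by (rule Y_le_Z)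
  finally show ?thesis .
qed

lemma lyapunov_bound:
  "\<bar>lyapunov r X\<bar> \<le> (\<Sum>k\<in>N. 1 + \<bar>ln (config_fact k / (a (snd k) * r))\<bar>) * (1 + real (Z X)) ^ 2"
proof -
  have "\<bar>lyapunov r X\<bar> \<le> (\<Sum>k\<in>N. \<bar>ln (fact (X k)) + real (X k) * ln (config_fact k / (a (snd k) * r))\<bar>)"
    unfolding lyapunov_def by (rule sum_abs)
  also have "\<dots> \<le> (\<Sum>k\<in>N. (1 + \<bar>ln (config_fact k / (a (snd k) * r))\<bar>) * (1 + real (Z X)) ^ 2)"
  proof (rule sum_mono)
    fix k assume k: "k \<in> N"
    let ?l = "\<bar>ln (config_fact k / (a (snd k) * r))\<bar>"
    have Xk: "real (X k) \<le> 1 + real (Z X)" using X_le_Z[OF k, of X] by linarith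
    have "ln (fact (X k) :: real) \<le> ln (real (X k) ^ X k)"
    proof (cases "X k = 0")
      case False
      have "(fact (X k) :: real) \<le> real (X k ^ X k)" by (rule fact_le_power)
      then show ?thesis using False by (subst ln_le_cancel_iff) auto
    qed simp
    also have "\<dots> \<le> real (X k) * real (X k)"
    proof (cases "X k = 0")
      case False
      then have "ln (real (X k)) \<le> real (X k)" using ln_le_minus_one[of "real (X k)"] by simp
      then show ?thesis using False by (simp add: ln_realpow mult_left_mono)
    qed simp
    also have "\<dots> \<le> (1 + real (Z X)) ^ 2"
      unfolding power2_eq_square using Xk by (intro mult_mono) auto
    finally have 1: "\<bar>ln (fact (X k) :: real)\<bar> \<le> (1 + real (Z X)) ^ 2"
      using fact_ge_1[of "X k", where 'a=real] by simp
    have "real (X k) \<le> (1 + real (Z X)) ^ 2"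
      using Xk self_le_power[of "1 + real (Z X)" 2] by simp
    then have 2: "\<bar>real (X k) * ln (config_fact k / (a (snd k) * r))\<bar> \<le> (1 + real (Z X)) ^ 2 * ?l"
      unfolding abs_mult by (intro mult_right_mono) auto
    have "\<bar>ln (fact (X k)) + real (X k) * ln (config_fact k / (a (snd k) * r))\<bar>
       \<le> (1 + real (Z X)) ^ 2 + (1 + real (Z X)) ^ 2 * ?l"
      by (rule order.trans[OF abs_triangle_ineq add_mono[OF 1 2]])
    then show "\<bar>ln (fact (X k)) + real (X k) * ln (config_fact k / (a (snd k) * r))\<bar>
       \<le> (1 + ?l) * (1 + real (Z X)) ^ 2"
      by (simp add: algebra_simps)
  qed
  finally show ?thesis by (simp add: sum_distrib_right)
qed

text \<open>
  Weights proportional, up to the added 1, to the probabilities that an arriving customer is placed into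
  a server in configuration \<open>k\<close>. The 1 comes from the increment of \<open>lyapunov\<close> along a
  departure; it keeps the logarithms finite when no server has configuration \<open>k\<close>.
\<close>

definition arr :: "('i, 's) state \<Rightarrow> ('i, 's) config \<Rightarrow> real" where
  "arr X k = real (servers C a X k) + 1"

text \<open>
  The analogous weights for a departing type-\<open>i\<close> customer leaving its server in configuration \<open>k\<close>,
  with the added 1 of the increment of \<open>lyapunov\<close> along an arrival.
\<close>

definition dep :: "'i \<Rightarrow> ('i, 's) state \<Rightarrow> ('i, 's) config \<Rightarrow> real" where
  "dep i X k = real (fst k i + 1) * (real (X (add_customer i k)) + 1)"

definition gap :: "'i \<Rightarrow> ('i, 's) state \<Rightarrow> ('i, 's) config \<Rightarrow> real" where
  "gap i X k = arr X k / sum (arr X) (F i) - dep i X k / sum (dep i X) (F i)"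

definition imbalance :: "('i, 's) state \<Rightarrow> real" where
  "imbalance X = (\<Sum>i\<in>UNIV. lam i * (\<Sum>k\<in>F i. (gap i X k)\<^sup>2))"

lemma arr_pos: "arr X k \<ge> 1" by (simp add: arr_def)
lemma dep_pos: "dep i X k \<ge> 1"
proof -
  have "1 * 1 \<le> real (fst k i + 1) * (real (X (add_customer i k)) + 1)" by (intro mult_mono) auto
  then show ?thesis by (simp add: dep_def)
qed

lemma gap_square_le_1: "k \<in> F i \<Longrightarrow> (gap i X k)\<^sup>2 \<le> 1"
proof -
  assume k: "k \<in> F i"
  have frac: "0 \<le> h k / sum h (F i) \<and> h k / sum h (F i) \<le> 1" if h: "\<And>k. h k \<ge> 1"
    for h :: "('i, 's) config \<Rightarrow> real"
  proof -
    have "h k \<le> sum h (F i)" using k order.trans[OF zero_le_one h] by (intro member_le_sum) auto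
    moreover have "h k > 0" using h[of k] by linarith
    ultimately show ?thesis by simp
  qed
  have "\<bar>gap i X k\<bar> \<le> 1"
    using frac[of "arr X"] frac[of "dep i X"] arr_pos dep_pos unfolding gap_def by fastforce
  then show ?thesis by (simp add: abs_square_le_1)
qed

lemma imbalance_nonneg: "imbalance X \<ge> 0"
  unfolding imbalance_def using lam_pos by (intro sum_nonneg mult_nonneg_nonneg) (auto simp: less_imp_le)

lemma imbalance_le: "imbalance X \<le> (\<Sum>i\<in>UNIV. lam i * real (card (F i)))"
  unfolding imbalance_def
proof (intro sum_mono mult_left_mono)
  fix i show "(\<Sum>k\<in>F i. (gap i X k)\<^sup>2) \<le> real (card (F i))"
    using sum_mono[of "F i" "\<lambda>k. (gap i X k)\<^sup>2" "\<lambda>_. 1"] gap_square_le_1 by simp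
qed (use lam_pos in \<open>auto simp: less_imp_le\<close>)

section \<open>Drift of the Lyapunov function\<close>

definition a_inv :: real where "a_inv = (\<Sum>s\<in>UNIV. 1 / a s)"
definition a_sum :: real where "a_sum = (\<Sum>s\<in>UNIV. a s)"
text \<open>
  A simultaneous bound for the number of edges of a type and for the factors \<open>k i + 1\<close>.
\<close>

definition kappa :: real where "kappa = (\<Sum>i\<in>UNIV. \<Sum>k\<in>F i. real (fst k i + 1))"
definition log_range :: "('i, 's) state \<Rightarrow> real" where
  "log_range X = ln ((a_sum + kappa + 2) * (1 + real (Z X)))"

lemma a_inv: "1 / a s \<le> a_inv" "0 \<le> a_inv"
proof -
  show "1 / a s \<le> a_inv" unfolding a_inv_def
    by (rule member_le_sum[of s UNIV "\<lambda>s. 1 / a s"]) (use less_imp_le[OF a_pos] in auto)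
  show "0 \<le> a_inv" unfolding a_inv_def using less_imp_le[OF a_pos] by (intro sum_nonneg) auto
qed

lemma a_sum: "a s \<le> a_sum" "0 \<le> a_sum"
proof -
  show "a s \<le> a_sum" unfolding a_sum_def
    by (rule member_le_sum[of s UNIV a]) (use less_imp_le[OF a_pos] in auto)
  show "0 \<le> a_sum" unfolding a_sum_def using less_imp_le[OF a_pos] by (intro sum_nonneg) auto
qed

lemma kappa_sum: "(\<Sum>k\<in>F i. real (fst k i + 1)) \<le> kappa"
  unfolding kappa_def
  by (rule member_le_sum[of i UNIV "\<lambda>i. \<Sum>k\<in>F i. real (fst k i + 1)"]) (auto intro!: sum_nonneg)

lemma kappa_card: "real (card (F i)) \<le> kappa"
  using sum_mono[of "F i" "\<lambda>_. 1" "\<lambda>k. real (fst k i + 1)"] kappa_sum[of i] by simp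

lemma kappa_mult: "k \<in> F i \<Longrightarrow> real (fst k i + 1) \<le> kappa"
  using member_le_sum[of k "F i" "\<lambda>k. real (fst k i + 1)"] kappa_sum[of i] by fastforce

lemma kappa_ge_1: "1 \<le> kappa"
proof -
  have "real (fst ((\<lambda>_. 0), s0 i) i + 1) \<le> kappa" for i by (rule kappa_mult[OF zero_in_F])
  then show ?thesis by simp
qed

lemma servers_zero:
  "k \<in> F i \<Longrightarrow> k \<notin> N \<Longrightarrow> servers C a X k = nat \<lceil>a (snd k) * real (Z X)\<rceil>"
  using F_in_N_iff by (simp add: servers_def)

lemma servers_nonzero: "k \<in> N \<Longrightarrow> servers C a X k = X k"
  by (auto simp: servers_def in_N_iff)

lemma servers_zero_bounds:
  assumes "k \<in> F i" "k \<notin> N"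
  shows "a (snd k) * real (Z X) \<le> real (servers C a X k)"
    "real (servers C a X k) \<le> a (snd k) * real (Z X) + 1"
proof -
  have "real (servers C a X k) = of_int \<lceil>a (snd k) * real (Z X)\<rceil>"
    using less_imp_le[OF a_pos, of "snd k"] by (simp add: servers_zero[OF assms] of_nat_nat)
  then show "a (snd k) * real (Z X) \<le> real (servers C a X k)"
    "real (servers C a X k) \<le> a (snd k) * real (Z X) + 1" by linarith+
qed

lemma arr_upper: "k \<in> F i \<Longrightarrow> arr X k \<le> (a_sum + kappa + 2) * (1 + real (Z X))"
proof -
  assume k: "k \<in> F i"
  have "0 \<le> a_sum * real (Z X)" "0 \<le> kappa * real (Z X)" using a_sum(2) kappa_ge_1 by auto
  moreover have "arr X k \<le> a_sum * real (Z X) + real (Z X) + 2"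
  proof (cases "k \<in> N")
    case True
    then have "servers C a X k = X k" by (rule servers_nonzero)
    then show ?thesis using X_le_Z[OF True, of X] \<open>0 \<le> a_sum * real (Z X)\<close> by (simp add: arr_def)
  next
    case False
    then have "arr X k \<le> a (snd k) * real (Z X) + 2"
      using servers_zero_bounds(2)[OF k, of X] by (simp add: arr_def)
    also have "\<dots> \<le> a_sum * real (Z X) + 2" using a_sum(1) by (intro add_right_mono mult_right_mono) auto
    finally show ?thesis by simp
  qed
  ultimately show ?thesis using a_sum(2) kappa_ge_1 unfolding distrib_left distrib_right by linarith
qed

lemma departing_le_Y: "k \<in> F i \<Longrightarrow> real (fst k i + 1) * real (X (add_customer i k)) \<le> real (Y i X)"
  unfolding Y_eq_sum_departures
  by (rule member_le_sum[of k "F i" "\<lambda>k. real (fst k i + 1) * real (X (add_customer i k))"]) auto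

lemma departing_le_Z: "k \<in> F i \<Longrightarrow> real (fst k i + 1) * real (X (add_customer i k)) \<le> real (Z X)"
  using departing_le_Y[of k i X] Y_le_Z[of i X] by linarith

lemma dep_eq: "dep i X k = real (fst k i + 1) * real (X (add_customer i k)) + real (fst k i + 1)"
  by (simp add: dep_def algebra_simps)

lemma dep_upper: "k \<in> F i \<Longrightarrow> dep i X k \<le> (a_sum + kappa + 2) * (1 + real (Z X))"
proof -
  assume k: "k \<in> F i"
  have "0 \<le> a_sum * real (Z X)" "0 \<le> kappa * real (Z X)" using a_sum(2) kappa_ge_1 by auto
  moreover have "dep i X k \<le> real (Z X) + kappa"
    using departing_le_Z[OF k, of X] kappa_mult[OF k] unfolding dep_eq by linarith
  ultimately show ?thesis using a_sum(2) kappa_ge_1 unfolding distrib_left distrib_right by linarith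
qed

lemma log_range_nonneg: "0 \<le> log_range X"
proof -
  have "1 * 1 \<le> (a_sum + kappa + 2) * (1 + real (Z X))"
    using a_sum(2) kappa_ge_1 by (intro mult_mono) auto
  then show ?thesis unfolding log_range_def by (intro ln_ge_zero) simp
qed

lemma ln_dep_arr_bound: "k \<in> F i \<Longrightarrow> \<bar>ln (dep i X k / arr X k)\<bar> \<le> log_range X"
proof -
  assume k: "k \<in> F i"
  have pos: "arr X k > 0" "dep i X k > 0" using arr_pos[of X k] dep_pos[of i X k] by linarith+
  have "ln (dep i X k / arr X k) = ln (dep i X k) - ln (arr X k)"
    using pos by (simp add: ln_div)
  moreover have "0 \<le> ln (dep i X k)" "0 \<le> ln (arr X k)"
    using arr_pos[of X k] dep_pos[of i X k] by auto
  moreover have "ln (dep i X k) \<le> log_range X" "ln (arr X k) \<le> log_range X"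
    unfolding log_range_def using pos arr_upper[OF k, of X] dep_upper[OF k, of X]
    by (auto intro!: ln_mono)
  ultimately show ?thesis by linarith
qed

text \<open>
  A type-\<open>i\<close> customer fits into the zero-servers of type \<open>s0 i\<close>, hence the number of available servers
  is at least of the order of \<open>Z\<close>.
\<close>

lemma available_ge: "a (s0 i) * real (Z X) \<le> real (available_servers C a X i)"
proof -
  have "a (s0 i) * real (Z X) \<le> real (servers C a X ((\<lambda>_. 0), s0 i))"
    using servers_zero_bounds(1)[OF zero_in_F, of i X] by simp
  also have "\<dots> \<le> real (available_servers C a X i)"
    unfolding available_servers_def of_nat_le_iff by (rule member_le_sum[OF zero_in_F]) auto
  finally show ?thesis .
qed

text \<open>
  Replacing the denominator \<open>source\<close> by \<open>arr\<close> in the logarithm costs little on average: the placement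
  probability is proportional to the number \<open>A\<close> of servers, and \<open>A * ln ((A + 1) / A) \<le> 1\<close>. For the
  zero-servers the replacement costs a multiple of the relative deviation of \<open>Z\<close> from \<open>r\<close>.
\<close>

lemma arrival_edge_bound:
  assumes k: "k \<in> F i" and r: "r \<ge> 1" and Z: "Z X \<ge> 1"
  defines "T \<equiv> real (available_servers C a X i)"
  shows "lam i * r * placement_prob C a s0 X i k * (lyapunov r (reconfigure C k (add_customer i k) X) - lyapunov r X)
    \<le> lam i * r * (real (servers C a X k) / T) * ln (dep i X k / arr X k)
       + lam i * (r / T + V r X + 2 * a_inv)"
proof -
  define A where "A = real (servers C a X k)"
  have T: "T > 0" unfolding T_def
    using Z a_pos[of "s0 i"] by (intro less_le_trans[OF _ available_ge]) auto
  have pl: "placement_prob C a s0 X i k = A / T"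
    using T k by (simp add: placement_prob_def A_def T_def)
  have err: "0 \<le> r / T" "0 \<le> V r X" "0 \<le> a_inv" using T r V_nonneg a_inv by auto
  show ?thesis
  proof (cases "A = 0")
    case True
    then show ?thesis using err less_imp_le[OF lam_pos[of i]] by (simp add: pl A_def[symmetric])
  next
    case False
    then have A: "A > 0" "arr X k = A + 1" by (auto simp: A_def arr_def)
    have AT: "A \<le> T" unfolding A_def T_def available_servers_def of_nat_le_iff
      by (rule member_le_sum[OF k]) auto
    have dep: "dep i X k > 0" using dep_pos[of i X k] by linarith
    have src: "source r X k > 0"
      using A a_pos[of "snd k"] r by (auto simp: source_def A_def servers_nonzero)
    have occ: "k \<in> N \<Longrightarrow> X k > 0" using A by (auto simp: A_def servers_nonzero)
    have L: "lyapunov r (reconfigure C k (add_customer i k) X) - lyapunov r X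
        = ln (dep i X k / arr X k) + ln (arr X k / source r X k)"
      using lyapunov_arrival[of k i X r] k occ r dep src A by (simp add: dep_def ln_div ln_mult)
    have "r * (A / T) * ln (arr X k / source r X k) \<le> r / T + V r X + 2 * a_inv"
    proof (cases "k \<in> N")
      case True
      then have "source r X k = A" by (simp add: source_def A_def servers_nonzero)
      then have "ln (arr X k / source r X k) \<le> 1 / A"
        using ln_add_one_self_le_self[of "1 / A"] A by (simp add: add_divide_distrib add.commute)
      then have "r * (A / T) * ln (arr X k / source r X k) \<le> r * (A / T) * (1 / A)"
        using A T r by (intro mult_left_mono) auto
      then show ?thesis using A err by simp
    next
      case False
      have s: "source r X k = a (snd k) * r" using False by (simp add: source_def)
      have "ln (arr X k / source r X k) \<le> arr X k / source r X k - 1"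
        using src A by (intro ln_le_minus_one) auto
      also have "\<dots> \<le> (a (snd k) * real (Z X) + 2) / (a (snd k) * r) - 1"
        unfolding s using servers_zero_bounds(2)[OF k False, of X] a_pos[of "snd k"] r
        by (intro diff_right_mono divide_right_mono) (auto simp: arr_def)
      also have "\<dots> = ((real (Z X) - r) + 2 * (1 / a (snd k))) / r"
        using a_pos[of "snd k"] r by (simp add: field_simps)
      also have "\<dots> \<le> (V r X + 2 * a_inv) / r"
        using Z_deviation_le_V[of X r] a_inv(1)[of "snd k"] r by (intro divide_right_mono) linarith+
      finally have "r * (A / T) * ln (arr X k / source r X k) \<le> r * (A / T) * ((V r X + 2 * a_inv) / r)"
        using A T r by (intro mult_left_mono) auto
      also have "\<dots> \<le> r * 1 * ((V r X + 2 * a_inv) / r)"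
        using AT T A r err by (intro mult_right_mono mult_left_mono) auto
      finally show ?thesis using r err by simp
    qed
    then have "lam i * (r * (A / T) * ln (arr X k / source r X k)) \<le> lam i * (r / T + V r X + 2 * a_inv)"
      by (rule mult_left_mono) (use lam_pos[of i] in simp)
    then show ?thesis unfolding L pl A_def[symmetric] by (simp add: algebra_simps)
  qed
qed

text \<open>
  As for arrivals, with rate proportional to \<open>B\<close> and \<open>B * ln (dep / B) \<le> dep - B\<close>. For zero-servers
  the error \<open>ln (r / Z)\<close> is multiplied by \<open>B \<le> Z\<close>, which turns the relative deviation of \<open>Z\<close> into the
  absolute one.
\<close>

lemma departure_edge_bound:
  assumes k: "k \<in> F i" and r: "r \<ge> 1" and Z: "Z X \<ge> 1"
  defines "B \<equiv> real (fst k i + 1) * real (X (add_customer i k))"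
  shows "mu i * B * (lyapunov r (reconfigure C (add_customer i k) k X) - lyapunov r X)
    \<le> - (mu i * B * ln (dep i X k / arr X k)) + mu i * (kappa + V r X)"
proof (cases "X (add_customer i k) = 0")
  case True
  then show ?thesis using mu_pos[of i] kappa_ge_1 V_nonneg[of r X] by (simp add: B_def)
next
  case False
  then have B: "B > 0" by (simp add: B_def)
  have BZ: "B \<le> real (Z X)" unfolding B_def by (rule departing_le_Z[OF k])
  have dep: "dep i X k > 0" using dep_pos[of i X k] by linarith
  have arr: "arr X k > 0" using arr_pos[of X k] by linarith
  define D where "D = (if k \<in> N then real (X k) + 1 else a (snd k) * r)"
  have D: "D > 0" using a_pos[of "snd k"] r by (simp add: D_def)
  have L: "lyapunov r (reconfigure C (add_customer i k) k X) - lyapunov r X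
     = ln (D / arr X k) - ln (dep i X k / arr X k) + ln (dep i X k / B)"
    using lyapunov_departure[of k i X r, folded D_def B_def] k False r B D dep arr
    by (simp add: ln_div)
  have "ln (dep i X k / B) \<le> dep i X k / B - 1" using dep B by (intro ln_le_minus_one) auto
  also have "\<dots> = real (fst k i + 1) / B"
    using B unfolding dep_eq B_def[symmetric] by (simp add: add_divide_distrib)
  finally have "B * ln (dep i X k / B) \<le> B * (real (fst k i + 1) / B)"
    using B by (intro mult_left_mono) auto
  then have 1: "B * ln (dep i X k / B) \<le> kappa" using B kappa_mult[OF k] by simp
  have 2: "B * ln (D / arr X k) \<le> V r X"
  proof (cases "k \<in> N")
    case True
    then have "D = arr X k" by (simp add: D_def arr_def servers_nonzero)
    then show ?thesis using arr V_nonneg by simp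
  next
    case False
    have D_eq: "D = a (snd k) * r" using False by (simp add: D_def)
    have "ln (D / arr X k) \<le> D / arr X k - 1" using D arr by (intro ln_le_minus_one) auto
    also have "\<dots> \<le> a (snd k) * r / (a (snd k) * real (Z X)) - 1"
      unfolding D_eq using servers_zero_bounds(1)[OF k False, of X] a_pos[of "snd k"] r Z
      by (intro diff_right_mono divide_left_mono) (auto simp: arr_def)
    also have "\<dots> = (r - real (Z X)) / real (Z X)"
      using a_pos[of "snd k"] Z by (simp add: field_simps)
    also have "\<dots> \<le> V r X / real (Z X)"
      using Z_deviation_le_V[of X r] by (intro divide_right_mono) linarith+
    finally have "B * ln (D / arr X k) \<le> B * (V r X / real (Z X))"
      using B by (intro mult_left_mono) auto
    also have "\<dots> \<le> real (Z X) * (V r X / real (Z X))"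
      using BZ V_nonneg[of r X] by (intro mult_right_mono) auto
    finally show ?thesis using Z by simp
  qed
  have "mu i * (B * ln (D / arr X k) + B * ln (dep i X k / B)) \<le> mu i * (kappa + V r X)"
    using 1 2 mu_pos[of i] by (intro mult_left_mono) auto
  then show ?thesis unfolding L by (simp add: algebra_simps)
qed

end

lemma shifted_fraction_diff:
  fixes A T n :: real
  assumes "0 \<le> A" "A \<le> T" "0 < T" "1 \<le> n"
  shows "\<bar>A / T - (A + 1) / (T + n)\<bar> \<le> n / T"
proof -
  have "A / T - (A + 1) / (T + n) = (A * n - T) / (T * (T + n))"
    using assms by (simp add: field_simps)
  then have "\<bar>A / T - (A + 1) / (T + n)\<bar> = \<bar>A * n - T\<bar> / (T * (T + n))"
    using assms by (simp add: abs_mult)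
  also have "\<dots> \<le> n * (T + n) / (T * (T + n))"
  proof (rule divide_right_mono)
    have "A * n \<le> T * n" "1 * T \<le> n * T" using assms by (intro mult_right_mono; simp)+
    moreover have "0 \<le> A * n" "0 \<le> n * n" using assms by auto
    ultimately show "\<bar>A * n - T\<bar> \<le> n * (T + n)"
      using assms unfolding abs_le_iff distrib_left mult.commute[of T n] by linarith
  qed (use assms in simp)
  also have "\<dots> = n / T" using assms by simp
  finally show ?thesis .
qed

context grand_system
begin

definition drift_const :: real where
  "drift_const = (\<Sum>i\<in>UNIV. kappa * (lam i * kappa * a_inv + mu i * (2 * kappa + 1))
     + kappa * (lam i * (3 * a_inv + 1) + mu i * (kappa + 1)) + lam i * (a_inv + kappa))"

text \<open>
  The net flow across an edge differs from \<open>lam i * r * gap\<close> in two ways: by the added ones in the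
  weights, and by the departure rate \<open>mu i * Y i X\<close>, which is only approximately \<open>lam i * r\<close>.
\<close>

lemma flow_minus_gap_bound:
  assumes k: "k \<in> F i" and r: "r \<ge> 1" and Z: "Z X \<ge> 1"
  defines "T \<equiv> real (available_servers C a X i)"
  defines "B \<equiv> real (fst k i + 1) * real (X (add_customer i k))"
  shows "\<bar>lam i * r * (real (servers C a X k) / T) - mu i * B - lam i * r * gap i X k\<bar>
    \<le> lam i * kappa * (r / T) + mu i * (2 * kappa + V r X)"
proof -
  define A where "A = real (servers C a X k)"
  define n where "n = real (card (F i))"
  have T: "T > 0" unfolding T_def
    using Z a_pos[of "s0 i"] by (intro less_le_trans[OF _ available_ge]) auto
  have AT: "A \<le> T" unfolding A_def T_def available_servers_def of_nat_le_iff
    by (rule member_le_sum[OF k]) auto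
  have n: "1 \<le> n" "n \<le> kappa" unfolding n_def using kappa_card[of i] k
    by (auto simp: Suc_le_eq card_gt_0_iff)
  have sarr: "sum (arr X) (F i) = T + n"
    by (simp add: arr_def T_def n_def available_servers_def sum.distrib)
  define m where "m = (\<Sum>k\<in>F i. real (fst k i + 1))"
  have m: "0 \<le> m" "m \<le> kappa" unfolding m_def using kappa_sum by (auto intro!: sum_nonneg)
  have sdep: "sum (dep i X) (F i) = real (Y i X) + m"
    unfolding m_def dep_eq sum.distrib Y_eq_sum_departures ..
  have dep: "dep i X k \<ge> 1" by (rule dep_pos)
  have depY: "dep i X k \<le> real (Y i X) + m" unfolding sdep[symmetric]
    by (rule member_le_sum[OF k]) (use order.trans[OF zero_le_one dep_pos] in auto)
  define Q where "Q = real (Y i X) + m"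
  have Q: "Q > 0" "dep i X k \<le> Q" using dep depY by (auto simp: Q_def)
  have 1: "\<bar>lam i * r * (A / T) - lam i * r * ((A + 1) / (T + n))\<bar> \<le> lam i * kappa * (r / T)"
  proof -
    have "\<bar>A / T - (A + 1) / (T + n)\<bar> \<le> n / T"
      by (rule shifted_fraction_diff) (use AT T n in \<open>auto simp: A_def\<close>)
    also have "\<dots> \<le> kappa / T" using n T by (intro divide_right_mono) auto
    finally have "lam i * r * \<bar>A / T - (A + 1) / (T + n)\<bar> \<le> lam i * r * (kappa / T)"
      using lam_pos[of i] r by (intro mult_left_mono) auto
    moreover have "\<bar>lam i * r * (A / T) - lam i * r * ((A + 1) / (T + n))\<bar>
       = lam i * r * \<bar>A / T - (A + 1) / (T + n)\<bar>"
      unfolding right_diff_distrib[symmetric] abs_mult using lam_pos[of i] r by simp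
    ultimately show ?thesis by (simp add: mult_ac)
  qed
  have 2: "\<bar>mu i * B - lam i * r * (dep i X k / Q)\<bar> \<le> mu i * (2 * kappa + V r X)"
  proof -
    have "B - rho i * r * (dep i X k / Q) = dep i X k / Q * (Q - rho i * r) - real (fst k i + 1)"
      using Q unfolding dep_eq B_def by (simp add: field_simps)
    also have "\<bar>\<dots>\<bar> \<le> \<bar>dep i X k / Q * (Q - rho i * r)\<bar> + \<bar>real (fst k i + 1)\<bar>"
      by (rule abs_triangle_ineq4)
    also have "\<dots> \<le> 1 * \<bar>Q - rho i * r\<bar> + kappa"
      unfolding abs_mult using Q dep kappa_mult[OF k] by (intro add_mono mult_right_mono) auto
    also have "\<dots> \<le> 2 * kappa + V r X"
      using Y_deviation_le_V[of i X r] abs_triangle_ineq[of "real (Y i X) - rho i * r" m] m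
      unfolding Q_def by (simp add: algebra_simps)
    finally have "mu i * \<bar>B - rho i * r * (dep i X k / Q)\<bar> \<le> mu i * (2 * kappa + V r X)"
      using mu_pos[of i] by (intro mult_left_mono) auto
    moreover have "mu i * B - lam i * r * (dep i X k / Q) = mu i * (B - rho i * r * (dep i X k / Q))"
      using rho_eq[of i] mu_pos[of i] by (simp add: field_simps)
    ultimately show ?thesis using mu_pos[of i] by (simp add: abs_mult)
  qed
  have "lam i * r * (A / T) - mu i * B - lam i * r * gap i X k
     = (lam i * r * (A / T) - lam i * r * ((A + 1) / (T + n))) - (mu i * B - lam i * r * (dep i X k / Q))"
    unfolding gap_def sarr sdep Q_def[symmetric] by (simp add: arr_def A_def algebra_simps)
  then show ?thesis unfolding A_def[symmetric]
    by (simp only: order.trans[OF abs_triangle_ineq4 add_mono[OF 1 2]])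
qed

text \<open>
  Each edge contributes net flow times \<open>ln (dep / arr)\<close>, up to the errors of the previous lemmas.
  Replacing the flow by \<open>lam i * r * gap\<close> multiplies its error by the logarithm, whence the factor
  \<open>log_range\<close>; what remains is a symmetrised relative entropy.
\<close>

lemma type_drift_bound_nonempty:
  assumes r: "r \<ge> 1" and Z: "Z X \<ge> 1"
  shows "type_drift r (lyapunov r) i X \<le> - (r * (lam i * (\<Sum>k\<in>F i. (gap i X k)\<^sup>2)))
    + (kappa * (lam i * kappa * a_inv + mu i * (2 * kappa + 1))
     + kappa * (lam i * (3 * a_inv + 1) + mu i * (kappa + 1))) * ((1 + log_range X) * (1 + V r X))"
proof -
  define T where "T = real (available_servers C a X i)"
  define w where "w = 1 + V r X"
  define B where "B k = real (fst k i + 1) * real (X (add_customer i k))" for k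
  define l where "l k = ln (dep i X k / arr X k)" for k
  define \<alpha> where "\<alpha> k = lam i * r * (real (servers C a X k) / T) - mu i * B k" for k
  define e1 where "e1 = lam i * (3 * a_inv + 1) + mu i * (kappa + 1)"
  define e2 where "e2 = lam i * kappa * a_inv + mu i * (2 * kappa + 1)"
  have lm: "0 < lam i" "0 < mu i" using lam_pos mu_pos by auto
  have k0: "kappa \<ge> 1" "a_inv \<ge> 0" using kappa_ge_1 a_inv by auto
  have w: "w \<ge> 1" using V_nonneg by (simp add: w_def)
  have lb: "log_range X \<ge> 0" by (rule log_range_nonneg)
  have e: "0 \<le> e1" "0 \<le> e2" using lm k0 by (auto simp: e1_def e2_def)
  have T: "T > 0" unfolding T_def
    using Z a_pos[of "s0 i"] by (intro less_le_trans[OF _ available_ge]) auto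
  \<comment> \<open>\<open>r / Z = 1 + (r - Z) / Z\<close> and \<open>Z \<ge> 1\<close>, so \<open>r / Z\<close> is at most \<open>1 + V\<close> however small \<open>Z\<close> is\<close>
  have rT: "r / T \<le> a_inv * w"
  proof -
    have "r / T \<le> r / (a (s0 i) * real (Z X))"
      unfolding T_def using available_ge[of i X] a_pos[of "s0 i"] Z r T unfolding T_def
      by (intro divide_left_mono) auto
    also have "\<dots> = 1 / a (s0 i) * (r / real (Z X))" by simp
    also have "\<dots> \<le> a_inv * w"
    proof (rule mult_mono)
      have "V r X * 1 \<le> V r X * real (Z X)" using V_nonneg Z by (intro mult_left_mono) auto
      then have "r \<le> w * real (Z X)"
        using Z_deviation_le_V[of X r] unfolding w_def distrib_right by linarith
      then show "r / real (Z X) \<le> w" using Z by (simp add: pos_divide_le_eq)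
    qed (use a_inv r in auto)
    finally show ?thesis .
  qed
  have edge: "lam i * r * placement_prob C a s0 X i k * (lyapunov r (reconfigure C k (add_customer i k) X) - lyapunov r X) +
     mu i * real (fst k i + 1) * real (X (add_customer i k))
       * (lyapunov r (reconfigure C (add_customer i k) k X) - lyapunov r X) \<le>
      lam i * r * gap i X k * l k + (e2 * log_range X + e1) * w" if k: "k \<in> F i" for k
  proof -
    have d1: "lam i * r * placement_prob C a s0 X i k * (lyapunov r (reconfigure C k (add_customer i k) X) - lyapunov r X) +
     mu i * real (fst k i + 1) * real (X (add_customer i k))
       * (lyapunov r (reconfigure C (add_customer i k) k X) - lyapunov r X)
      \<le> \<alpha> k * l k + lam i * (r / T + V r X + 2 * a_inv) + mu i * (kappa + V r X)"
      using arrival_edge_bound[OF k r Z] departure_edge_bound[OF k r Z]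
      unfolding \<alpha>_def B_def l_def T_def by (simp add: algebra_simps)
    have "r / T + V r X + 2 * a_inv \<le> (3 * a_inv + 1) * w"
    proof -
      have "a_inv * 1 \<le> a_inv * w" using k0 w by (intro mult_left_mono) auto
      then show ?thesis using rT by (simp add: w_def algebra_simps)
    qed
    moreover have "kappa + V r X \<le> (kappa + 1) * w"
      using k0 V_nonneg[of r X] by (simp add: w_def algebra_simps)
    ultimately have d2: "lam i * (r / T + V r X + 2 * a_inv) + mu i * (kappa + V r X) \<le> e1 * w"
    proof -
      assume "r / T + V r X + 2 * a_inv \<le> (3 * a_inv + 1) * w" "kappa + V r X \<le> (kappa + 1) * w"
      then have "lam i * (r / T + V r X + 2 * a_inv) \<le> lam i * ((3 * a_inv + 1) * w)"
        "mu i * (kappa + V r X) \<le> mu i * ((kappa + 1) * w)"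
        using lm by (auto intro!: mult_left_mono simp del: mult_le_cancel_left_pos)
      then show ?thesis unfolding e1_def by (simp add: algebra_simps)
    qed
    have "\<bar>\<alpha> k - lam i * r * gap i X k\<bar> \<le> lam i * kappa * (r / T) + mu i * (2 * kappa + V r X)"
      using flow_minus_gap_bound[OF k r Z] unfolding \<alpha>_def B_def T_def .
    also have "\<dots> \<le> lam i * kappa * (a_inv * w) + mu i * ((2 * kappa + 1) * w)"
      using rT lm k0 V_nonneg[of r X] by (intro add_mono mult_left_mono) (auto simp: w_def algebra_simps)
    also have "\<dots> = e2 * w" by (simp add: e2_def algebra_simps)
    finally have "\<bar>\<alpha> k - lam i * r * gap i X k\<bar> * \<bar>l k\<bar> \<le> e2 * w * log_range X"
      using ln_dep_arr_bound[OF k, of X] e w unfolding l_def by (intro mult_mono) auto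
    then have "(\<alpha> k - lam i * r * gap i X k) * l k \<le> e2 * w * log_range X"
      unfolding abs_mult[symmetric] by linarith
    then have "\<alpha> k * l k \<le> lam i * r * gap i X k * l k + e2 * w * log_range X"
      by (simp add: left_diff_distrib)
    with d1 d2 show ?thesis by (simp add: algebra_simps)
  qed
  have "type_drift r (lyapunov r) i X \<le> (\<Sum>k\<in>F i. lam i * r * gap i X k * l k + (e2 * log_range X + e1) * w)"
    unfolding type_drift_def by (rule sum_mono) (rule edge)
  also have "\<dots> = lam i * r * (\<Sum>k\<in>F i. gap i X k * l k) + real (card (F i)) * ((e2 * log_range X + e1) * w)"
    by (simp add: sum.distrib sum_distrib_left mult.assoc)
  also have "\<dots> \<le> lam i * r * (- (\<Sum>k\<in>F i. (gap i X k)\<^sup>2)) + kappa * ((e2 * log_range X + e1) * w)"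
  proof (intro add_mono mult_left_mono mult_right_mono)
    show "(\<Sum>k\<in>F i. gap i X k * l k) \<le> - (\<Sum>k\<in>F i. (gap i X k)\<^sup>2)"
      unfolding gap_def l_def
      by (rule sum_fraction_diff_mult_ln_le)
         (use less_le_trans[OF zero_less_one arr_pos] less_le_trans[OF zero_less_one dep_pos] in auto)
  qed (use lm r e lb w kappa_card in auto)
  also have "kappa * ((e2 * log_range X + e1) * w) \<le> (kappa * e2 + kappa * e1) * ((1 + log_range X) * w)"
  proof -
    have "e2 * log_range X + e1 \<le> (e2 + e1) * (1 + log_range X)" using e lb by (simp add: algebra_simps)
    then have "kappa * ((e2 * log_range X + e1) * w) \<le> kappa * (((e2 + e1) * (1 + log_range X)) * w)"
      using k0 w by (intro mult_left_mono mult_right_mono) auto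
    then show ?thesis by (simp add: algebra_simps)
  qed
  finally show ?thesis by (simp add: e1_def e2_def w_def mult_ac)
qed

text \<open>
  In the empty system the placement follows the special rule. There \<open>V\<close> is at least \<open>r\<close>, which makes
  the error term dominate everything.
\<close>

lemma type_drift_bound_empty:
  assumes r: "r \<ge> 1" and Z: "Z X = 0"
  shows "type_drift r (lyapunov r) i X \<le> - (r * (lam i * (\<Sum>k\<in>F i. (gap i X k)\<^sup>2)))
    + lam i * (a_inv + kappa) * ((1 + log_range X) * (1 + V r X))"
proof -
  have X0: "X k = 0" if "k \<in> N" for k using X_le_Z[OF that, of X] Z by simp
  have lm: "0 < lam i" using lam_pos by auto
  have k0: "kappa \<ge> 1" "a_inv \<ge> 0" using kappa_ge_1 a_inv by auto
  have srv: "servers C a X k = 0" if "k \<in> F i" for k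
    using X0[of k] servers_zero[OF that, of X] Z by (cases "k \<in> N") (auto simp: servers_nonzero)
  then have av: "available_servers C a X i = 0" by (simp add: available_servers_def)
  let ?z = "((\<lambda>_. 0), s0 i) :: ('i, 's) config"
  have z: "?z \<in> F i" "?z \<notin> N" by (auto simp: zero_in_F)
  have "type_drift r (lyapunov r) i X = (\<Sum>k\<in>F i. if k = ?z then lam i * r * (lyapunov r (reconfigure C k (add_customer i k) X) - lyapunov r X) else 0)"
    unfolding type_drift_def
    by (rule sum.cong) (auto simp: placement_prob_def av X0 add_in_N)
  also have "\<dots> = lam i * r * (lyapunov r (reconfigure C ?z (add_customer i ?z) X) - lyapunov r X)"
    using z by (simp add: sum.delta)
  also have "lyapunov r (reconfigure C ?z (add_customer i ?z) X) - lyapunov r X = ln (1 / (a (s0 i) * r))"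
    using lyapunov_arrival[of ?z i X r] z r by (simp add: X0 add_in_N source_def)
  also have "ln (1 / (a (s0 i) * r)) \<le> 1 / (a (s0 i) * r) - 1"
    using a_pos[of "s0 i"] r by (intro ln_le_minus_one) auto
  also have "\<dots> \<le> 1 / a (s0 i)" 
  proof -
    have "1 / (a (s0 i) * r) \<le> 1 / a (s0 i)"
      using a_pos[of "s0 i"] r by (intro divide_left_mono) auto
    then show ?thesis by linarith
  qed
  also have "\<dots> \<le> a_inv" by (rule a_inv)
  finally have 1: "type_drift r (lyapunov r) i X \<le> lam i * r * a_inv"
    using lm r by (simp add: mult_left_mono)
  have "(\<Sum>k\<in>F i. (gap i X k)\<^sup>2) \<le> real (card (F i))"
    using sum_mono[of "F i" "\<lambda>k. (gap i X k)\<^sup>2" "\<lambda>_. 1"] gap_square_le_1 by simp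
  also have "\<dots> \<le> kappa" by (rule kappa_card)
  finally have "r * (lam i * (\<Sum>k\<in>F i. (gap i X k)\<^sup>2)) \<le> r * (lam i * kappa)"
    using r lm by (intro mult_left_mono) auto
  with 1 have "type_drift r (lyapunov r) i X \<le> - (r * (lam i * (\<Sum>k\<in>F i. (gap i X k)\<^sup>2))) + lam i * (a_inv + kappa) * r"
    by (simp add: algebra_simps)
  also have "lam i * (a_inv + kappa) * r \<le> lam i * (a_inv + kappa) * ((1 + log_range X) * (1 + V r X))"
  proof (rule mult_left_mono)
    have "r \<le> 1 * (1 + V r X)" using Z_deviation_le_V[of X r] Z by simp
    also have "\<dots> \<le> (1 + log_range X) * (1 + V r X)"
      using log_range_nonneg[of X] V_nonneg[of r X] by (intro mult_right_mono) auto
    finally show "r \<le> (1 + log_range X) * (1 + V r X)" .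
  qed (use lm k0 in auto)
  finally show ?thesis by simp
qed

lemma drift_bound:
  assumes r: "r \<ge> 1"
  shows "drift r (lyapunov r) X \<le> - (r * imbalance X) + drift_const * ((1 + log_range X) * (1 + V r X))"
proof -
  define G where "G = (1 + log_range X) * (1 + V r X)"
  have G: "G \<ge> 0" using log_range_nonneg[of X] V_nonneg[of r X] by (simp add: G_def)
  have k0: "kappa \<ge> 1" "a_inv \<ge> 0" using kappa_ge_1 a_inv by auto
  have "drift r (lyapunov r) X = (\<Sum>i\<in>UNIV. type_drift r (lyapunov r) i X)"
    by (simp add: drift_def)
  also have "\<dots> \<le> (\<Sum>i\<in>UNIV. - (r * (lam i * (\<Sum>k\<in>F i. (gap i X k)\<^sup>2)))
    + (kappa * (lam i * kappa * a_inv + mu i * (2 * kappa + 1))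
     + kappa * (lam i * (3 * a_inv + 1) + mu i * (kappa + 1)) + lam i * (a_inv + kappa)) * G)"
  proof (rule sum_mono)
    fix i
    define c1 where "c1 = kappa * (lam i * kappa * a_inv + mu i * (2 * kappa + 1))
     + kappa * (lam i * (3 * a_inv + 1) + mu i * (kappa + 1))"
    define c2 where "c2 = lam i * (a_inv + kappa)"
    have c: "0 \<le> c1" "0 \<le> c2"
      using less_imp_le[OF lam_pos[of i]] less_imp_le[OF mu_pos[of i]] k0 by (auto simp: c1_def c2_def)
    have nn: "0 \<le> c1 * G" "0 \<le> c2 * G" using c G by auto
    show "type_drift r (lyapunov r) i X \<le> - (r * (lam i * (\<Sum>k\<in>F i. (gap i X k)\<^sup>2))) + (kappa * (lam i * kappa * a_inv + mu i * (2 * kappa + 1))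
     + kappa * (lam i * (3 * a_inv + 1) + mu i * (kappa + 1)) + lam i * (a_inv + kappa)) * G"
    proof (cases "Z X = 0")
      case True
      then show ?thesis using type_drift_bound_empty[OF r True, of i] nn
        unfolding c1_def[symmetric] c2_def[symmetric] G_def[symmetric] distrib_right[of c1 c2] by linarith
    next
      case False
      then have "Z X \<ge> 1" by simp
      from type_drift_bound_nonempty[OF r this, of i] nn show ?thesis
        unfolding c1_def[symmetric] c2_def[symmetric] G_def[symmetric] distrib_right[of c1 c2] by linarith
    qed
  qed
  also have "\<dots> = - (r * imbalance X) + drift_const * G"
    by (simp add: sum_subtractf sum.distrib imbalance_def drift_const_def sum_distrib_right[symmetric] sum_distrib_left[symmetric] sum_negf)
  finally show ?thesis by (simp add: G_def)
qed

lemma drift_const_nonneg: "drift_const \<ge> 0"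
  unfolding drift_const_def
  using less_imp_le[OF lam_pos] less_imp_le[OF mu_pos] kappa_ge_1 a_inv(2) by (intro sum_nonneg) auto

definition rate_const :: real where
  "rate_const = drift_const * ((4 + ln (a_sum + kappa + 2)) * (1 + real CARD('i)))"

text \<open>
  Estimating the logarithm at scale \<open>r\<close> leaves \<open>ln r\<close> and a term linear in \<open>V / r\<close>, so that first and
  second moments of \<open>V\<close> suffice for the mean error.
\<close>

lemma log_range_le:
  assumes r: "r \<ge> 1"
  shows "1 + log_range X \<le> (2 + ln (a_sum + kappa + 2) + ln r) + V r X / r"
proof -
  have c: "a_sum + kappa + 2 > 0" using a_sum(2) kappa_ge_1 by linarith
  have "ln (1 + real (Z X)) = ln r + ln ((1 + real (Z X)) / r)"
    using r by (simp add: ln_div)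
  also have "ln ((1 + real (Z X)) / r) \<le> (1 + real (Z X)) / r - 1"
    using r by (intro ln_le_minus_one) auto
  also have "\<dots> \<le> 1 + V r X / r"
  proof -
    have "(1 + real (Z X)) / r \<le> (2 * r + V r X) / r"
      using Z_deviation_le_V[of X r] r by (intro divide_right_mono) linarith+
    then show ?thesis using r by (simp add: add_divide_distrib)
  qed
  finally show ?thesis using c by (simp add: log_range_def ln_mult)
qed

end

context stationary_grand
begin

lemma imbalance_integrable: "integrable (measure_pmf p) imbalance"
  by (rule measure_pmf.integrable_const_bound[where B="\<Sum>i\<in>UNIV. lam i * real (card (F i))"])
     (use imbalance_le imbalance_nonneg in auto)

text \<open>
  Take expectations in \<open>drift_bound\<close>: the left side vanishes, the main term is \<open>r * E imbalance\<close>, and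
  the mean error is of order \<open>sqrt r * ln r\<close>.
\<close>

theorem imbalance_mean: "E imbalance \<le> rate_const * ((1 + ln r) / sqrt r)"
proof -
  define n where "n = real CARD('i)"
  define b where "b = ln (a_sum + kappa + 2)"
  have n: "n \<ge> 1" by (simp add: n_def Suc_leI)
  have b: "b \<ge> 0" unfolding b_def using a_sum(2) kappa_ge_1 by (intro ln_ge_zero) auto
  have lnr: "ln r \<ge> 0" using r_ge_1 by simp
  have sq: "sqrt r \<ge> 1" using r_ge_1 by simp
  have i1: "integrable (measure_pmf p) (drift r (lyapunov r))" "E (drift r (lyapunov r)) = 0"
    by (rule drift_zero_polynomial[OF lyapunov_bound])+
  note i2 = imbalance_integrable
  have le: "drift r (lyapunov r) X \<le> - (r * imbalance X) + drift_const * ((2 + b + ln r) * (1 + V r X)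
     + (V r X / r + (V r X)\<^sup>2 / r))" for X
  proof -
    have "(1 + log_range X) * (1 + V r X) \<le> ((2 + b + ln r) + V r X / r) * (1 + V r X)"
      using log_range_le[OF r_ge_1, of X] V_nonneg[of r X] unfolding b_def by (intro mult_right_mono) auto
    also have "\<dots> = (2 + b + ln r) * (1 + V r X) + (V r X / r + (V r X)\<^sup>2 / r)"
      by (simp add: algebra_simps power2_eq_square add_divide_distrib)
    finally have "drift_const * ((1 + log_range X) * (1 + V r X)) \<le> drift_const * ((2 + b + ln r) * (1 + V r X)
       + (V r X / r + (V r X)\<^sup>2 / r))" by (rule mult_left_mono) (rule drift_const_nonneg)
    then show ?thesis using drift_bound[OF r_ge_1, of X] by linarith
  qed
  have "E (drift r (lyapunov r)) \<le> E (\<lambda>X. - (r * imbalance X) + drift_const * ((2 + b + ln r) * (1 + V r X)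
     + (V r X / r + (V r X)\<^sup>2 / r)))"
    by (rule integral_mono) (use i1 i2 V_integrable V_square le in auto)
  also have "\<dots> = - (r * E imbalance) + drift_const * ((2 + b + ln r) * (1 + E (V r))
     + (E (V r) / r + E (\<lambda>X. (V r X)\<^sup>2) / r))"
    using i2 V_integrable V_square(1) by simp
  finally have "r * E imbalance \<le> drift_const * ((2 + b + ln r) * (1 + E (V r))
     + (E (V r) / r + E (\<lambda>X. (V r X)\<^sup>2) / r))" by (simp add: i1)
  also have "\<dots> \<le> drift_const * ((4 + b) * (1 + n) * ((1 + ln r) * sqrt r))"
  proof (rule mult_left_mono[OF _ drift_const_nonneg])
    have v1: "1 + E (V r) \<le> (1 + n) * sqrt r" using V_mean sq unfolding n_def distrib_right by linarith
    have "E (V r) / r \<le> n * sqrt r / r"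
      using V_mean r_pos by (intro divide_right_mono) (auto simp: n_def)
    also have "\<dots> \<le> n * sqrt r" using r_ge_1 n by (simp add: divide_le_eq mult_left_mono)
    finally have v2: "E (V r) / r \<le> n * sqrt r" .
    have "E (\<lambda>X. (V r X)\<^sup>2) / r \<le> n" using V_square(2) r_pos by (simp add: pos_divide_le_eq n_def)
    also have "n * 1 \<le> n * sqrt r" using n sq by (intro mult_left_mono) auto
    finally have v3: "E (\<lambda>X. (V r X)\<^sup>2) / r \<le> n * sqrt r" by simp
    have v23: "E (V r) / r + E (\<lambda>X. (V r X)\<^sup>2) / r \<le> 2 * ((1 + n) * sqrt r)"
      by (rule order.trans[OF add_mono[OF v2 v3]]) (use sq in \<open>simp add: algebra_simps\<close>)
    have "(2 + b + ln r) * (1 + E (V r)) \<le> (2 + b + ln r) * ((1 + n) * sqrt r)"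
      using v1 b lnr by (intro mult_left_mono) auto
    then have "(2 + b + ln r) * (1 + E (V r)) + (E (V r) / r + E (\<lambda>X. (V r X)\<^sup>2) / r)
      \<le> (2 + b + ln r) * ((1 + n) * sqrt r) + 2 * ((1 + n) * sqrt r)"
      using v23 by (rule add_mono)
    also have "\<dots> = (4 + b + ln r) * ((1 + n) * sqrt r)" by (simp add: algebra_simps)
    also have "\<dots> \<le> ((4 + b) * (1 + ln r)) * ((1 + n) * sqrt r)"
    proof (rule mult_right_mono)
      have "1 * ln r \<le> (4 + b) * ln r" using b lnr by (intro mult_right_mono) auto
      then show "4 + b + ln r \<le> (4 + b) * (1 + ln r)" by (simp add: algebra_simps)
    qed (use n sq in auto)
    finally show "(2 + b + ln r) * (1 + E (V r)) + (E (V r) / r + E (\<lambda>X. (V r X)\<^sup>2) / r)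
      \<le> (4 + b) * (1 + n) * ((1 + ln r) * sqrt r)" by (simp add: mult_ac)
  qed
  also have "\<dots> = rate_const * ((1 + ln r) * sqrt r)" by (simp add: rate_const_def b_def n_def)
  finally have "E imbalance \<le> rate_const * ((1 + ln r) * sqrt r) / r"
    using r_pos by (simp add: pos_le_divide_eq mult.commute)
  also have "\<dots> = rate_const * ((1 + ln r) * (sqrt r / r))" by simp
  also have "\<dots> = rate_const * ((1 + ln r) / sqrt r)"
  proof -
    have "sqrt r / r = 1 / sqrt r" using r_pos by (simp add: sqrt_divide_self_eq inverse_eq_divide)
    then show ?thesis by simp
  qed
  finally show ?thesis .
qed

end

section \<open>Zero defect characterises the minimizer\<close>

text \<open>
  Strict convexity of \<open>v * ln (v * b / e)\<close>, whose derivative at \<open>u\<close> is \<open>ln (u * b)\<close>; the boundary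
  point \<open>v = 0\<close> is included.
\<close>

lemma entropy_tangent_less:
  fixes u v b :: real
  assumes u: "u > 0" and v: "v \<ge> 0" and b: "b > 0" and neq: "v \<noteq> u"
  shows "(v - u) * ln (u * b) < v * ln (v * b / exp 1) - u * ln (u * b / exp 1)"
proof (cases "v = 0")
  case True
  then show ?thesis using u b by (simp add: ln_div algebra_simps)
next
  case False
  then have v: "v > 0" using v by simp
  have "ln (u / v) \<le> u / v - 1" using u v by (intro ln_le_minus_one) auto
  moreover have "ln (u / v) \<noteq> u / v - 1" using ln_eq_minus_one[of "u / v"] u v neq by auto
  ultimately have "ln (u / v) < u / v - 1" by simp
  then have "v * ln (u / v) < v * (u / v - 1)" using v by (intro mult_strict_left_mono) auto
  also have "\<dots> = u - v" using v by (simp add: field_simps)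
  finally have "v * ln u - v * ln v < u - v" using u v by (simp add: ln_div algebra_simps)
  then show ?thesis using u v b by (simp add: ln_div ln_mult algebra_simps)
qed

context grand_system
begin

definition avail_frac :: "(('i, 's) config \<Rightarrow> real) \<Rightarrow> ('i, 's) config \<Rightarrow> real" where
  "avail_frac x k = (if k \<in> N then x k else a (snd k))"

text \<open>
  The violation of the load constraints and of edge balance at the fluid scale. Denominators are
  multiplied out to make the function continuous everywhere.
\<close>

definition defect :: "(('i, 's) config \<Rightarrow> real) \<Rightarrow> real" where
  "defect x = (\<Sum>i\<in>UNIV. \<bar>(\<Sum>k\<in>N. real (fst k i) * x k) - rho i\<bar>) +
     (\<Sum>i\<in>UNIV. \<Sum>k\<in>F i. (real (fst k i + 1) * x (add_customer i k) * (\<Sum>l\<in>F i. avail_frac x l)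
        - rho i * avail_frac x k)\<^sup>2)"

text \<open>
  The bound 2 leaves room for fluctuations of the total load around 1.
\<close>

definition box :: "(('i, 's) config \<Rightarrow> real) set" where
  "box = PiE UNIV (\<lambda>k. if k \<in> N then {0..2} else {0})"

lemma box_iff: "x \<in> box \<longleftrightarrow> (\<forall>k\<in>N. 0 \<le> x k \<and> x k \<le> 2) \<and> (\<forall>k. k \<notin> N \<longrightarrow> x k = 0)"
  unfolding box_def by (auto simp: PiE_iff split: if_splits)

lemma compact_box: "compact box"
proof -
  have "compactin (product_topology (\<lambda>_. euclidean) UNIV) box"
    unfolding box_def compactin_PiE by auto
  then show ?thesis by (simp add: euclidean_product_topology)
qed

lemma continuous_defect: "continuous_on A defect"
proof -
  have [continuous_intros]: "continuous_on A (\<lambda>x :: ('i, 's) config \<Rightarrow> real. x k)" for k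
    by (rule continuous_on_subset[OF continuous_on_product_coordinates]) auto
  have [continuous_intros]: "continuous_on A (\<lambda>x. avail_frac x k)" for k
    unfolding avail_frac_def by (cases "k \<in> N") (auto intro!: continuous_intros)
  show ?thesis unfolding defect_def[abs_def] by (intro continuous_intros)
qed

lemma defect_nonneg: "defect x \<ge> 0"
  unfolding defect_def by (intro add_nonneg_nonneg sum_nonneg) auto

lemma L_fun_eq: "L_fun C a x = (\<Sum>k\<in>N. x k * ln (x k * (config_fact k / a (snd k)) / exp 1))"
proof -
  have "L_fun C a x = (\<Sum>s\<in>UNIV. \<Sum>k | k \<in> N \<and> snd k = s. x k * ln (x k * (config_fact k / a (snd k)) / exp 1))"
    unfolding L_fun_def config_fact_def by (intro sum.cong) (auto simp: mult.commute)
  also have "\<dots> = (\<Sum>k\<in>N. x k * ln (x k * (config_fact k / a (snd k)) / exp 1))"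
    by (rule sum.group) auto
  finally show ?thesis .
qed

text \<open>
  Edge balance determines \<open>x\<close> recursively from the zero configurations, which gives the product form
  \<open>a (snd k) * (\<Prod>i. w i ^ k i / fact (k i))\<close> with \<open>w i = rho i / \<tau> i\<close>. In particular \<open>x\<close> is positive and
  the derivative of \<open>L_fun\<close> in direction \<open>k\<close> is \<open>\<Sum>i. k i * ln (w i)\<close>. The tangent to \<open>L_fun\<close> at \<open>x\<close>
  is therefore constant on the feasible set, and \<open>L_fun\<close> lies strictly above it.
\<close>

lemma zero_defect_strict_min:
  assumes x: "x \<in> box" and H: "defect x = 0"
  shows "x \<in> feasible_set C rho"
    and "\<And>y. y \<in> feasible_set C rho \<Longrightarrow> y \<noteq> x \<Longrightarrow> L_fun C a x < L_fun C a y"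
proof -
  define z where "z = avail_frac x"
  define \<tau> where "\<tau> i = (\<Sum>k\<in>F i. z k)" for i
  define w where "w i = rho i / \<tau> i" for i
  have nn1: "0 \<le> (\<Sum>i\<in>UNIV. \<bar>(\<Sum>k\<in>N. real (fst k i) * x k) - rho i\<bar>)" by (intro sum_nonneg) auto
  have nn2: "0 \<le> (\<Sum>i\<in>UNIV. \<Sum>k\<in>F i. (real (fst k i + 1) * x (add_customer i k) * \<tau> i - rho i * z k)\<^sup>2)"
    by (intro sum_nonneg) auto
  have z0: "(\<Sum>i\<in>UNIV. \<bar>(\<Sum>k\<in>N. real (fst k i) * x k) - rho i\<bar>) = 0"
    "(\<Sum>i\<in>UNIV. \<Sum>k\<in>F i. (real (fst k i + 1) * x (add_customer i k) * \<tau> i - rho i * z k)\<^sup>2) = 0"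
    using H nn1 nn2 unfolding defect_def \<tau>_def z_def by linarith+
  have load: "(\<Sum>k\<in>N. real (fst k i) * x k) = rho i" for i
    using z0(1) by (subst (asm) sum_nonneg_eq_0_iff) auto
  have bal: "real (fst k i + 1) * x (add_customer i k) * \<tau> i = rho i * z k" if "k \<in> F i" for i k
  proof -
    have "(\<Sum>k\<in>F i. (real (fst k i + 1) * x (add_customer i k) * \<tau> i - rho i * z k)\<^sup>2) = 0"
      using z0(2) by (subst (asm) sum_nonneg_eq_0_iff) (auto intro!: sum_nonneg)
    then show ?thesis using that by (subst (asm) sum_nonneg_eq_0_iff) auto
  qed
  have xnn: "0 \<le> x k" for k using x unfolding box_iff by (metis order_refl)
  show feas: "x \<in> feasible_set C rho"
    using x load by (auto simp: feasible_set_def box_iff)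
  have znn: "0 \<le> z k" for k using xnn less_imp_le[OF a_pos] by (simp add: z_def avail_frac_def)
  have \<tau>: "\<tau> i > 0" for i
  proof -
    have "0 < z ((\<lambda>_. 0), s0 i)" using a_pos by (simp add: z_def avail_frac_def)
    also have "\<dots> \<le> \<tau> i" unfolding \<tau>_def by (rule member_le_sum[OF zero_in_F]) (use znn in auto)
    finally show ?thesis .
  qed
  have w: "w i > 0" for i using \<tau>[of i] lam_pos[of i] mu_pos[of i] by (simp add: w_def rho_eq)
  have prod_form: "z k * config_fact k = a (snd k) * (\<Prod>i\<in>UNIV. w i ^ fst k i)" if "k \<in> C" for k
    using that
  proof (induction "\<Sum>i\<in>UNIV. fst k i" arbitrary: k)
    case 0
    then have "fst k = (\<lambda>_. 0)" by auto
    then show ?case by (simp add: z_def avail_frac_def config_fact_zero)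
  next
    case (Suc n)
    then obtain i where i: "fst k i \<noteq> 0" by (metis nat.distinct(1) sum.neutral)
    define l where "l = remove_customer i k"
    have kl: "k = add_customer i l" unfolding l_def using i by (simp add: add_remove)
    have lC: "l \<in> C" unfolding l_def using Suc.prems by (rule remove_in_C)
    have kN: "k \<in> N" using Suc.prems i by (auto simp: in_N_iff)
    have lF: "l \<in> F i" using lC kN by (simp add: fitting_configs_def kl)
    have "(\<Sum>j\<in>UNIV. fst k j) = (\<Sum>j\<in>UNIV. fst l j) + 1"
      unfolding kl by (simp add: sum.distrib)
    then have IH: "z l * config_fact l = a (snd l) * (\<Prod>i\<in>UNIV. w i ^ fst l i)"
      using Suc.hyps lC by auto
    have "z k * config_fact k = (real (fst l i + 1) * x (add_customer i l) * \<tau> i) * config_fact l / \<tau> i"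
      using kN \<tau>[of i] by (simp add: z_def avail_frac_def kl config_fact_add)
    also have "\<dots> = w i * (z l * config_fact l)" unfolding bal[OF lF] by (simp add: w_def)
    also have "\<dots> = a (snd k) * (w i * (\<Prod>i\<in>UNIV. w i ^ fst l i))" unfolding IH by (simp add: kl)
    also have "w i * (\<Prod>j\<in>UNIV. w j ^ fst l j) = (\<Prod>j\<in>UNIV. (if j = i then w i else 1) * w j ^ fst l j)"
      by (simp add: prod.distrib)
    also have "\<dots> = (\<Prod>j\<in>UNIV. w j ^ fst k j)" by (rule prod.cong) (auto simp: kl)
    finally show ?case .
  qed
  have xw: "x k * (config_fact k / a (snd k)) = (\<Prod>i\<in>UNIV. w i ^ fst k i)" if "k \<in> N" for k
    using prod_form[of k] that N_subset_C a_pos[of "snd k"] by (auto simp: z_def avail_frac_def field_simps)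
  have xpos: "x k > 0" if "k \<in> N" for k
  proof -
    have "0 < x k * (config_fact k / a (snd k))" unfolding xw[OF that] using w by (intro prod_pos) auto
    then show ?thesis using config_fact_pos[of k] a_pos[of "snd k"] by (simp add: zero_less_mult_iff zero_less_divide_iff)
  qed
  have lnx: "ln (x k * (config_fact k / a (snd k))) = (\<Sum>i\<in>UNIV. real (fst k i) * ln (w i))" if "k \<in> N" for k
    unfolding xw[OF that] using w less_imp_neq[OF w]
    by (subst ln_prod) (auto simp: ln_realpow)
  fix y assume y: "y \<in> feasible_set C rho" "y \<noteq> x"
  have tangent: "(y k - x k) * ln (x k * (config_fact k / a (snd k))) < y k * ln (y k * (config_fact k / a (snd k)) / exp 1)
      - x k * ln (x k * (config_fact k / a (snd k)) / exp 1)" if "k \<in> N" "y k \<noteq> x k" for k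
    by (rule entropy_tangent_less)
       (use that xpos y(1) config_fact_pos[of k] a_pos[of "snd k"] in \<open>auto simp: feasible_set_def\<close>)
  have "0 = (\<Sum>i\<in>UNIV. ln (w i) * ((\<Sum>k\<in>N. real (fst k i) * y k) - (\<Sum>k\<in>N. real (fst k i) * x k)))"
    using y(1) by (simp add: load feasible_set_def)
  also have "\<dots> = (\<Sum>i\<in>UNIV. \<Sum>k\<in>N. (y k - x k) * (real (fst k i) * ln (w i)))"
    unfolding sum_subtractf[symmetric] sum_distrib_left by (intro sum.cong refl) (simp add: algebra_simps)
  also have "\<dots> = (\<Sum>k\<in>N. (y k - x k) * ln (x k * (config_fact k / a (snd k))))"
    by (subst sum.swap) (intro sum.cong refl, simp only: lnx sum_distrib_left)
  also have "\<dots> < (\<Sum>k\<in>N. y k * ln (y k * (config_fact k / a (snd k)) / exp 1)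
      - x k * ln (x k * (config_fact k / a (snd k)) / exp 1))"
  proof (rule sum_strict_mono_ex1)
    show "\<forall>k\<in>N. (y k - x k) * ln (x k * (config_fact k / a (snd k))) \<le> y k * ln (y k * (config_fact k / a (snd k)) / exp 1)
      - x k * ln (x k * (config_fact k / a (snd k)) / exp 1)"
      using tangent by (metis (no_types, lifting) diff_self less_imp_le mult_zero_left order_refl)
    obtain k where "y k \<noteq> x k" using y(2) by (meson ext)
    moreover from this have "k \<in> N"
      using y(1) x unfolding feasible_set_def box_iff mem_Collect_eq by metis
    ultimately show "\<exists>k\<in>N. (y k - x k) * ln (x k * (config_fact k / a (snd k))) < y k * ln (y k * (config_fact k / a (snd k)) / exp 1)
      - x k * ln (x k * (config_fact k / a (snd k)) / exp 1)" using tangent by blast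
  qed simp
  finally show "L_fun C a x < L_fun C a y" by (simp add: L_fun_eq sum_subtractf)
qed

end

section \<open>The defect of a scaled state\<close>

context grand_system
begin

definition fluid :: "real \<Rightarrow> ('i, 's) state \<Rightarrow> ('i, 's) config \<Rightarrow> real" where
  "fluid r X k = real (X k) / r"

text \<open>
  A random upper bound, up to a constant, for the defect of the scaled state; its mean tends to zero.
\<close>

definition slack :: "real \<Rightarrow> ('i, 's) state \<Rightarrow> real" where
  "slack r X = imbalance X + V r X / r + 1 / r"

definition size_const :: real where
  "size_const = 10 * (kappa * (a_sum + 2)) + 10"

text \<open>
  The scaled weights differ from their fluid counterparts by multiples of \<open>V / r + 1 / r\<close>, and the edge
  equation for the weights themselves holds up to \<open>gap\<close>. Everything involved is bounded by
  \<open>size_const\<close> as long as \<open>V r X \<le> r\<close>.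
\<close>

lemma edge_defect_bound:
  assumes r: "r \<ge> 1" and V: "V r X \<le> r" and k: "k \<in> F i"
  defines "x \<equiv> fluid r X"
  defines "e \<equiv> V r X / r + 1 / r"
  shows "(real (fst k i + 1) * x (add_customer i k) * (\<Sum>l\<in>F i. avail_frac x l) - rho i * avail_frac x k)\<^sup>2
     \<le> 2 * size_const ^ 4 * (gap i X k)\<^sup>2 + 64 * size_const ^ 4 * e"
proof -
  define c1 where "c1 = a_sum + 2"
  define P where "P = kappa * c1"
  have k1: "kappa \<ge> 1" "c1 \<ge> 2" using kappa_ge_1 a_sum(2) by (auto simp: c1_def)
  have P: "P \<ge> kappa" "P \<ge> c1"
    using mult_left_mono[of 1 c1 kappa] mult_right_mono[of 1 kappa c1] k1 by (auto simp: P_def)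
  define D where "D = size_const"
  have D: "D = 10 * P + 10" by (simp add: D_def size_const_def P_def c1_def)
  have V0: "V r X \<ge> 0" by (rule V_nonneg)
  have e: "0 \<le> e" "e \<le> 2" "1 / r \<le> e" "V r X / r \<le> e"
    using r V V0 by (auto simp: e_def field_simps)
  define arr' where "arr' = (\<lambda>l. arr X l / r)"
  define \<beta> where "\<beta> = real (fst k i + 1) * x (add_customer i k)"
  define b where "b = dep i X k / r"
  define t where "t = (\<Sum>l\<in>F i. arr' l)"
  define \<tau> where "\<tau> = (\<Sum>l\<in>F i. avail_frac x l)"
  define y where "y = sum (dep i X) (F i) / r"
  define m where "m = (\<Sum>k\<in>F i. real (fst k i + 1))"
  have m: "0 \<le> m" "m \<le> kappa" unfolding m_def using kappa_sum by (auto intro!: sum_nonneg)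
  have sdep: "sum (dep i X) (F i) = real (Y i X) + m"
    unfolding m_def dep_eq sum.distrib Y_eq_sum_departures ..
  have scale: "q * (1 / r) \<le> q * e" if "q \<ge> 0" for q using e(3) that by (rule mult_left_mono)
  have "\<bar>b - \<beta>\<bar> = real (fst k i + 1) * (1 / r)"
    using r unfolding b_def \<beta>_def x_def fluid_def dep_eq by (simp add: add_divide_distrib del: of_nat_add)
  also have "\<dots> \<le> kappa * e" using kappa_mult[OF k] e r k1 by (intro mult_mono) auto
  also have "\<dots> \<le> D * e" using e P k1 unfolding D by (intro mult_right_mono) auto
  finally have d1: "\<bar>b - \<beta>\<bar> \<le> D * e" .
  have Zr: "\<bar>real (Z X) / r - 1\<bar> \<le> V r X / r"
  proof -
    have "real (Z X) / r - 1 = (real (Z X) - r) / r" using r by (simp add: diff_divide_distrib)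
    also have "\<bar>\<dots>\<bar> = \<bar>real (Z X) - r\<bar> / r" using r by (simp add: abs_divide)
    also have "\<dots> \<le> V r X / r" using Z_deviation_le_V[of X r] r by (intro divide_right_mono) auto
    finally show ?thesis .
  qed
  have Z2: "real (Z X) / r \<le> 2"
    using Z_deviation_le_V[of X r] V r by (simp add: pos_divide_le_eq)
  have dl: "\<bar>arr' l - avail_frac x l\<bar> \<le> c1 * e" if l: "l \<in> F i" for l
  proof (cases "l \<in> N")
    case True
    then have "\<bar>arr' l - avail_frac x l\<bar> = 1 * (1 / r)"
      using r by (simp add: arr'_def avail_frac_def arr_def servers_nonzero x_def fluid_def add_divide_distrib)
    also have "\<dots> \<le> c1 * e" using e r k1 by (intro mult_mono) auto
    finally show ?thesis .
  next
    case False
    let ?a = "a (snd l)"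
    define s where "s = arr X l - ?a * real (Z X)"
    have s: "0 \<le> s" "s \<le> 2" using servers_zero_bounds[OF l False, of X] by (auto simp: s_def arr_def)
    have "arr' l - avail_frac x l = ?a * (real (Z X) / r - 1) + s * (1 / r)"
      using False r by (simp add: arr'_def avail_frac_def s_def field_simps)
    also have "\<bar>\<dots>\<bar> \<le> \<bar>?a * (real (Z X) / r - 1)\<bar> + \<bar>s * (1 / r)\<bar>" by (rule abs_triangle_ineq)
    also have "\<dots> \<le> a_sum * e + 2 * e"
    proof (rule add_mono)
      have "\<bar>?a * (real (Z X) / r - 1)\<bar> = ?a * \<bar>real (Z X) / r - 1\<bar>"
        using a_pos[of "snd l"] by (simp add: abs_mult)
      also have "\<dots> \<le> a_sum * e" using a_sum Zr e less_imp_le[OF a_pos, of "snd l"] by (intro mult_mono) auto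
      finally show "\<bar>?a * (real (Z X) / r - 1)\<bar> \<le> a_sum * e" .
      have "\<bar>s * (1 / r)\<bar> = s * (1 / r)" using s r by simp
      also have "\<dots> \<le> 2 * e" using s e r by (intro mult_mono) auto
      finally show "\<bar>s * (1 / r)\<bar> \<le> 2 * e" .
    qed
    finally show ?thesis by (simp add: c1_def distrib_right)
  qed
  have "\<bar>t - \<tau>\<bar> \<le> (\<Sum>l\<in>F i. \<bar>arr' l - avail_frac x l\<bar>)"
    unfolding t_def \<tau>_def sum_subtractf[symmetric] by (rule sum_abs)
  also have "\<dots> \<le> (\<Sum>l\<in>F i. c1 * e)" by (intro sum_mono dl)
  also have "\<dots> = real (card (F i)) * (c1 * e)" by simp
  also have "\<dots> \<le> kappa * (c1 * e)" using kappa_card k1 e by (intro mult_right_mono) auto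
  also have "\<dots> = P * e" by (simp add: P_def)
  also have "\<dots> \<le> D * e" using e P k1 unfolding D by (intro mult_right_mono) auto
  finally have d2: "\<bar>t - \<tau>\<bar> \<le> D * e" .
  have d3: "\<bar>arr' k - avail_frac x k\<bar> \<le> D * e"
    using dl[OF k] mult_right_mono[of c1 D e] e P k1 unfolding D by simp
  have d4: "\<bar>y - rho i\<bar> \<le> (1 + kappa) * e"
  proof -
    have "y - rho i = (real (Y i X) - rho i * r + m) / r"
      using r unfolding y_def sdep by (simp add: field_simps)
    also have "\<bar>\<dots>\<bar> = \<bar>real (Y i X) - rho i * r + m\<bar> / r" using r by (simp add: abs_divide)
    also have "\<dots> \<le> (V r X + kappa) / r"
    proof (rule divide_right_mono)
      show "\<bar>real (Y i X) - rho i * r + m\<bar> \<le> V r X + kappa"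
        using Y_deviation_le_V[of i X r] abs_triangle_ineq[of "real (Y i X) - rho i * r" m] m by linarith
    qed (use r in simp)
    also have "\<dots> = V r X / r + kappa * (1 / r)" by (simp add: add_divide_distrib)
    also have "\<dots> \<le> e + kappa * e" using e scale[of kappa] k1 by (intro add_mono) auto
    finally show ?thesis by (simp add: distrib_right)
  qed
  then have d4': "\<bar>y - rho i\<bar> \<le> D * e"
    using mult_right_mono[of "1 + kappa" D e] e P k1 unfolding D by linarith
  have rho: "0 \<le> rho i" "rho i \<le> 1"
  proof -
    have "0 \<le> rho j" for j using less_imp_le[OF lam_pos[of j]] less_imp_le[OF mu_pos[of j]] by (simp add: rho_eq)
    then show "0 \<le> rho i" "rho i \<le> 1"
      using member_le_sum[of i UNIV rho] by (auto simp: rho_sum)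
  qed
  have B: "0 \<le> \<beta>" "\<beta> \<le> D"
  proof -
    have "\<beta> = real (fst k i + 1) * real (X (add_customer i k)) / r" by (simp add: \<beta>_def x_def fluid_def)
    also have "\<dots> \<le> real (Z X) / r" using departing_le_Z[OF k, of X] r by (intro divide_right_mono) auto
    also have "\<dots> \<le> D" using Z2 P k1 unfolding D by linarith
    finally show "\<beta> \<le> D" .
    show "0 \<le> \<beta>" using r by (simp add: \<beta>_def x_def fluid_def)
  qed
  have al: "0 \<le> arr' l" "arr' l \<le> 3 * c1" if l: "l \<in> F i" for l
  proof -
    show "0 \<le> arr' l" using r arr_pos[of X l] unfolding arr'_def by (intro divide_nonneg_nonneg) linarith+
    have "avail_frac x l \<le> c1"
    proof (cases "l \<in> N")
      case True
      have "real (X l) / r \<le> real (Z X) / r" using X_le_Z[OF True, of X] r by (intro divide_right_mono) auto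
      then show ?thesis using True Z2 a_sum(2) by (simp add: avail_frac_def x_def fluid_def c1_def)
    next
      case False
      then show ?thesis using a_sum(1)[of "snd l"] by (simp add: avail_frac_def c1_def)
    qed
    moreover have "c1 * e \<le> c1 * 2" using e k1 by (intro mult_left_mono) auto
    ultimately show "arr' l \<le> 3 * c1" using dl[OF l] by linarith
  qed
  have t: "0 \<le> t" "t \<le> D"
  proof -
    show "0 \<le> t" unfolding t_def using al by (intro sum_nonneg) auto
    have "t \<le> (\<Sum>l\<in>F i. 3 * c1)" unfolding t_def by (intro sum_mono al)
    also have "\<dots> = real (card (F i)) * (3 * c1)" by simp
    also have "\<dots> \<le> kappa * (3 * c1)" using kappa_card k1 by (intro mult_right_mono) auto
    also have "\<dots> = 3 * P" by (simp add: P_def)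
    also have "\<dots> \<le> D" using P k1 unfolding D by linarith
    finally show "t \<le> D" .
  qed
  have y: "0 \<le> y" "y \<le> D"
  proof -
    show "0 \<le> y" using r m unfolding y_def sdep by simp
    have "y - rho i \<le> (1 + kappa) * e" by (rule abs_le_D1[OF d4])
    also have "\<dots> \<le> (1 + kappa) * 2" using e k1 by (intro mult_left_mono) auto
    finally have "y \<le> 3 + 2 * kappa" using rho by simp
    then show "y \<le> D" using P k1 unfolding D by linarith
  qed
  have D1: "D \<ge> 1" using P k1 unfolding D by linarith
  have tpos: "t > 0" "y > 0"
  proof -
    have "arr' k > 0" using r arr_pos[of X k] unfolding arr'_def by (intro divide_pos_pos) linarith+
    moreover have "arr' k \<le> t" unfolding t_def by (rule member_le_sum[OF k]) (use al in auto)
    ultimately show "t > 0" by linarith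
    have "dep i X k \<le> sum (dep i X) (F i)"
      by (rule member_le_sum[OF k]) (use order.trans[OF zero_le_one dep_pos] in auto)
    then have "0 < sum (dep i X) (F i)" using dep_pos[of i X k] by linarith
    then show "y > 0" using r by (simp add: y_def)
  qed
  have gap: "gap i X k = arr' k / t - b / y"
  proof -
    have "t = sum (arr X) (F i) / r" by (simp add: t_def arr'_def sum_divide_distrib)
    then show ?thesis using r by (simp add: gap_def arr'_def b_def y_def)
  qed
  \<comment> \<open>\<open>u\<close> is the gap term, \<open>v\<close> collects the errors of passing from weights to fluid quantities\<close>
  define u where "u = - (y * t * gap i X k)"
  define v where "v = (\<beta> * (\<tau> - t) + t * (\<beta> - b)) + (rho i * (arr' k - avail_frac x k) + arr' k * (y - rho i))"
  have "y * t * gap i X k = y * arr' k - t * b" using tpos unfolding gap by (simp add: field_simps)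
  then have uv: "\<beta> * \<tau> - rho i * avail_frac x k = u + v"
    unfolding u_def v_def by (simp add: algebra_simps)
  have prodb: "\<bar>p * q\<bar> \<le> D * (D * e)" if "0 \<le> p" "p \<le> D" "\<bar>q\<bar> \<le> D * e" for p q
    unfolding abs_mult using that by (intro mult_mono) auto
  have "\<bar>v\<bar> \<le> 4 * (D * (D * e))"
  proof -
    have "\<bar>\<beta> * (\<tau> - t)\<bar> \<le> D * (D * e)" by (rule prodb) (use B d2 in auto)
    moreover have "\<bar>t * (\<beta> - b)\<bar> \<le> D * (D * e)" by (rule prodb) (use t d1 in auto)
    moreover have "\<bar>rho i * (arr' k - avail_frac x k)\<bar> \<le> D * (D * e)"
      by (rule prodb) (use rho d3 D1 in auto)
    moreover have "\<bar>arr' k * (y - rho i)\<bar> \<le> D * (D * e)"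
    proof (rule prodb)
      show "arr' k \<le> D" using al(2)[OF k] P k1 unfolding D by linarith
    qed (use al[OF k] d4' in auto)
    ultimately show ?thesis unfolding v_def by linarith
  qed
  then have "v\<^sup>2 \<le> (4 * (D * (D * e)))\<^sup>2" using abs_le_square_iff by fastforce
  also have "\<dots> = 16 * D ^ 4 * (e * e)" by (simp add: power2_eq_square power4_eq_xxxx)
  also have "\<dots> \<le> 16 * D ^ 4 * (2 * e)" using e D1 by (intro mult_left_mono mult_right_mono) auto
  finally have v2: "v\<^sup>2 \<le> 32 * D ^ 4 * e" by simp
  have "u\<^sup>2 = (y * t)\<^sup>2 * (gap i X k)\<^sup>2" by (simp add: u_def power_mult_distrib)
  also have "\<dots> \<le> (D * D)\<^sup>2 * (gap i X k)\<^sup>2"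
    using y t by (intro mult_right_mono power_mono mult_mono) auto
  also have "(D * D)\<^sup>2 = D ^ 4" by (simp add: power2_eq_square power4_eq_xxxx)
  finally have u2: "u\<^sup>2 \<le> D ^ 4 * (gap i X k)\<^sup>2" .
  have "(u + v)\<^sup>2 \<le> 2 * u\<^sup>2 + 2 * v\<^sup>2"
    using zero_le_power2[of "u - v"] by (simp add: power2_sum power2_diff)
  also have "\<dots> \<le> 2 * D ^ 4 * (gap i X k)\<^sup>2 + 64 * D ^ 4 * e" using u2 v2 by linarith
  finally show ?thesis unfolding uv[symmetric] by (simp add: \<beta>_def \<tau>_def D_def)
qed

definition defect_const :: real where
  "defect_const = 1 + 2 * size_const ^ 4 * (\<Sum>i\<in>UNIV. 1 / lam i) + 64 * size_const ^ 4 * kappa"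

lemma defect_bound:
  assumes r: "r \<ge> 1" and V: "V r X \<le> r"
  shows "defect (fluid r X) \<le> defect_const * slack r X"
proof -
  define e where "e = V r X / r + 1 / r"
  define D where "D = size_const ^ 4"
  have D: "D \<ge> 0" by (simp add: D_def)
  have e: "e \<ge> 0" "V r X / r \<le> e" using r V_nonneg[of r X] by (auto simp: e_def)
  have "(\<Sum>i\<in>UNIV. \<bar>(\<Sum>k\<in>N. real (fst k i) * fluid r X k) - rho i\<bar>) = V r X / r"
  proof -
    have "\<bar>(\<Sum>k\<in>N. real (fst k i) * fluid r X k) - rho i\<bar> = \<bar>real (Y i X) - rho i * r\<bar> / r" for i
    proof -
      have "(\<Sum>k\<in>N. real (fst k i) * fluid r X k) - rho i = (real (Y i X) - rho i * r) / r"
        using r by (simp add: fluid_def Y_def sum_divide_distrib[symmetric] field_simps)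
      then show ?thesis using r by (simp add: abs_divide)
    qed
    then show ?thesis by (simp add: V_def sum_divide_distrib)
  qed
  then have "defect (fluid r X) \<le> V r X / r + (\<Sum>i\<in>UNIV. \<Sum>k\<in>F i. 2 * D * (gap i X k)\<^sup>2 + 64 * D * e)"
    unfolding defect_def D_def e_def
    by (intro add_mono sum_mono edge_defect_bound[OF r V]) auto
  also have "(\<Sum>i\<in>UNIV. \<Sum>k\<in>F i. 2 * D * (gap i X k)\<^sup>2 + 64 * D * e)
     = 2 * D * (\<Sum>i\<in>UNIV. \<Sum>k\<in>F i. (gap i X k)\<^sup>2) + 64 * D * e * (\<Sum>i\<in>UNIV. real (card (F i)))"
    by (simp add: sum.distrib sum_distrib_left sum_distrib_right mult_ac)
  also have "\<dots> \<le> 2 * D * ((\<Sum>i\<in>UNIV. 1 / lam i) * imbalance X) + 64 * D * e * kappa"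
  proof (intro add_mono mult_left_mono)
    have "(\<Sum>k\<in>F i. (gap i X k)\<^sup>2) \<le> 1 / lam i * imbalance X" for i
    proof -
      have "lam i * (\<Sum>k\<in>F i. (gap i X k)\<^sup>2) \<le> imbalance X"
        unfolding imbalance_def
        by (rule member_le_sum[of i UNIV "\<lambda>i. lam i * (\<Sum>k\<in>F i. (gap i X k)\<^sup>2)"])
           (use less_imp_le[OF lam_pos] in \<open>auto intro!: mult_nonneg_nonneg sum_nonneg\<close>)
      then show ?thesis using lam_pos[of i] by (simp add: pos_le_divide_eq mult.commute)
    qed
    then show "(\<Sum>i\<in>UNIV. \<Sum>k\<in>F i. (gap i X k)\<^sup>2) \<le> (\<Sum>i\<in>UNIV. 1 / lam i) * imbalance X"
      unfolding sum_distrib_right by (intro sum_mono)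
    show "(\<Sum>i\<in>UNIV. real (card (F i))) \<le> kappa"
      unfolding kappa_def
    proof (rule sum_mono)
      fix i show "real (card (F i)) \<le> (\<Sum>k\<in>F i. real (fst k i + 1))"
        using sum_mono[of "F i" "\<lambda>_. 1" "\<lambda>k. real (fst k i + 1)"] by simp
    qed
  qed (use D e in auto)
  finally have "defect (fluid r X) \<le> e + 2 * D * (\<Sum>i\<in>UNIV. 1 / lam i) * imbalance X + 64 * D * kappa * e"
    using e by (simp add: mult_ac)
  also have "\<dots> \<le> defect_const * (imbalance X + e)"
  proof -
    define s where "s = 2 * D * (\<Sum>i\<in>UNIV. 1 / lam i)"
    define q where "q = 64 * D * kappa"
    have "0 \<le> s" "0 \<le> q" using D kappa_ge_1 less_imp_le[OF lam_pos] by (auto simp: s_def q_def intro!: mult_nonneg_nonneg sum_nonneg)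
    then have "0 \<le> s * e" "0 \<le> q * imbalance X" using e imbalance_nonneg by auto
    moreover have "defect_const = 1 + s + q" by (simp add: defect_const_def D_def s_def q_def)
    ultimately show ?thesis
      using imbalance_nonneg[of X] unfolding s_def[symmetric] q_def[symmetric] by (simp add: algebra_simps)
  qed
  also have "imbalance X + e = slack r X" by (simp add: slack_def e_def)
  finally show ?thesis .
qed

lemma defect_const_pos: "defect_const > 0"
proof -
  have "0 \<le> 2 * size_const ^ 4 * (\<Sum>i\<in>UNIV. 1 / lam i)" "0 \<le> 64 * size_const ^ 4 * kappa"
    using kappa_ge_1 less_imp_le[OF lam_pos] by (auto intro!: mult_nonneg_nonneg sum_nonneg)
  then show ?thesis unfolding defect_const_def by linarith
qed

lemma slack_parts:
  assumes "r \<ge> 1"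
  shows "0 \<le> slack r X" "V r X / r \<le> slack r X"
  using assms imbalance_nonneg[of X] V_nonneg[of r X] by (auto simp: slack_def)

lemma small_slack:
  assumes r: "r \<ge> 1" and X: "X \<in> states C" and \<eta>: "\<eta> > 0"
    and small: "slack r X < min 1 (\<eta> / defect_const)"
  shows "fluid r X \<in> box" "defect (fluid r X) < \<eta>"
proof -
  have "V r X / r < 1" using slack_parts(2)[OF r, of X] small by simp
  then have V: "V r X \<le> r" using r by simp
  have Z2: "real (Z X) \<le> 2 * r" using Z_deviation_le_V[of X r] V by linarith
  show "fluid r X \<in> box"
    unfolding box_iff
  proof (intro conjI ballI allI impI)
    fix k assume k: "k \<in> N"
    show "0 \<le> fluid r X k" using r by (simp add: fluid_def)
    show "fluid r X k \<le> 2" using X_le_Z[OF k, of X] Z2 r by (simp add: fluid_def pos_divide_le_eq)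
  next
    fix k assume "k \<notin> N"
    then have "X k = 0" using X unfolding states_def by blast
    then show "fluid r X k = 0" by (simp add: fluid_def)
  qed
  have "defect (fluid r X) \<le> defect_const * slack r X" by (rule defect_bound[OF r V])
  also have "\<dots> < defect_const * (\<eta> / defect_const)"
    using small defect_const_pos by (intro mult_strict_left_mono) auto
  finally show "defect (fluid r X) < \<eta>" using defect_const_pos by simp
qed

end

section \<open>Convergence in distribution\<close>

context stationary_grand
begin

lemma slack_integrable: "integrable (measure_pmf p) (slack r)"
  unfolding slack_def[abs_def] using V_integrable imbalance_integrable by simp

lemma slack_mean:
  "E (slack r) \<le> rate_const * ((1 + ln r) / sqrt r) + real CARD('i) / sqrt r + 1 / r"
proof -
  have "E (slack r) = E imbalance + E (V r) / r + 1 / r"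
    unfolding slack_def[abs_def] using V_integrable imbalance_integrable by simp
  moreover have "E (V r) / r \<le> real CARD('i) / sqrt r"
  proof -
    have "E (V r) / r \<le> real CARD('i) * sqrt r / r" using V_mean r_pos by (intro divide_right_mono) auto
    also have "\<dots> = real CARD('i) * (sqrt r / r)" by simp
    also have "sqrt r / r = 1 / sqrt r" using r_pos by (simp add: sqrt_divide_self_eq inverse_eq_divide)
    finally show ?thesis by simp
  qed
  ultimately show ?thesis using imbalance_mean by linarith
qed

lemma support_in_states: "X \<in> set_pmf p \<Longrightarrow> X \<in> states C"
  using stat by (auto simp: stationary_distribution_def)

lemma exists_small_slack:
  assumes "E (slack r) < \<delta>"
  shows "\<exists>X\<in>states C. slack r X < \<delta>"
proof (rule ccontr)
  assume "\<not> ?thesis"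
  then have "AE X in measure_pmf p. \<delta> \<le> slack r X"
    using support_in_states by (auto simp: AE_measure_pmf_iff not_less)
  then have "E (\<lambda>_. \<delta>) \<le> E (slack r)" by (intro integral_mono_AE) (use slack_integrable in auto)
  then show False using assms by simp
qed

text \<open>
  Markov's inequality in the form: where the slack is not small, the difference of values of \<open>f\<close> is at
  most \<open>2 * M\<close>, hence at most \<open>2 * M / \<delta>\<close> times the slack.
\<close>

lemma expectation_near:
  fixes f :: "(('i, 's) config \<Rightarrow> real) \<Rightarrow> real"
  assumes M: "\<And>x. \<bar>f x\<bar> \<le> M" and \<delta>: "\<delta> > 0" and e: "\<epsilon> \<ge> 0"
    and near: "\<And>X. X \<in> states C \<Longrightarrow> slack r X < \<delta> \<Longrightarrow> \<bar>f (fluid r X) - f x\<bar> \<le> \<epsilon>"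
  shows "\<bar>E (\<lambda>X. f (fluid r X)) - f x\<bar> \<le> \<epsilon> + 2 * M / \<delta> * E (slack r)"
proof -
  have M0: "M \<ge> 0" using M[of x] by linarith
  have i: "integrable (measure_pmf p) (\<lambda>X. f (fluid r X))"
    by (rule measure_pmf.integrable_const_bound[where B=M]) (use M in auto)
  have "\<bar>E (\<lambda>X. f (fluid r X)) - f x\<bar> = \<bar>E (\<lambda>X. f (fluid r X) - f x)\<bar>" using i by simp
  also have "\<dots> \<le> E (\<lambda>X. \<bar>f (fluid r X) - f x\<bar>)" by (rule integral_abs_bound)
  also have "\<dots> \<le> E (\<lambda>X. \<epsilon> + 2 * M / \<delta> * slack r X)"
  proof (rule integral_mono_AE)
    show "AE X in measure_pmf p. \<bar>f (fluid r X) - f x\<bar> \<le> \<epsilon> + 2 * M / \<delta> * slack r X"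
      unfolding AE_measure_pmf_iff
    proof
      fix X assume "X \<in> set_pmf p"
      then have X: "X \<in> states C" by (rule support_in_states)
      have s0: "0 \<le> slack r X" by (rule slack_parts(1)[OF r_ge_1])
      show "\<bar>f (fluid r X) - f x\<bar> \<le> \<epsilon> + 2 * M / \<delta> * slack r X"
      proof (cases "slack r X < \<delta>")
        case True
        have "0 \<le> 2 * M / \<delta> * slack r X" using M0 \<delta> s0 by simp
        then show ?thesis using near[OF X True] by linarith
      next
        case False
        have "\<bar>f (fluid r X) - f x\<bar> \<le> 2 * M" using M[of "fluid r X"] M[of x] by linarith
        also have "\<dots> = 2 * M / \<delta> * \<delta>" using \<delta> by simp
        also have "\<dots> \<le> 2 * M / \<delta> * slack r X" using False M0 \<delta> by (intro mult_left_mono) auto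
        finally show ?thesis using e by linarith
      qed
    qed
  qed (use i slack_integrable in auto)
  also have "\<dots> = \<epsilon> + 2 * M / \<delta> * E (slack r)" using slack_integrable by simp
  finally show ?thesis .
qed

end

theorem theorem2:
  fixes C :: "('i::finite, 's::finite) config set"
    and a :: "'s \<Rightarrow> real" and s0 :: "'i \<Rightarrow> 's"
    and lam mu rho :: "'i \<Rightarrow> real"
    and r :: "nat \<Rightarrow> real"
    and p :: "nat \<Rightarrow> ('i, 's) state pmf"
  assumes "packing_constraints C"
    and "\<And>s. a s > 0"
    and "\<And>i. lam i > 0" and "\<And>i. mu i > 0"
    and "\<And>i. rho i = lam i / mu i" and "(\<Sum>i\<in>UNIV. rho i) = 1"
    and "\<And>i. (unit_vec i, s0 i) \<in> nonzero_configs C"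
    and "\<And>n. r n \<ge> 1" and "strict_mono r" and "filterlim r at_top sequentially"
    and "\<And>n. stationary_distribution (states C)
               (grand_rate C a s0 (\<lambda>i. lam i * r n) mu) (p n)"
  shows "(\<exists>!x. is_arg_min (L_fun C a) (\<lambda>y. y \<in> feasible_set C rho) x) \<and>
         converges_in_distribution (\<lambda>n. fluid_scaled (r n) (p n))
           (return_pmf (arg_min (L_fun C a) (\<lambda>y. y \<in> feasible_set C rho)))"
proof -
  interpret grand_system C a s0 lam mu rho
    by unfold_locales (use assms in auto)
  have st: "stationary_grand C a s0 lam mu rho (r n) (p n)" for n
    by unfold_locales (use assms in auto)
  define m where "m n = measure_pmf.expectation (p n) (slack (r n))" for n
  have m_lim: "m \<longlonglongrightarrow> 0"
  proof (rule tendsto_sandwich[OF _ _ tendsto_const])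
    show "\<forall>\<^sub>F n in sequentially. 0 \<le> m n"
      unfolding m_def using slack_parts(1) assms(8) by (intro always_eventually allI Bochner_Integration.integral_nonneg) auto
    show "\<forall>\<^sub>F n in sequentially. m n \<le> rate_const * ((1 + ln (r n)) / sqrt (r n)) + real CARD('i) / sqrt (r n) + 1 / r n"
      unfolding m_def using stationary_grand.slack_mean[OF st] by (intro always_eventually allI) auto
    have "((\<lambda>t::real. (1 + ln t) / sqrt t) \<longlongrightarrow> 0) at_top" by real_asymp
    moreover have "((\<lambda>t::real. real CARD('i) / sqrt t) \<longlongrightarrow> 0) at_top" by real_asymp
    moreover have "((\<lambda>t::real. 1 / t) \<longlongrightarrow> 0) at_top" by real_asymp
    ultimately have "((\<lambda>t::real. rate_const * ((1 + ln t) / sqrt t) + real CARD('i) / sqrt t + 1 / t)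
        \<longlongrightarrow> rate_const * 0 + 0 + 0) at_top"
      by (intro tendsto_intros)
    from filterlim_compose[OF this assms(10)]
    show "(\<lambda>n. rate_const * ((1 + ln (r n)) / sqrt (r n)) + real CARD('i) / sqrt (r n) + 1 / r n) \<longlonglongrightarrow> 0"
      by simp
  qed
  have small_state: "\<exists>X n. X \<in> states C \<and> slack (r n) X < \<delta>" if "\<delta> > 0" for \<delta>
  proof -
    have "\<forall>\<^sub>F n in sequentially. m n < \<delta>" using m_lim that by (rule order_tendstoD)
    then obtain n where "m n < \<delta>" by (meson eventually_happens sequentially_bot)
    then show ?thesis using stationary_grand.exists_small_slack[OF st] unfolding m_def by blast
  qed
  have "(\<lambda>_. 0) \<in> box" by (simp add: box_iff)
  then obtain x where x: "x \<in> box" "\<And>y. y \<in> box \<Longrightarrow> defect x \<le> defect y"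
    using continuous_attains_inf[OF compact_box _ continuous_defect] by blast
  \<comment> \<open>a positive infimum of the defect would keep the slack away from zero\<close>
  have x0: "defect x = 0"
  proof (rule ccontr)
    assume "defect x \<noteq> 0"
    then have pos: "defect x > 0" using defect_nonneg[of x] by simp
    then obtain X n where X: "X \<in> states C" "slack (r n) X < min 1 (defect x / defect_const)"
      using small_state[of "min 1 (defect x / defect_const)"] defect_const_pos by auto
    from small_slack[OF assms(8) X(1) pos X(2)] x(2) show False by force
  qed
  note min = zero_defect_strict_min[OF x(1) x0]
  have am: "is_arg_min (L_fun C a) (\<lambda>y. y \<in> feasible_set C rho) y \<longleftrightarrow> y = x" for y
    unfolding is_arg_min_def using min by (metis less_asym)
  have ex1: "\<exists>!x. is_arg_min (L_fun C a) (\<lambda>y. y \<in> feasible_set C rho) x" using am by simp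
  have arg: "arg_min (L_fun C a) (\<lambda>y. y \<in> feasible_set C rho) = x"
    unfolding arg_min_def am by simp
  have "converges_in_distribution (\<lambda>n. fluid_scaled (r n) (p n)) (return_pmf x)"
    unfolding converges_in_distribution_def
  proof (intro allI impI, elim conjE)
    fix f :: "(('i, 's) config \<Rightarrow> real) \<Rightarrow> real"
    assume f: "continuous_on UNIV f" and bd: "bounded (range f)"
    obtain M where M: "\<And>x. \<bar>f x\<bar> \<le> M" using bd unfolding bounded_iff by auto
    have ex: "measure_pmf.expectation (fluid_scaled (r n) (p n)) f
       = measure_pmf.expectation (p n) (\<lambda>X. f (fluid (r n) X))" for n
      by (simp add: fluid_scaled_def fluid_def[abs_def])
    have "(\<lambda>n. measure_pmf.expectation (p n) (\<lambda>X. f (fluid (r n) X))) \<longlonglongrightarrow> f x"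
    proof (rule tendstoI)
      fix \<epsilon> :: real assume \<epsilon>: "\<epsilon> > 0"
      define U where "U = {y. \<bar>f y - f x\<bar> < \<epsilon> / 2}"
      have "open U" unfolding U_def
        by (intro open_Collect_less continuous_intros continuous_on_subset[OF f]) auto
      then have cU: "compact (box - U)" by (rule compact_diff[OF compact_box])
      obtain \<eta> where \<eta>: "\<eta> > 0" "\<And>y. y \<in> box \<Longrightarrow> defect y < \<eta> \<Longrightarrow> y \<in> U"
      proof (cases "box - U = {}")
        case True
        then show ?thesis using that[of 1] by auto
      next
        case False
        then obtain y where y: "y \<in> box - U" "\<And>z. z \<in> box - U \<Longrightarrow> defect y \<le> defect z"
          using continuous_attains_inf[OF cU _ continuous_defect] by blast
        have "defect y \<noteq> 0"
        proof
          assume "defect y = 0"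
          then have "y \<in> feasible_set C rho" "\<And>z. z \<in> feasible_set C rho \<Longrightarrow> z \<noteq> y \<Longrightarrow> L_fun C a y < L_fun C a z"
            using zero_defect_strict_min[of y] y(1) by auto
          then have "y = x" using min by (metis less_asym)
          then show False using y(1) \<epsilon> by (simp add: U_def)
        qed
        then have "defect y > 0" using defect_nonneg[of y] by simp
        then show ?thesis using that[of "defect y"] y(2) by (meson DiffI not_less)
      qed
      define \<delta> where "\<delta> = min 1 (\<eta> / defect_const)"
      have \<delta>: "\<delta> > 0" using \<eta> defect_const_pos by (simp add: \<delta>_def)
      have near: "\<bar>f (fluid (r n) X) - f x\<bar> \<le> \<epsilon> / 2" if "X \<in> states C" "slack (r n) X < \<delta>" for X n
        using \<eta>(2)[OF small_slack[OF assms(8) that(1) \<eta>(1) that(2)[unfolded \<delta>_def]]] by (simp add: U_def)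
      have bound: "\<bar>measure_pmf.expectation (p n) (\<lambda>X. f (fluid (r n) X)) - f x\<bar> \<le> \<epsilon> / 2 + 2 * M / \<delta> * m n" for n
        unfolding m_def by (rule stationary_grand.expectation_near[OF st M \<delta>]) (use \<epsilon> near in auto)
      have "(\<lambda>n. 2 * M / \<delta> * m n) \<longlonglongrightarrow> 2 * M / \<delta> * 0" by (intro tendsto_intros m_lim)
      then have "\<forall>\<^sub>F n in sequentially. 2 * M / \<delta> * m n < \<epsilon> / 2"
        by (rule order_tendstoD) (use \<epsilon> in simp)
      then show "\<forall>\<^sub>F n in sequentially. dist (measure_pmf.expectation (p n) (\<lambda>X. f (fluid (r n) X))) (f x) < \<epsilon>"
      proof eventually_elim
        case (elim n)
        then show ?case using bound[of n] unfolding dist_real_def by linarith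
      qed
    qed
    then show "(\<lambda>n. measure_pmf.expectation (fluid_scaled (r n) (p n)) f)
        \<longlonglongrightarrow> measure_pmf.expectation (return_pmf x) f"
      unfolding ex by simp
  qed
  then show ?thesis using ex1 unfolding arg by simp
qed

end
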